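(* Let $\Sigma=(\mathbb{R}^n,\mathsf{U},\mathcal{U},f)$ be a smooth control system on $\mathbb{R}^n$ equipped with a Riemannian metric $G$, let $\mathsf{U}$ be a convex set, and suppose that $(\mathbb{R}^n,\mathbf{d}_G)$ is a complete metric space, where $\mathbf{d}_G$ is the Riemannian distance function of $G$. If $G$ is a contraction metric, with respect to states and inputs, for $\Sigma$, then $\Sigma$ is $\delta_\exists$-ISS. If $G$ is a contraction metric, with respect to states, for $\Sigma$, then $\Sigma$ is $\delta_\exists$-GAS.
   Context: Control systems. A control system is a quadruple $\Sigma=(\mathbb{R}^n,\mathsf{U},\mathcal{U},f)$ where $\mathbb{R}^n$ is the state space; $\mathsf{U}\subseteq\mathbb{R}^m$ is the input set; $\mathcal{U}$ is the set of all measurable, locally essentially bounded functions of time from intervals $]a,b[\subseteq\mathbb{R}$, with $a<0<b$, to $\mathsf{U}$; and $f:\mathbb{R}^n\times\mathsf{U}\to\mathbb{R}^n$ is continuous and such that for every compact $Q\subset\mathbb{R}^n$ there is $Z>0$ with $\|f(x,u)-f(y,u)\|\le Z\|x-y\|$ for all $x,y\in Q$, $u\in\mathsf{U}$. $\Sigma$ is smooth if $f$ is smooth (infinitely differentiable). A curve $\xi:]a,b[\to\mathbb{R}^n$ is a trajectory of $\Sigma$ if there is $\upsilon\in\mathcal{U}$ with $\dot\xi(t)=f(\xi(t),\upsilon(t))$ for almost all $t\in]a,b[$. $\xi_{x\upsilon}(t)$ denotes the (unique) point reached at time $t$ under input $\upsilon$ from $x=\xi_{x\upsilon}(0)$. $\Sigma$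 is forward complete if every trajectory is defined on an interval of the form $]a,\infty[$. $\|g\|_\infty$ denotes the essential supremum of $\|g(t)\|$ over $t\ge0$, with $\|\cdot\|$ the Euclidean norm. Comparison functions. A continuous $\gamma:\mathbb{R}_0^+\to\mathbb{R}_0^+$ is of class $\mathcal{K}$ if it is strictly increasing with $\gamma(0)=0$, and of class $\mathcal{K}_\infty$ if moreover $\gamma(r)\to\infty$ as $r\to\infty$. A continuous $\beta:\mathbb{R}_0^+\times\mathbb{R}_0^+\to\mathbb{R}_0^+$ is of class $\mathcal{KL}$ if $\beta(\cdot,s)\in\mathcal{K}_\infty$ for each fixed $s$, and for each fixed $r\ne0$ the map $s\mapsto\beta(r,s)$ is decreasing with $\beta(r,s)\to0$ as $s\to\infty$. Stability. $\Sigma$ is $\delta_\exists$-GAS if it is forward complete and there exist a metric $\mathbf{d}$ on $\mathbb{R}^n$ and $\beta\in\mathcal{KL}$ such that $\mathbf{d}(\xi_{x\upsilon}(t),\xi_{x'\upsilon}(t))\le\beta(\mathbf{d}(x,x'),t)$ for all $t\ge0$, $x,x'\in\mathbb{R}^n$, $\upsilon\in\mathcal{U}$. $\Sigma$ is $\delta_\exists$-ISS if it is forward complete and there exist a metric $\mathbf{d}$ on $\mathbb{R}^n$, $\beta\in\mathcal{KL}$ and $\gamma\in\mathcal{K}_\infty$ such that $\mathbf{d}(\xi_{x\upsilon}(t),\xi_{x'\upsilon'}(t))\le\beta(\mathbf{d}(x,x'),t)+\gamma(\|\upsilon-\upsilon'\|_\infty)$ for all $t\ge0$, $x,x'\in\mathbb{R}^n$,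 $\upsilon,\upsilon'\in\mathcal{U}$. Riemannian metrics. A Riemannian metric is a smooth map $G:\mathbb{R}^n\to\mathbb{R}^{n\times n}$ with $G(x)$ symmetric positive definite for every $x$. $\mathbf{d}_G(x,y)$ is the infimum of $\int_0^1\sqrt{\chi'(s)^TG(\chi(s))\chi'(s)}\,ds$ over all piecewise smooth (continuous, and smooth on the open pieces of a finite partition) curves $\chi:[0,1]\to\mathbb{R}^n$ with $\chi(0)=x$, $\chi(1)=y$. Write $\langle I,J\rangle_H=I^THJ$ for any matrix $H$ (not necessarily positive definite). Contraction metrics. Let $F(x,u)=\left(\frac{\partial f}{\partial x}\right)^TG(x)+G(x)\frac{\partial f}{\partial x}+\frac{\partial G}{\partial x}f(x,u)$, where $\frac{\partial G}{\partial x}f$ is the matrix with entries $\sum_k\frac{\partial G_{ij}}{\partial x_k}f_k$. $G$ is a contraction metric with respect to states for the smooth control system $\Sigma$ if there is $\widehat\lambda>0$ with $\langle X,X\rangle_F\le-\widehat\lambda\langle X,X\rangle_G$ for all $u\in\mathsf{U}$, $X\in\mathbb{R}^n$, $x\in\mathbb{R}^n$. $G$ is a contraction metric with respect to states and inputs for $\Sigma$ if there are $\widehat\lambda>0$ and $\alpha\ge0$ with $\langle X,X\rangle_F+2\left\langle\frac{\partial f}{\partial u}Y,X\right\rangle_G\le-\widehat\lambda\langle X,X\rangle_G+\alpha\langle X,X\rangle_G^{1/2}\langle Y,Y\rangle_{I_m}^{1/2}$ for all $X,x\in\mathbb{R}^n$, $u\in\mathsf{U}$, $Y\in\mathbb{R}^m$,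 where $I_m$ is the $m\times m$ identity matrix.
   Formalization: "Locally essentially bounded" inputs are taken to have, on each compact time interval, almost all values in a compact subset of U; for non-closed U mere norm boundedness makes the GAS claim false (U=]0,1[, f=-x+1/u, G=1). *)

theory Defs
  imports "HOL-Analysis.Analysis" "HOL-Probability.Essential_Supremum"
begin

section \<open>Smooth maps\<close>

text \<open>
  Only meaningful for open \<open>S\<close>. The iterated directional derivatives of order at most \<open>k\<close> all exist
  as (total) Frechet derivatives on \<open>S\<close> and those of order \<open>k\<close> are continuous.
\<close>

primrec Ck_on :: "nat \<Rightarrow> 'a::real_normed_vector set \<Rightarrow> ('a \<Rightarrow> 'b::real_normed_vector) \<Rightarrow> bool" where
  "Ck_on 0 S g \<longleftrightarrow> continuous_on S g"
| "Ck_on (Suc k) S g \<longleftrightarrow> (\<forall>x\<in>S. g differentiable (at x)) \<and>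
     (\<forall>v. Ck_on k S (\<lambda>x. frechet_derivative g (at x) v))"

definition smooth_on :: "'a::real_normed_vector set \<Rightarrow> ('a \<Rightarrow> 'b::real_normed_vector) \<Rightarrow> bool" where
  "smooth_on S g \<longleftrightarrow> (\<forall>k. Ck_on k S g)"

section \<open>Comparison functions\<close>

definition class_K :: "(real \<Rightarrow> real) \<Rightarrow> bool" where
  "class_K \<gamma> \<longleftrightarrow> continuous_on {0..} \<gamma> \<and> strict_mono_on {0..} \<gamma> \<and> \<gamma> 0 = 0"

definition class_Kinf :: "(real \<Rightarrow> real) \<Rightarrow> bool" where
  "class_Kinf \<gamma> \<longleftrightarrow> class_K \<gamma> \<and> filterlim \<gamma> at_top at_top"

definition class_KL :: "(real \<Rightarrow> real \<Rightarrow> real) \<Rightarrow> bool" where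
  "class_KL \<beta> \<longleftrightarrow> continuous_on ({0..} \<times> {0..}) (\<lambda>(r, s). \<beta> r s) \<and>
     (\<forall>s\<ge>0. class_Kinf (\<lambda>r. \<beta> r s)) \<and>
     (\<forall>r>0. antimono_on {0..} (\<beta> r) \<and> (\<beta> r \<longlongrightarrow> 0) at_top)"

section \<open>Control systems\<close>

definition control_system :: "(real^'m) set \<Rightarrow> (real^'n \<Rightarrow> real^'m \<Rightarrow> real^'n) \<Rightarrow> bool" where
  "control_system U f \<longleftrightarrow> continuous_on (UNIV \<times> U) (\<lambda>(x, u). f x u) \<and>
     (\<forall>Q. compact Q \<longrightarrow>
       (\<exists>Z>0. \<forall>x\<in>Q. \<forall>y\<in>Q. \<forall>u\<in>U. norm (f x u - f y u) \<le> Z * norm (x - y)))"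

text \<open>
  Since \<open>U\<close> need not be open, smoothness of \<open>f\<close> on \<open>\<real>\<^sup>n \<times> U\<close> means smoothness on some open
  neighbourhood of that set. In particular the partial derivatives at points of \<open>\<real>\<^sup>n \<times> U\<close> are
  ordinary derivatives; values of \<open>f\<close> outside of the neighbourhood are irrelevant.
\<close>

definition smooth_control_system :: "(real^'m) set \<Rightarrow> (real^'n \<Rightarrow> real^'m \<Rightarrow> real^'n) \<Rightarrow> bool" where
  "smooth_control_system U f \<longleftrightarrow> control_system U f \<and>
     (\<exists>W. open W \<and> UNIV \<times> U \<subseteq> W \<and> smooth_on W (\<lambda>(x, u). f x u))"

text \<open>
  \<open>is_input U a b \<upsilon>\<close>: \<open>\<upsilon>\<close> restricted to \<open>]a,b[\<close> is a measurable, locally essentially bounded function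
  into \<open>U\<close>; the endpoints may be infinite. As usual for control systems with an arbitrary input
  set (Sontag, Mathematical Control Theory), a function into \<open>U\<close> is essentially bounded if
  almost all of its values lie in a compact subset of \<open>U\<close>. For closed \<open>U\<close> this is essential
  boundedness of the norm. For other \<open>U\<close> mere boundedness of the norm does not ensure that
  solutions exist: for \<open>U = ]0,1[\<close> and \<open>f x u = - x + 1 / u\<close>, an input which is \<open>(t - 1)\<^sup>2\<close>
  near \<open>t = 1\<close> (except at \<open>t = 1\<close>) has no trajectory passing through time \<open>1\<close>, although \<open>f\<close> is
  smooth and contracting in \<open>x\<close>.
\<close>

definition is_input :: "(real^'m) set \<Rightarrow> ereal \<Rightarrow> ereal \<Rightarrow> (real \<Rightarrow> real^'m) \<Rightarrow> bool" where
  "is_input U a b \<upsilon> \<longleftrightarrow> a < 0 \<and> 0 < b \<and> (\<forall>t\<in>einterval a b. \<upsilon> t \<in> U) \<and>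
     \<upsilon> \<in> borel_measurable (lebesgue_on (einterval a b)) \<and>
     (\<forall>c d. {c..d} \<subseteq> einterval a b \<longrightarrow>
       (\<exists>K. compact K \<and> K \<subseteq> U \<and> (AE t in lebesgue_on {c..d}. \<upsilon> t \<in> K)))"

definition abs_continuous_on :: "real \<Rightarrow> real \<Rightarrow> (real \<Rightarrow> 'a::real_normed_vector) \<Rightarrow> bool" where
  "abs_continuous_on c d g \<longleftrightarrow>
     (\<forall>\<epsilon>>0. \<exists>\<delta>>0. \<forall>D T. D division_of T \<and> T \<subseteq> {c..d} \<and> (\<Sum>I\<in>D. Sup I - Inf I) < \<delta> \<longrightarrow>
        (\<Sum>I\<in>D. norm (g (Sup I) - g (Inf I))) < \<epsilon>)"

text \<open>
  \<open>\<xi>\<close> is a trajectory on \<open>]a,b[\<close> with input \<open>\<upsilon>\<close>. Trajectories are solutions in the sense of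
  Caratheodory: local absolute continuity is part of the notion.
\<close>

definition trajectory ::
  "(real^'m) set \<Rightarrow> (real^'n \<Rightarrow> real^'m \<Rightarrow> real^'n) \<Rightarrow> ereal \<Rightarrow> ereal \<Rightarrow>
   (real \<Rightarrow> real^'m) \<Rightarrow> (real \<Rightarrow> real^'n) \<Rightarrow> bool" where
  "trajectory U f a b \<upsilon> \<xi> \<longleftrightarrow> is_input U a b \<upsilon> \<and>
     (\<forall>c d. {c..d} \<subseteq> einterval a b \<longrightarrow> abs_continuous_on c d \<xi>) \<and>
     (AE t in lebesgue_on (einterval a b). (\<xi> has_vector_derivative f (\<xi> t) (\<upsilon> t)) (at t))"

text \<open>
  For every input defined for all positive times: each initial state has a trajectory, and every
  trajectory, on whatever interval it is given, is defined up to time \<open>\<infinity>\<close>.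
\<close>

definition forward_complete :: "(real^'m) set \<Rightarrow> (real^'n \<Rightarrow> real^'m \<Rightarrow> real^'n) \<Rightarrow> bool" where
  "forward_complete U f \<longleftrightarrow> (\<forall>a \<upsilon>. is_input U a \<infinity> \<upsilon> \<longrightarrow>
     (\<forall>x. \<exists>c\<ge>a. \<exists>\<xi>. trajectory U f c \<infinity> \<upsilon> \<xi> \<and> \<xi> 0 = x) \<and>
     (\<forall>c\<ge>a. \<forall>b \<xi>. trajectory U f c b \<upsilon> \<xi> \<longrightarrow>
        (\<exists>\<zeta>. trajectory U f c \<infinity> \<upsilon> \<zeta> \<and> (\<forall>t\<in>einterval c b. \<zeta> t = \<xi> t))))"

text \<open>
  The essential supremum of \<open>\<parallel>g t\<parallel>\<close> over the times \<open>t \<ge> 0\<close> in the domain \<open>]a,b[\<close> of \<open>g\<close>;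
  it may be infinite.
\<close>

definition sup_norm :: "ereal \<Rightarrow> ereal \<Rightarrow> (real \<Rightarrow> real^'m) \<Rightarrow> ennreal" where
  "sup_norm a b g = esssup (lebesgue_on (einterval a b \<inter> {0..})) (\<lambda>t. ennreal (norm (g t)))"

section \<open>Incremental stability\<close>

text \<open>
  Instead of the point \<open>\<xi>\<^bsub>x\<upsilon>\<^esub> t\<close> reached from \<open>x\<close>, we quantify over all trajectories and
  their initial values. Inputs on intervals with a finite right endpoint are included, for the times
  at which they are defined; two inputs are compared on a common domain.
\<close>

definition delta_GAS :: "(real^'m) set \<Rightarrow> (real^'n \<Rightarrow> real^'m \<Rightarrow> real^'n) \<Rightarrow> bool" where
  "delta_GAS U f \<longleftrightarrow> forward_complete U f \<and>
     (\<exists>d \<beta>. Metric_space (UNIV :: (real^'n) set) d \<and> class_KL \<beta> \<and>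
       (\<forall>a b \<upsilon> \<xi> \<xi>' t. trajectory U f a b \<upsilon> \<xi> \<and> trajectory U f a b \<upsilon> \<xi>' \<and> 0 \<le> t \<and> ereal t < b \<longrightarrow>
          d (\<xi> t) (\<xi>' t) \<le> \<beta> (d (\<xi> 0) (\<xi>' 0)) t))"

text \<open>If the supremum norm is infinite, the bound holds trivially, \<open>\<gamma>\<close> being unbounded.\<close>

definition delta_ISS :: "(real^'m) set \<Rightarrow> (real^'n \<Rightarrow> real^'m \<Rightarrow> real^'n) \<Rightarrow> bool" where
  "delta_ISS U f \<longleftrightarrow> forward_complete U f \<and>
     (\<exists>d \<beta> \<gamma>. Metric_space (UNIV :: (real^'n) set) d \<and> class_KL \<beta> \<and> class_Kinf \<gamma> \<and>
       (\<forall>a b \<upsilon> \<upsilon>' \<xi> \<xi>' t. trajectory U f a b \<upsilon> \<xi> \<and> trajectory U f a b \<upsilon>' \<xi>' \<and> 0 \<le> t \<and> ereal t < b \<and>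
          sup_norm a b (\<lambda>s. \<upsilon> s - \<upsilon>' s) < \<infinity> \<longrightarrow>
          d (\<xi> t) (\<xi>' t) \<le> \<beta> (d (\<xi> 0) (\<xi>' 0)) t + \<gamma> (enn2real (sup_norm a b (\<lambda>s. \<upsilon> s - \<upsilon>' s)))))"

section \<open>Riemannian metrics\<close>

definition form :: "real^'k^'k \<Rightarrow> real^'k \<Rightarrow> real^'k \<Rightarrow> real" where
  "form H I J = I \<bullet> (H *v J)"

definition riemannian_metric :: "(real^'n \<Rightarrow> real^'n^'n) \<Rightarrow> bool" where
  "riemannian_metric G \<longleftrightarrow> smooth_on UNIV G \<and>
     (\<forall>x. transpose (G x) = G x \<and> (\<forall>v. v \<noteq> 0 \<longrightarrow> 0 < form (G x) v v))"

definition piecewise_smooth_curve :: "(real \<Rightarrow> real^'n) \<Rightarrow> bool" where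
  "piecewise_smooth_curve \<phi> \<longleftrightarrow> continuous_on {0..1} \<phi> \<and>
     (\<exists>P. finite P \<and> smooth_on ({0<..<1} - P) \<phi>)"

text \<open>
  The length is a nonnegative extended real: the derivative of a piecewise smooth curve may be
  unbounded near the partition points, so a curve can have infinite length.
\<close>

definition curve_length :: "(real^'n \<Rightarrow> real^'n^'n) \<Rightarrow> (real \<Rightarrow> real^'n) \<Rightarrow> ennreal" where
  "curve_length G \<phi> = (\<integral>\<^sup>+ s. ennreal (sqrt (form (G (\<phi> s))
      (vector_derivative \<phi> (at s)) (vector_derivative \<phi> (at s)))) \<partial>(lebesgue_on {0..1}))"

definition riemannian_dist :: "(real^'n \<Rightarrow> real^'n^'n) \<Rightarrow> real^'n \<Rightarrow> real^'n \<Rightarrow> real" where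
  "riemannian_dist G x y =
     enn2real (INF \<phi> \<in> {\<phi>. piecewise_smooth_curve \<phi> \<and> \<phi> 0 = x \<and> \<phi> 1 = y}. curve_length G \<phi>)"

section \<open>Contraction metrics\<close>

definition jac_x :: "(real^'n \<Rightarrow> real^'m \<Rightarrow> real^'n) \<Rightarrow> real^'n \<Rightarrow> real^'m \<Rightarrow> real^'n^'n" where
  "jac_x f x u = jacobian (\<lambda>y. f y u) (at x)"

definition jac_u :: "(real^'n \<Rightarrow> real^'m \<Rightarrow> real^'n) \<Rightarrow> real^'n \<Rightarrow> real^'m \<Rightarrow> real^'m^'n" where
  "jac_u f x u = jacobian (\<lambda>w. f x w) (at u)"

definition contraction_matrix ::
  "(real^'n \<Rightarrow> real^'m \<Rightarrow> real^'n) \<Rightarrow> (real^'n \<Rightarrow> real^'n^'n) \<Rightarrow> real^'n \<Rightarrow> real^'m \<Rightarrow> real^'n^'n" where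
  "contraction_matrix f G x u =
     transpose (jac_x f x u) ** G x + G x ** jac_x f x u +
     (\<chi> i j. \<Sum>k\<in>UNIV. frechet_derivative (\<lambda>y. G y $ i $ j) (at x) (axis k 1) * f x u $ k)"

definition contraction_metric_states ::
  "(real^'m) set \<Rightarrow> (real^'n \<Rightarrow> real^'m \<Rightarrow> real^'n) \<Rightarrow> (real^'n \<Rightarrow> real^'n^'n) \<Rightarrow> bool" where
  "contraction_metric_states U f G \<longleftrightarrow>
     (\<exists>lam>0. \<forall>u\<in>U. \<forall>X x. form (contraction_matrix f G x u) X X \<le> - lam * form (G x) X X)"

definition contraction_metric_states_inputs ::
  "(real^'m) set \<Rightarrow> (real^'n \<Rightarrow> real^'m \<Rightarrow> real^'n) \<Rightarrow> (real^'n \<Rightarrow> real^'n^'n) \<Rightarrow> bool" where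
  "contraction_metric_states_inputs U f G \<longleftrightarrow>
     (\<exists>lam>0. \<exists>\<alpha>\<ge>0. \<forall>X x. \<forall>u\<in>U. \<forall>Y.
        form (contraction_matrix f G x u) X X + 2 * form (G x) (jac_u f x u *v Y) X
          \<le> - lam * form (G x) X X + \<alpha> * sqrt (form (G x) X X) * sqrt (form (mat 1) Y Y))"

end

theory Submission
  imports Defs
begin

text \<open>
  Both conclusions hold for the Riemannian distance \<open>d\<close> of \<open>G\<close>. Write \<open>|v|\<^sub>x\<close> for the norm
  \<open>(v\<^sup>T G(x) v)\<^bsup>1/2\<^esup>\<close>.

  Contraction. For two nearby solutions \<open>\<xi>, \<zeta>\<close> with nearby inputs \<open>u, w\<close>, the hypothesis, applied to
  \<open>X = \<zeta> - \<xi>\<close> and \<open>Y = w - u\<close>, bounds the derivative of \<open>E = |\<zeta> - \<xi>|\<^sub>\<xi>\<^sup>2\<close> by \<open>- \<lambda> E + \<alpha> \<surd>E |Y|\<close>, up to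
  linearisation errors that are small compared with these terms (\<open>contraction_of_differences\<close>). Hence
  \<open>|\<zeta> - \<xi>|\<^sub>\<xi>\<close> decays exponentially up to a multiple of \<open>sup |Y|\<close> (\<open>pair_contraction\<close>). For two arbitrary
  solutions, take an almost shortest curve between their initial states, inscribe a fine polygon
  (\<open>riemannian_dist_polygon\<close>), interpolate linearly between the two inputs, which is possible because
  \<open>U\<close> is convex, and let the vertices flow. Neighbouring vertices stay close to each other, so that
  the estimate for pairs applies to them; adding up over the polygon bounds \<open>d\<close> at later times
  (\<open>segment_contraction\<close>, \<open>trajectory_estimate\<close>). Working with differences of solutions instead of the
  variational equation avoids differentiating the flow of an equation that is only measurable in
  time with respect to the initial state.

  Forward completeness. The solution from the origin exists for a short time that depends only on
  a compact set containing the values of the input. Existence spreads from the origin to any state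
  \<open>x\<close> along the segment of states \<open>\<sigma> x\<close>: the set of good \<open>\<sigma>\<close> is open by Gronwall's
  inequality, and it is closed because contraction makes the solutions a Cauchy family for \<open>d\<close>,
  uniformly in time. Since \<open>d\<close> is complete, they have a limit curve; this curve is continuous, hence
  bounded, which keeps the solutions in a compact set (\<open>solution_from_everywhere\<close>). Concatenation
  of short time intervals of equal length then reaches all positive times (\<open>solution_exists\<close>).

  For contraction with respect to states and for contraction with respect to states and inputs the
  argument is the same; they differ in the set \<open>V\<close> of input variations \<open>Y\<close> that are allowed, which is
  \<open>{0}\<close> or the whole space. The rate \<open>\<lambda> / 8\<close> and the factors 2, 4 and 8 come from
  crude estimates: only the existence of comparison functions is at stake.
\<close>

section \<open>Absolutely continuous functions\<close>

lemma continuous_on_compact_bound: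
  assumes "compact S" "continuous_on S g"
  obtains B where "B \<ge> 0" "\<And>s. s \<in> S \<Longrightarrow> norm (g s) \<le> B"
proof -
  have "bounded (g ` S)" using assms by (intro compact_imp_bounded compact_continuous_image)
  then obtain B where "\<forall>x\<in>g ` S. norm x \<le> B" unfolding bounded_iff by blast
  then show thesis using that[of "max B 0"] by (simp add: le_max_iff_disj)
qed

lemma abs_continuous_onE:
  assumes "abs_continuous_on a b g" "\<epsilon> > 0"
  obtains \<delta> where "\<delta> > 0"
    "\<And>D T. \<lbrakk>D division_of T; T \<subseteq> {a..b}; (\<Sum>I\<in>D. Sup I - Inf I) < \<delta>\<rbrakk> \<Longrightarrow>
       (\<Sum>I\<in>D. norm (g (Sup I) - g (Inf I))) < \<epsilon>"
proof -
  have "\<exists>\<delta>>0. \<forall>D T. D division_of T \<and> T \<subseteq> {a..b} \<and> (\<Sum>I\<in>D. Sup I - Inf I) < \<delta> \<longrightarrow>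
        (\<Sum>I\<in>D. norm (g (Sup I) - g (Inf I))) < \<epsilon>"
    using assms(1)[unfolded abs_continuous_on_def, THEN spec, THEN mp, OF assms(2)] .
  then obtain \<delta> where "\<delta> > 0" and *: "\<forall>D T. D division_of T \<and> T \<subseteq> {a..b} \<and> (\<Sum>I\<in>D. Sup I - Inf I) < \<delta> \<longrightarrow>
        (\<Sum>I\<in>D. norm (g (Sup I) - g (Inf I))) < \<epsilon>" by (elim exE conjE)
  show thesis
    by (rule that[OF \<open>\<delta> > 0\<close>]) (rule *[THEN spec, THEN spec, THEN mp], intro conjI)
qed

lemma abs_continuous_on_subinterval:
  assumes "abs_continuous_on a b g" "a \<le> c" "d \<le> b"
  shows "abs_continuous_on c d g"
  unfolding abs_continuous_on_def
proof (intro allI impI)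
  fix \<epsilon> :: real assume "\<epsilon> > 0"
  from abs_continuous_onE[OF assms(1) this] obtain \<delta> where \<delta>: "\<delta> > 0"
    "\<And>D T. \<lbrakk>D division_of T; T \<subseteq> {a..b}; (\<Sum>I\<in>D. Sup I - Inf I) < \<delta>\<rbrakk> \<Longrightarrow>
        (\<Sum>I\<in>D. norm (g (Sup I) - g (Inf I))) < \<epsilon>" by blast
  have "{c..d} \<subseteq> {a..b}" using assms by auto
  then show "\<exists>\<delta>>0. \<forall>D T. D division_of T \<and> T \<subseteq> {c..d} \<and> (\<Sum>I\<in>D. Sup I - Inf I) < \<delta> \<longrightarrow>
        (\<Sum>I\<in>D. norm (g (Sup I) - g (Inf I))) < \<epsilon>"
    using \<delta> by (intro exI[of _ \<delta>] conjI allI impI) (blast intro: order_trans)+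
qed

lemma division_real_intervalE:
  fixes D :: "real set set"
  assumes "D division_of T" "I \<in> D"
  obtains u v where "I = {u..v}" "u \<le> v" "Sup I = v" "Inf I = u"
proof -
  obtain u v where "I = cbox u v" "I \<noteq> {}" using assms division_ofD(3,4) by metis
  then show thesis using that[of u v] by auto
qed

lemma lipschitz_imp_abs_continuous_on:
  assumes "L-lipschitz_on {a..b} g" shows "abs_continuous_on a b g"
  unfolding abs_continuous_on_def
proof (intro allI impI)
  fix \<epsilon> :: real assume "\<epsilon> > 0"
  have L0: "L \<ge> 0" using assms lipschitz_on_nonneg by blast
  show "\<exists>\<delta>>0. \<forall>D T. D division_of T \<and> T \<subseteq> {a..b} \<and> (\<Sum>I\<in>D. Sup I - Inf I) < \<delta> \<longrightarrow>
        (\<Sum>I\<in>D. norm (g (Sup I) - g (Inf I))) < \<epsilon>"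
  proof (intro exI[of _ "\<epsilon> / (L + 1)"] conjI allI impI)
    show "\<epsilon> / (L + 1) > 0" using \<open>\<epsilon> > 0\<close> L0 by simp
    fix D T assume *: "D division_of T \<and> T \<subseteq> {a..b} \<and> (\<Sum>I\<in>D. Sup I - Inf I) < \<epsilon> / (L + 1)"
    have "(\<Sum>I\<in>D. norm (g (Sup I) - g (Inf I))) \<le> (\<Sum>I\<in>D. (L + 1) * (Sup I - Inf I))"
    proof (rule sum_mono)
      fix I assume I: "I \<in> D"
      obtain u v where uv: "I = {u..v}" "u \<le> v" "Sup I = v" "Inf I = u"
        using division_real_intervalE * I by blast
      have "I \<subseteq> {a..b}" using * I division_ofD(2) by blast
      then have "u \<in> {a..b}" "v \<in> {a..b}" using uv by auto
      then have "norm (g v - g u) \<le> L * (v - u)"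
        using lipschitz_onD[OF assms, of v u] uv by (simp add: dist_norm)
      also have "\<dots> \<le> (L + 1) * (v - u)" using uv by (simp add: algebra_simps)
      finally show "norm (g (Sup I) - g (Inf I)) \<le> (L + 1) * (Sup I - Inf I)" using uv by simp
    qed
    also have "\<dots> = (L + 1) * (\<Sum>I\<in>D. Sup I - Inf I)" by (simp add: sum_distrib_left)
    also have "\<dots> < \<epsilon>" using * L0 by (simp add: field_simps)
    finally show "(\<Sum>I\<in>D. norm (g (Sup I) - g (Inf I))) < \<epsilon>" .
  qed
qed

lemma abs_continuous_on_add:
  assumes "abs_continuous_on a b g" "abs_continuous_on a b h"
  shows "abs_continuous_on a b (\<lambda>t. g t + h t)"
  unfolding abs_continuous_on_def
proof (intro allI impI)
  fix \<epsilon> :: real assume "\<epsilon> > 0"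
  then have "\<epsilon> / 2 > 0" by simp
  from abs_continuous_onE[OF assms(1) this] obtain d1 where d1: "d1 > 0"
    "\<And>D T. \<lbrakk>D division_of T; T \<subseteq> {a..b}; (\<Sum>I\<in>D. Sup I - Inf I) < d1\<rbrakk> \<Longrightarrow>
        (\<Sum>I\<in>D. norm (g (Sup I) - g (Inf I))) < \<epsilon> / 2" by blast
  from abs_continuous_onE[OF assms(2) \<open>\<epsilon> / 2 > 0\<close>] obtain d2 where d2: "d2 > 0"
    "\<And>D T. \<lbrakk>D division_of T; T \<subseteq> {a..b}; (\<Sum>I\<in>D. Sup I - Inf I) < d2\<rbrakk> \<Longrightarrow>
        (\<Sum>I\<in>D. norm (h (Sup I) - h (Inf I))) < \<epsilon> / 2" by blast
  show "\<exists>\<delta>>0. \<forall>D T. D division_of T \<and> T \<subseteq> {a..b} \<and> (\<Sum>I\<in>D. Sup I - Inf I) < \<delta> \<longrightarrow>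
        (\<Sum>I\<in>D. norm (g (Sup I) + h (Sup I) - (g (Inf I) + h (Inf I)))) < \<epsilon>"
  proof (intro exI[of _ "min d1 d2"] conjI allI impI)
    fix D T assume *: "D division_of T \<and> T \<subseteq> {a..b} \<and> (\<Sum>I\<in>D. Sup I - Inf I) < min d1 d2"
    have "(\<Sum>I\<in>D. norm (g (Sup I) + h (Sup I) - (g (Inf I) + h (Inf I))))
      \<le> (\<Sum>I\<in>D. norm (g (Sup I) - g (Inf I)) + norm (h (Sup I) - h (Inf I)))"
      by (intro sum_mono) (simp only: add_diff_add norm_triangle_ineq)
    also have "\<dots> < \<epsilon>" using d1(2)[of D T] d2(2)[of D T] * by (simp add: sum.distrib)
    finally show "(\<Sum>I\<in>D. norm (g (Sup I) + h (Sup I) - (g (Inf I) + h (Inf I)))) < \<epsilon>" .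
  qed (use d1 d2 in auto)
qed

lemma abs_continuous_on_inner:
  assumes "abs_continuous_on a b g"
  shows "abs_continuous_on a b (\<lambda>t. w \<bullet> g t)"
  unfolding abs_continuous_on_def
proof (intro allI impI)
  fix \<epsilon> :: real assume "\<epsilon> > 0"
  then have "\<epsilon> / (norm w + 1) > 0" by (simp add: add_nonneg_pos)
  from abs_continuous_onE[OF assms this] obtain d where d: "d > 0"
    and dd: "\<And>D T. \<lbrakk>D division_of T; T \<subseteq> {a..b}; (\<Sum>I\<in>D. Sup I - Inf I) < d\<rbrakk> \<Longrightarrow>
        (\<Sum>I\<in>D. norm (g (Sup I) - g (Inf I))) < \<epsilon> / (norm w + 1)" by blast
  show "\<exists>\<delta>>0. \<forall>D T. D division_of T \<and> T \<subseteq> {a..b} \<and> (\<Sum>I\<in>D. Sup I - Inf I) < \<delta> \<longrightarrow>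
        (\<Sum>I\<in>D. norm (w \<bullet> g (Sup I) - w \<bullet> g (Inf I))) < \<epsilon>"
  proof (intro exI[of _ d] conjI allI impI)
    fix D T assume *: "D division_of T \<and> T \<subseteq> {a..b} \<and> (\<Sum>I\<in>D. Sup I - Inf I) < d"
    have "(\<Sum>I\<in>D. norm (w \<bullet> g (Sup I) - w \<bullet> g (Inf I)))
      \<le> (\<Sum>I\<in>D. (norm w + 1) * norm (g (Sup I) - g (Inf I)))"
    proof (intro sum_mono)
      fix I
      have "norm (w \<bullet> g (Sup I) - w \<bullet> g (Inf I)) \<le> norm w * norm (g (Sup I) - g (Inf I))"
        by (metis Cauchy_Schwarz_ineq2 inner_diff_right real_norm_def)
      also have "\<dots> \<le> (norm w + 1) * norm (g (Sup I) - g (Inf I))" by (intro mult_right_mono) auto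
      finally show "norm (w \<bullet> g (Sup I) - w \<bullet> g (Inf I)) \<le> (norm w + 1) * norm (g (Sup I) - g (Inf I))" .
    qed
    also have "\<dots> = (norm w + 1) * (\<Sum>I\<in>D. norm (g (Sup I) - g (Inf I)))" by (simp add: sum_distrib_left)
    also have "\<dots> < \<epsilon>"
      using dd[of D T] * pos_less_divide_eq[of "norm w + 1"] by (simp add: mult.commute add_nonneg_pos)
    finally show "(\<Sum>I\<in>D. norm (w \<bullet> g (Sup I) - w \<bullet> g (Inf I))) < \<epsilon>" .
  qed (use d in auto)
qed

lemma AE_lebesgue_on_exceptional_negligible:
  fixes S :: "real set"
  assumes "S \<in> sets lebesgue" "AE t in lebesgue_on S. P t"
  shows "negligible {t \<in> S. \<not> P t}"
proof -
  have "AE t in lebesgue. t \<in> S \<longrightarrow> P t"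
    using assms AE_restrict_space_iff[of S lebesgue P] by simp
  then obtain N where N: "N \<in> null_sets lebesgue" "{t. \<not> (t \<in> S \<longrightarrow> P t)} \<subseteq> N"
    unfolding eventually_ae_filter by auto
  show ?thesis
    by (rule negligible_subset[of N]) (use N in \<open>auto simp: negligible_iff_null_sets\<close>)
qed

lemma negligible_imp_AE_lebesgue_on:
  fixes S :: "real set"
  assumes "S \<in> sets lebesgue" "negligible N" "\<And>t. t \<in> S \<Longrightarrow> t \<notin> N \<Longrightarrow> P t"
  shows "AE t in lebesgue_on S. P t"
proof -
  have "AE t in lebesgue. t \<in> S \<longrightarrow> P t"
    using assms by (intro AE_I'[of N]) (auto simp: negligible_iff_null_sets)
  then show ?thesis using assms(1) by (simp add: AE_restrict_space_iff)
qed

text \<open>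
  The exceptional times form a null set. It lies in an open set so small that, by absolute
  continuity, the increments of \<open>h\<close> over intervals inside this set add up to at most \<open>\<epsilon>\<close>. Around every
  other time the increments are at most \<open>\<epsilon>\<close> times the length. By Cousin's lemma there is a division
  of \<open>[a,b]\<close> into intervals of these two kinds.
\<close>

lemma abs_continuous_nonincreasing:
  fixes h :: "real \<Rightarrow> real"
  assumes ab: "a \<le> b" and ac: "abs_continuous_on a b h"
    and der: "AE t in lebesgue_on {a..b}. \<exists>l\<le>0. (h has_real_derivative l) (at t)"
  shows "h b \<le> h a"
proof -
  define S where "S = {t \<in> {a..b}. \<not> (\<exists>l\<le>0. (h has_real_derivative l) (at t))}"
  have neg: "negligible S"
    unfolding S_def by (rule AE_lebesgue_on_exceptional_negligible[OF _ der]) simp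
  have "h b - h a \<le> \<epsilon> * (b - a) + \<epsilon>" if e: "\<epsilon> > 0" for \<epsilon>
  proof -
    obtain \<delta> where \<delta>: "\<delta> > 0"
      and ac': "\<And>D T. \<lbrakk>D division_of T; T \<subseteq> {a..b}; (\<Sum>I\<in>D. Sup I - Inf I) < \<delta>\<rbrakk> \<Longrightarrow>
         (\<Sum>I\<in>D. norm (h (Sup I) - h (Inf I))) < \<epsilon>"
      using abs_continuous_onE[OF ac e] by blast
    obtain W where W: "open W" "S \<subseteq> W" "W - S \<in> lmeasurable" "emeasure lebesgue (W - S) < ennreal \<delta>"
      using sets_lebesgue_outer_open[of S \<delta>] neg \<delta> negligible_iff_null_sets by blast
    have Wm: "W \<in> lmeasurable" "measure lebesgue W < \<delta>"
    proof -
      have "W = (W - S) \<union> S" using W by auto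
      moreover have "S \<in> lmeasurable" using neg by (simp add: negligible_imp_measurable)
      ultimately show 1: "W \<in> lmeasurable" using W(3) by (metis fmeasurable.Un)
      have "measure lebesgue (W - S) < \<delta>"
        using W(4) \<delta> unfolding emeasure_eq_measure2[OF W(3)] by (simp add: ennreal_less_iff)
      moreover have "measure lebesgue (W - S) = measure lebesgue W"
        using measure_Diff_null_set[OF fmeasurableD[OF 1]] neg unfolding negligible_iff_null_sets by blast
      ultimately show "measure lebesgue W < \<delta>" by simp
    qed
    have "\<exists>r>0. (x \<in> S \<longrightarrow> ball x r \<subseteq> W) \<and>
        (x \<in> {a..b} - S \<longrightarrow> (\<forall>u v. u \<le> x \<and> x \<le> v \<and> u \<in> ball x r \<and> v \<in> ball x r \<longrightarrow> h v - h u \<le> \<epsilon> * (v - u)))" for x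
    proof (cases "x \<in> {a..b} - S")
      case True
      then obtain l where l: "l \<le> 0" "(h has_real_derivative l) (at x)" unfolding S_def by auto
      then have "(h has_derivative (*) l) (at x)" by (simp add: has_field_derivative_def)
      then obtain r where r: "r > 0" "\<And>y. norm (y - x) < r \<Longrightarrow> norm (h y - h x - l * (y - x)) \<le> \<epsilon> * norm (y - x)"
        using e unfolding has_derivative_at_alt by blast
      have "h v - h u \<le> \<epsilon> * (v - u)" if "u \<le> x" "x \<le> v" "u \<in> ball x r" "v \<in> ball x r" for u v
      proof -
        have "norm (h v - h x - l * (v - x)) \<le> \<epsilon> * norm (v - x)" "norm (h u - h x - l * (u - x)) \<le> \<epsilon> * norm (u - x)"
          using that r(2)[of v] r(2)[of u] by (auto simp: dist_norm)
        then have "h v - h x \<le> l * (v - x) + \<epsilon> * (v - x)" "h x - h u \<le> l * (x - u) + \<epsilon> * (x - u)"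
          using that by (auto simp: abs_le_iff algebra_simps)
        moreover have "l * (v - x) \<le> 0" "l * (x - u) \<le> 0" using l that by (auto simp: mult_nonpos_nonneg)
        ultimately show ?thesis by (simp add: algebra_simps)
      qed
      then show ?thesis using r(1) True by auto
    next
      case False
      show ?thesis
      proof (cases "x \<in> S")
        case True
        then show ?thesis using W(1,2) open_contains_ball by (metis DiffD2 subsetD)
      qed (use False in \<open>auto intro: exI[of _ 1]\<close>)
    qed
    then obtain r where r0: "\<And>x. r x > 0" and rS: "\<And>x. x \<in> S \<Longrightarrow> ball x (r x) \<subseteq> W"
      and rd: "\<And>x u v. \<lbrakk>x \<in> {a..b} - S; u \<le> x; x \<le> v; u \<in> ball x (r x); v \<in> ball x (r x)\<rbrakk> \<Longrightarrow> h v - h u \<le> \<epsilon> * (v - u)"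
      by metis
    have "gauge (\<lambda>x. ball x (r x))" using r0 by (simp add: gauge_def)
    then obtain p where p: "p tagged_division_of {a..b}" "(\<lambda>x. ball x (r x)) fine p"
      using fine_division_exists_real by metis
    have fin: "finite p" using p by blast
    define pS where "pS = {(x, k) \<in> p. x \<in> S}"
    define pN where "pN = {(x, k) \<in> p. x \<notin> S}"
    have pu: "p = pS \<union> pN" "pS \<inter> pN = {}" by (auto simp: pS_def pN_def)
    have fS: "finite pS" "finite pN" using fin pu(1) by auto
    have elt: "\<exists>u v. k = {u..v} \<and> u \<le> x \<and> x \<le> v \<and> Sup k = v \<and> Inf k = u \<and> x \<in> {a..b} \<and>
        k \<subseteq> ball x (r x) \<and> k \<subseteq> {a..b}" if xk: "(x, k) \<in> p" for x k
    proof -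
      obtain u v where k: "k = {u..v}" using tagged_division_ofD(4)[OF p(1) xk] by auto
      have "x \<in> k" "k \<subseteq> {a..b}" using tagged_division_ofD(2,3)[OF p(1) that] by auto
      moreover have "k \<subseteq> ball x (r x)" using p(2) that by (auto simp: fine_def)
      ultimately show ?thesis using k by auto
    qed
    have "h b - h a = (\<Sum>(x, k)\<in>p. h (Sup k) - h (Inf k))"
      using additive_tagged_division_1[OF ab p(1), of h] by simp
    also have "\<dots> = (\<Sum>(x, k)\<in>pS. h (Sup k) - h (Inf k)) + (\<Sum>(x, k)\<in>pN. h (Sup k) - h (Inf k))"
      using pu fS by (metis (no_types, lifting) sum.union_disjoint)
    also have "(\<Sum>(x, k)\<in>pN. h (Sup k) - h (Inf k)) \<le> (\<Sum>(x, k)\<in>pN. \<epsilon> * (Sup k - Inf k))"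
    proof (rule sum_mono, clarify)
      fix x k assume "(x, k) \<in> pN"
      then have 1: "(x, k) \<in> p" "x \<notin> S" by (auto simp: pN_def)
      from elt[OF 1(1)] obtain u v where uv: "k = {u..v}" "u \<le> x" "x \<le> v" "Sup k = v" "Inf k = u" "x \<in> {a..b}" "k \<subseteq> ball x (r x)"
        by (elim exE conjE) (rule that)
      have "u \<in> k" "v \<in> k" using uv by auto
      then have "u \<in> ball x (r x)" "v \<in> ball x (r x)" using uv(7) by blast+
      then have "h v - h u \<le> \<epsilon> * (v - u)" using rd[of x u v] uv 1 by blast
      then show "h (Sup k) - h (Inf k) \<le> \<epsilon> * (Sup k - Inf k)" using uv by simp
    qed
    also have "\<dots> \<le> (\<Sum>(x, k)\<in>p. \<epsilon> * (Sup k - Inf k))"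
    proof (rule sum_mono2[OF fin])
      show "pN \<subseteq> p" using pu(1) by auto
      fix z assume "z \<in> p - pN"
      then obtain x k where z: "z = (x, k)" "(x, k) \<in> p" by (cases z) auto
      from elt[OF z(2)] obtain u v where "u \<le> x" "x \<le> v" "Sup k = v" "Inf k = u" by (elim exE conjE) (rule that)
      then show "0 \<le> (case z of (x, k) \<Rightarrow> \<epsilon> * (Sup k - Inf k))" using e z by simp
    qed
    also have "\<dots> = \<epsilon> * (b - a)"
      using additive_tagged_division_1[OF ab p(1), of "\<lambda>t. \<epsilon> * t"] by (simp add: algebra_simps)
    also have "(\<Sum>(x, k)\<in>pS. h (Sup k) - h (Inf k)) \<le> \<epsilon>"
    proof -
      have "pS tagged_partial_division_of {a..b}"
        by (rule tagged_partial_division_subset[of p]) (use p pu in \<open>auto simp: tagged_division_of_def\<close>)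
      then have td: "pS tagged_division_of \<Union>(snd ` pS)" by (rule tagged_partial_division_of_Union_self)
      then have dv: "snd ` pS division_of \<Union>(snd ` pS)" by (rule division_of_tagged_division)
      have sub: "\<Union>(snd ` pS) \<subseteq> {a..b}" using elt by (fastforce simp: pS_def)
      have "(\<Sum>I\<in>snd ` pS. Sup I - Inf I) = (\<Sum>I\<in>snd ` pS. measure lebesgue I)"
      proof (rule sum.cong)
        fix I assume "I \<in> snd ` pS"
        then obtain u v where "I = {u..v}" "u \<le> v" "Sup I = v" "Inf I = u" using division_real_intervalE[OF dv] by metis
        then show "Sup I - Inf I = measure lebesgue I" by auto
      qed auto
      also have "\<dots> = measure lebesgue (\<Union>(snd ` pS))"
        by (rule content_division[OF dv])
      also have "\<dots> \<le> measure lebesgue W"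
      proof (rule measure_mono_fmeasurable[OF _ _ Wm(1)])
        have "k \<subseteq> W" if "(x, k) \<in> pS" for x k
        proof -
          have "(x, k) \<in> p" "x \<in> S" using that by (auto simp: pS_def)
          then show ?thesis using elt[of x k] rS[of x] by blast
        qed
        then show "\<Union>(snd ` pS) \<subseteq> W" by (intro Union_least) (elim imageE, metis prod.collapse)
        show "\<Union>(snd ` pS) \<in> sets lebesgue"
          by (rule fmeasurableD[OF lmeasurable_division[OF dv]])
      qed
      finally have "(\<Sum>I\<in>snd ` pS. Sup I - Inf I) < \<delta>" using Wm by simp
      from ac'[OF dv sub this] have *: "(\<Sum>I\<in>snd ` pS. norm (h (Sup I) - h (Inf I))) < \<epsilon>" .
      \<comment> \<open>The division may be indexed by its intervals only if degenerate intervals contribute zero;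
        the empty interval is treated separately because \<open>Sup {}\<close> and \<open>Inf {}\<close> carry no meaning.\<close>
      define d where "d = (\<lambda>k :: real set. if k = {} then 0 else h (Sup k) - h (Inf k))"
      have "(\<Sum>(x, k)\<in>pS. h (Sup k) - h (Inf k)) = (\<Sum>(x, k)\<in>pS. d k)"
        by (rule sum.cong) (use tagged_division_ofD(2)[OF td] in \<open>fastforce simp: d_def\<close>)+
      also have "\<dots> = (\<Sum>I\<in>snd ` pS. d I)"
      proof (rule sum.over_tagged_division_lemma[OF td, of d])
        fix u v :: real assume uv: "box u v = {}"
        show "d (cbox u v) = 0" using uv by (cases "u = v") (auto simp: d_def)
      qed
      also have "\<dots> = (\<Sum>I\<in>snd ` pS. h (Sup I) - h (Inf I))"
        by (rule sum.cong) (use division_ofD(3)[OF dv] in \<open>auto simp: d_def\<close>)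
      also have "\<dots> \<le> (\<Sum>I\<in>snd ` pS. norm (h (Sup I) - h (Inf I)))" by (intro sum_mono) simp
      finally show ?thesis using * by simp
    qed
    finally show ?thesis by simp
  qed
  then have *: "h b - h a \<le> \<epsilon> * (b - a + 1)" if "\<epsilon> > 0" for \<epsilon> using that by (simp add: algebra_simps)
  show ?thesis
  proof (rule ccontr)
    assume "\<not> h b \<le> h a"
    then have "h b - h a \<le> ((h b - h a) / (2 * (b - a + 1))) * (b - a + 1)" using ab by (intro *) auto
    also have "\<dots> = (h b - h a) / 2" using ab by (simp add: field_simps)
    finally show False using \<open>\<not> h b \<le> h a\<close> by simp
  qed
qed

text \<open>
  With \<open>w = \<xi> t - \<xi> s\<close>, the function \<open>w \<bullet> \<xi> \<tau> - |w| M \<tau>\<close> is nonincreasing; its values at \<open>s\<close> and \<open>t\<close> give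
  \<open>|w|\<^sup>2 \<le> |w| M (t - s)\<close>.
\<close>

lemma abs_continuous_imp_lipschitz:
  fixes \<xi> :: "real \<Rightarrow> 'a::real_inner"
  assumes ac: "abs_continuous_on a b \<xi>" and M: "M \<ge> 0"
    and der: "AE t in lebesgue_on {a..b}. \<exists>v. norm v \<le> M \<and> (\<xi> has_vector_derivative v) (at t)"
  shows "M-lipschitz_on {a..b} \<xi>"
proof -
  have main: "norm (\<xi> t - \<xi> s) \<le> M * (t - s)" if st: "s \<in> {a..b}" "t \<in> {a..b}" "s \<le> t" for s t
  proof -
    define w where "w = \<xi> t - \<xi> s"
    define h where "h = (\<lambda>\<tau>. w \<bullet> \<xi> \<tau> + (- (norm w * M)) * \<tau>)"
    have "(norm w * M)-lipschitz_on {s..t} (\<lambda>\<tau>::real. (- (norm w * M)) * \<tau>)"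
      using M by (intro lipschitz_onI) (auto simp: dist_real_def abs_mult abs_minus_commute simp flip: right_diff_distrib minus_mult_left)
    then have "abs_continuous_on s t h"
      unfolding h_def using st
      by (intro abs_continuous_on_add abs_continuous_on_inner abs_continuous_on_subinterval[OF ac]
          lipschitz_imp_abs_continuous_on) auto
    moreover have "AE \<tau> in lebesgue_on {s..t}. \<exists>l\<le>0. (h has_real_derivative l) (at \<tau>)"
    proof (rule negligible_imp_AE_lebesgue_on)
      show "negligible {\<tau> \<in> {a..b}. \<not> (\<exists>v. norm v \<le> M \<and> (\<xi> has_vector_derivative v) (at \<tau>))}"
        by (rule AE_lebesgue_on_exceptional_negligible[OF _ der]) simp
      fix \<tau> assume "\<tau> \<in> {s..t}" "\<tau> \<notin> {\<tau> \<in> {a..b}. \<not> (\<exists>v. norm v \<le> M \<and> (\<xi> has_vector_derivative v) (at \<tau>))}"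
      then obtain v where v: "norm v \<le> M" "(\<xi> has_vector_derivative v) (at \<tau>)" using st by auto
      have "((\<lambda>\<tau>. w \<bullet> \<xi> \<tau>) has_vector_derivative w \<bullet> v) (at \<tau>)"
        using bounded_linear.has_vector_derivative[OF bounded_linear_inner_right v(2)] .
      then have "((\<lambda>\<tau>. w \<bullet> \<xi> \<tau>) has_real_derivative w \<bullet> v) (at \<tau>)"
        by (simp add: has_real_derivative_iff_has_vector_derivative)
      then have "(h has_real_derivative (w \<bullet> v + (- (norm w * M)))) (at \<tau>)"
        unfolding h_def by (auto intro!: derivative_eq_intros)
      moreover have "w \<bullet> v \<le> norm w * M"
        by (meson norm_cauchy_schwarz mult_left_mono norm_ge_zero order_trans v(1))
      ultimately show "\<exists>l\<le>0. (h has_real_derivative l) (at \<tau>)"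
        by (intro exI[of _ "w \<bullet> v + - (norm w * M)"]) simp
    qed simp
    ultimately have "h t \<le> h s" by (rule abs_continuous_nonincreasing[OF st(3)])
    then have "w \<bullet> (\<xi> t - \<xi> s) \<le> norm w * (M * (t - s))"
      by (simp add: h_def algebra_simps)
    then have "norm w * norm w \<le> norm w * (M * (t - s))"
      unfolding w_def[symmetric] dot_square_norm power2_eq_square .
    then show ?thesis unfolding w_def[symmetric] using M st
      by (cases "w = 0") auto
  qed
  show ?thesis
  proof (rule lipschitz_onI[OF _ M])
    fix s t assume "s \<in> {a..b}" "t \<in> {a..b}"
    then show "dist (\<xi> s) (\<xi> t) \<le> M * dist s t"
      using main[of s t] main[of t s] by (cases "s \<le> t") (auto simp: dist_norm norm_minus_commute)
  qed
qed

section \<open>Gronwall estimates\<close>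

abbreviation lipschitz_fun :: "real \<Rightarrow> real \<Rightarrow> (real \<Rightarrow> 'a::real_normed_vector) \<Rightarrow> bool" where
  "lipschitz_fun a b g \<equiv> \<exists>L. L-lipschitz_on {a..b} g"

lemma lipschitz_fun_mult:
  fixes g h :: "real \<Rightarrow> real"
  assumes "lipschitz_fun a b g" "lipschitz_fun a b h" shows "lipschitz_fun a b (\<lambda>t. g t * h t)"
proof -
  obtain A B where AB: "A-lipschitz_on {a..b} g" "B-lipschitz_on {a..b} h" using assms by blast
  have AB0: "A \<ge> 0" "B \<ge> 0" using AB lipschitz_on_nonneg by blast+
  obtain P where P: "P \<ge> 0" "\<And>t. t \<in> {a..b} \<Longrightarrow> norm (g t) \<le> P"
    by (rule continuous_on_compact_bound[OF compact_Icc lipschitz_on_continuous_on[OF AB(1)]]) (rule that, assumption+)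
  obtain Q where Q: "Q \<ge> 0" "\<And>t. t \<in> {a..b} \<Longrightarrow> norm (h t) \<le> Q"
    by (rule continuous_on_compact_bound[OF compact_Icc lipschitz_on_continuous_on[OF AB(2)]]) (rule that, assumption+)
  have "(A * Q + P * B)-lipschitz_on {a..b} (\<lambda>t. g t * h t)"
  proof (rule lipschitz_onI)
    show "0 \<le> A * Q + P * B" using AB0 P(1) Q(1) by simp
    fix s t assume st: "s \<in> {a..b}" "t \<in> {a..b}"
    have "\<bar>g s * h s - g t * h t\<bar> = \<bar>(g s - g t) * h s + g t * (h s - h t)\<bar>" by (simp add: algebra_simps)
    also have "\<dots> \<le> \<bar>g s - g t\<bar> * \<bar>h s\<bar> + \<bar>g t\<bar> * \<bar>h s - h t\<bar>" by (metis abs_mult abs_triangle_ineq)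
    also have "\<dots> \<le> (A * dist s t) * Q + P * (B * dist s t)"
      using lipschitz_onD[OF AB(1) st] lipschitz_onD[OF AB(2) st] P Q(1) Q(2)[OF st(1)] P(2)[OF st(2)] AB0
      by (intro add_mono mult_mono) (auto simp: dist_real_def)
    finally show "dist (g s * h s) (g t * h t) \<le> (A * Q + P * B) * dist s t"
      by (simp add: dist_real_def algebra_simps)
  qed
  then show ?thesis by blast
qed

lemma lipschitz_fun_exp:
  fixes k :: real
  shows "lipschitz_fun a b (\<lambda>t. exp (k * t))"
proof -
  have "continuous_on {a..b} (\<lambda>t. exp (k * t) * k)" by (intro continuous_intros)
  then obtain M where M: "M \<ge> 0" "\<And>t. t \<in> {a..b} \<Longrightarrow> norm (exp (k * t) * k) \<le> M"
    by (rule continuous_on_compact_bound[OF compact_Icc]) (rule that, assumption+)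
  have "norm (exp (k * y) - exp (k * x)) \<le> M * norm (y - x)" if "x \<in> {a..b}" "y \<in> {a..b}" for x y
    by (rule field_differentiable_bound[of "{a..b}" _ "\<lambda>t. exp (k * t) * k"])
      (use that M(2) in \<open>auto intro!: derivative_eq_intros\<close>)
  then have "M-lipschitz_on {a..b} (\<lambda>t. exp (k * t))"
    using M(1) by (intro lipschitz_onI) (auto simp: dist_norm norm_minus_commute)
  then show ?thesis by blast
qed

text \<open>
  The function \<open>(h s + c / k) exp (- k s)\<close> is nonincreasing. The constant \<open>k\<close> may be negative: then the
  lemma describes exponential decay.
\<close>

lemma lipschitz_gronwall:
  fixes h :: "real \<Rightarrow> real"
  assumes t: "t \<in> {a..b}" and lip: "L-lipschitz_on {a..b} h" and k: "k \<noteq> 0"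
    and der: "AE t in lebesgue_on {a..b}. \<exists>l. l \<le> k * h t + c \<and> (h has_real_derivative l) (at t)"
  shows "h t \<le> exp (k * (t - a)) * (h a + c / k) - c / k"
proof -
  define g where "g = (\<lambda>s. (h s + c / k) * exp (- k * s))"
  have "L-lipschitz_on {a..b} (\<lambda>s. h s + c / k)" using lip by (simp add: lipschitz_on_def)
  then have "lipschitz_fun a b g" unfolding g_def by (intro lipschitz_fun_mult lipschitz_fun_exp) blast
  then have "abs_continuous_on a b g" using lipschitz_imp_abs_continuous_on by blast
  then have ac: "abs_continuous_on a t g" by (rule abs_continuous_on_subinterval) (use t in auto)
  have "AE s in lebesgue_on {a..t}. \<exists>l\<le>0. (g has_real_derivative l) (at s)"
  proof (rule negligible_imp_AE_lebesgue_on)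
    let ?N = "{s \<in> {a..b}. \<not> (\<exists>l. l \<le> k * h s + c \<and> (h has_real_derivative l) (at s))}"
    show "negligible ?N" by (rule AE_lebesgue_on_exceptional_negligible[OF _ der]) simp
    fix s assume "s \<in> {a..t}" "s \<notin> ?N"
    then obtain l where l: "l \<le> k * h s + c" "(h has_real_derivative l) (at s)" using t by auto
    have "(g has_real_derivative (l * exp (- k * s) + (h s + c / k) * (exp (- k * s) * (- k)))) (at s)"
      unfolding g_def using l(2) by (auto intro!: derivative_eq_intros)
    moreover have "l * exp (- k * s) + (h s + c / k) * (exp (- k * s) * (- k)) = (l - (k * h s + c)) * exp (- k * s)"
      using k by (simp add: field_simps)
    moreover have "\<dots> \<le> 0" using l(1) by (simp add: mult_nonpos_nonneg)
    ultimately show "\<exists>l\<le>0. (g has_real_derivative l) (at s)" by metis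
  qed simp
  then have "g t \<le> g a" using abs_continuous_nonincreasing[OF _ ac] t by auto
  then have "(h t + c / k) * (exp (- k * t) * exp (k * t)) \<le> (h a + c / k) * (exp (- k * a) * exp (k * t))"
    unfolding g_def by (simp add: mult.assoc[symmetric] mult_right_mono)
  then show ?thesis by (simp add: algebra_simps flip: exp_add)
qed

text \<open>
  The squared distance \<open>h\<close> of the curves satisfies \<open>h' \<le> 2 Z \<surd>h (\<surd>h + D) \<le> 3 Z h + Z D\<^sup>2\<close>. Using the
  square avoids differentiating the norm at zero.
\<close>

lemma curve_gronwall:
  fixes \<xi> \<zeta> :: "real \<Rightarrow> 'a::real_inner"
  assumes t: "t \<in> {a..b}" and lip: "L-lipschitz_on {a..b} \<xi>" "M-lipschitz_on {a..b} \<zeta>" and Z: "Z > 0" and D: "D \<ge> 0"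
    and der: "AE t in lebesgue_on {a..b}. \<exists>v w. (\<xi> has_vector_derivative v) (at t) \<and> (\<zeta> has_vector_derivative w) (at t)
        \<and> norm (v - w) \<le> Z * (norm (\<xi> t - \<zeta> t) + D)"
  shows "(norm (\<xi> t - \<zeta> t))\<^sup>2 \<le> exp (3 * Z * (t - a)) * ((norm (\<xi> a - \<zeta> a))\<^sup>2 + D\<^sup>2)"
proof -
  define \<delta> where "\<delta> = (\<lambda>t. \<xi> t - \<zeta> t)"
  define h where "h = (\<lambda>t. \<delta> t \<bullet> \<delta> t)"
  have lipd: "(L + M)-lipschitz_on {a..b} \<delta>" unfolding \<delta>_def by (rule lipschitz_on_diff[OF lip])
  have LM: "L + M \<ge> 0" using lipd lipschitz_on_nonneg by blast
  obtain B where B: "\<And>s. s \<in> {a..b} \<Longrightarrow> norm (\<delta> s) \<le> B"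
    using continuous_on_compact_bound[OF compact_Icc lipschitz_on_continuous_on[OF lipd]] by blast
  have "(2 * (L + M) * \<bar>B\<bar>)-lipschitz_on {a..b} h"
  proof (rule lipschitz_onI)
    fix x y assume xy: "x \<in> {a..b}" "y \<in> {a..b}"
    have "h x - h y = (\<delta> x - \<delta> y) \<bullet> (\<delta> x + \<delta> y)" by (simp add: h_def algebra_simps inner_commute)
    also have "\<bar>\<dots>\<bar> \<le> norm (\<delta> x - \<delta> y) * norm (\<delta> x + \<delta> y)" by (rule Cauchy_Schwarz_ineq2)
    also have "\<dots> \<le> ((L + M) * dist x y) * (\<bar>B\<bar> + \<bar>B\<bar>)"
    proof (intro mult_mono)
      show "norm (\<delta> x - \<delta> y) \<le> (L + M) * dist x y" using lipschitz_onD[OF lipd xy] by (simp add: dist_norm)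
      show "norm (\<delta> x + \<delta> y) \<le> \<bar>B\<bar> + \<bar>B\<bar>"
        using norm_triangle_ineq[of "\<delta> x" "\<delta> y"] B[OF xy(1)] B[OF xy(2)] by linarith
    qed (use LM in auto)
    finally show "dist (h x) (h y) \<le> 2 * (L + M) * \<bar>B\<bar> * dist x y" by (simp add: dist_real_def algebra_simps)
  qed (use LM in simp)
  moreover have "AE t in lebesgue_on {a..b}. \<exists>l. l \<le> (3 * Z) * h t + Z * D\<^sup>2 \<and> (h has_real_derivative l) (at t)"
    using der
  proof (rule AE_mp, intro AE_I2 impI)
    fix t assume "\<exists>v w. (\<xi> has_vector_derivative v) (at t) \<and> (\<zeta> has_vector_derivative w) (at t)
        \<and> norm (v - w) \<le> Z * (norm (\<xi> t - \<zeta> t) + D)"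
    then obtain v w where vw: "(\<xi> has_vector_derivative v) (at t)" "(\<zeta> has_vector_derivative w) (at t)"
      "norm (v - w) \<le> Z * (norm (\<delta> t) + D)" unfolding \<delta>_def by blast
    have "(\<delta> has_vector_derivative (v - w)) (at t)" unfolding \<delta>_def using vw by (auto intro!: derivative_intros)
    then have "(h has_real_derivative (\<delta> t \<bullet> (v - w) + (v - w) \<bullet> \<delta> t)) (at t)"
      unfolding h_def has_real_derivative_iff_has_vector_derivative
      by (rule bounded_bilinear.has_vector_derivative[OF bounded_bilinear_inner, of \<delta> "v - w" _ _ \<delta> "v - w", rotated 1]) fact
    moreover have "\<delta> t \<bullet> (v - w) + (v - w) \<bullet> \<delta> t \<le> (3 * Z) * h t + Z * D\<^sup>2"
    proof -
      have "\<delta> t \<bullet> (v - w) \<le> norm (\<delta> t) * (Z * (norm (\<delta> t) + D))"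
        by (meson norm_cauchy_schwarz mult_left_mono norm_ge_zero order_trans vw(3))
      moreover have "h t = (norm (\<delta> t))\<^sup>2" by (simp add: h_def power2_norm_eq_inner)
      moreover have "2 * norm (\<delta> t) * D \<le> (norm (\<delta> t))\<^sup>2 + D\<^sup>2" by (rule sum_squares_bound)
      then have "Z * (2 * norm (\<delta> t) * D) \<le> Z * ((norm (\<delta> t))\<^sup>2 + D\<^sup>2)" using Z by (intro mult_left_mono) auto
      ultimately show ?thesis by (simp add: inner_commute algebra_simps power2_eq_square)
    qed
    ultimately show "\<exists>l. l \<le> (3 * Z) * h t + Z * D\<^sup>2 \<and> (h has_real_derivative l) (at t)" by blast
  qed
  ultimately have *: "h t \<le> exp ((3 * Z) * (t - a)) * (h a + Z * D\<^sup>2 / (3 * Z)) - Z * D\<^sup>2 / (3 * Z)"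
    using t Z by (intro lipschitz_gronwall) auto
  have "Z * D\<^sup>2 / (3 * Z) \<ge> 0" "Z * D\<^sup>2 / (3 * Z) \<le> D\<^sup>2" using Z by (auto simp: field_simps)
  then have "h t \<le> exp (3 * Z * (t - a)) * (h a + D\<^sup>2)"
    using * by (smt (verit) exp_gt_zero mult_left_mono)
  then show ?thesis by (simp add: h_def \<delta>_def power2_norm_eq_inner)
qed

section \<open>Caratheodory solutions of globally Lipschitz equations\<close>

text \<open>
  At almost every \<open>t\<close> the averages of \<open>f\<close> over the intervals \<open>[t, t + h]\<close> converge to \<open>f t\<close>; the same
  statement for \<open>f (- t)\<close> yields the intervals \<open>[t - h, t]\<close>.
\<close>

lemma indefinite_integral_ae_derivative:
  fixes f :: "real \<Rightarrow> 'a::euclidean_space"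
  assumes int: "\<And>a b. f integrable_on {a..b}"
  obtains N where "negligible N"
    "\<And>a t. t \<notin> N \<Longrightarrow> a < t \<Longrightarrow> ((\<lambda>s. integral {a..s} f) has_vector_derivative f t) (at t)"
proof -
  have "\<And>a b. f integrable_on cbox a b" using int by simp
  then obtain N1 where N1: "negligible N1"
    "\<And>x e. \<lbrakk>x \<notin> N1; 0 < e\<rbrakk> \<Longrightarrow> \<exists>d>0. \<forall>h. 0 < h \<and> h < d \<longrightarrow>
        norm (integral (cbox x (x + h *\<^sub>R One)) f /\<^sub>R h ^ DIM(real) - f x) < e"
    by (rule integrable_ccontinuous_explicit) blast
  define F where "F = (\<lambda>t. f (- t))"
  have "F integrable_on cbox a b" for a b
    unfolding F_def using Henstock_Kurzweil_Integration.integrable_reflect_real[where f = f and a = "-b" and b = "-a"] int by simp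
  then obtain N2 where N2: "negligible N2"
    "\<And>x e. \<lbrakk>x \<notin> N2; 0 < e\<rbrakk> \<Longrightarrow> \<exists>d>0. \<forall>h. 0 < h \<and> h < d \<longrightarrow>
        norm (integral (cbox x (x + h *\<^sub>R One)) F /\<^sub>R h ^ DIM(real) - F x) < e"
    by (rule integrable_ccontinuous_explicit) blast
  have comb: "integral {a..v} f - integral {a..u} f = integral {u..v} f" if "a \<le> u" "u \<le> v" for a u v
    using Henstock_Kurzweil_Integration.integral_combine[OF that int] by (simp add: algebra_simps)
  show thesis
  proof
    show "negligible (N1 \<union> uminus ` N2)"
      using N1(1) N2(1)
      by (intro negligible_Un negligible_differentiable_image_negligible)
        (auto intro: derivative_intros simp: differentiable_on_def)
    fix a t :: real assume t: "t \<notin> N1 \<union> uminus ` N2" and at: "a < t"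
    then have t1: "t \<notin> N1" and t2: "- t \<notin> N2" by force+
    show "((\<lambda>s. integral {a..s} f) has_vector_derivative f t) (at t)"
      unfolding has_vector_derivative_def has_derivative_at_alt
    proof (intro conjI allI impI)
      show "bounded_linear (\<lambda>x. x *\<^sub>R f t)" by (rule bounded_linear_scaleR_left)
      fix e :: real assume e: "e > 0"
      obtain d1 where d1: "d1 > 0" "\<And>h. 0 < h \<Longrightarrow> h < d1 \<Longrightarrow> norm (integral {t..t + h} f /\<^sub>R h - f t) < e"
        using N1(2)[OF t1 e] by auto
      obtain d2 where d2: "d2 > 0" "\<And>h. 0 < h \<Longrightarrow> h < d2 \<Longrightarrow> norm (integral {- t..- t + h} (\<lambda>t. f (- t)) /\<^sub>R h - f t) < e"
        using N2(2)[OF t2 e] by (auto simp: F_def)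
      have sc: "norm (I - h *\<^sub>R f t) \<le> e * h" if "norm (I /\<^sub>R h - f t) < e" "h > 0" for I h
      proof -
        have "I - h *\<^sub>R f t = h *\<^sub>R (I /\<^sub>R h - f t)" using that by (simp add: algebra_simps)
        then have "norm (I - h *\<^sub>R f t) = h * norm (I /\<^sub>R h - f t)" using that by simp
        then show ?thesis using that by (simp add: mult.commute)
      qed
      have "norm (integral {a..y} f - integral {a..t} f - (y - t) *\<^sub>R f t) \<le> e * norm (y - t)"
        if y: "norm (y - t) < min (min d1 d2) (t - a)" for y
      proof -
        consider "y = t" | "y > t" | "y < t" by linarith
        then show ?thesis
        proof cases
          case 2
          then have "norm (integral {t..y} f - (y - t) *\<^sub>R f t) \<le> e * (y - t)"
            using sc[OF d1(2)[of "y - t"]] y by simp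
          then show ?thesis using comb[of a t y] 2 at by simp
        next
          case 3
          have "integral {- t..- t + (t - y)} (\<lambda>t. f (- t)) = integral {y..t} f"
            using Henstock_Kurzweil_Integration.integral_reflect_real[of t y f] by simp
          then have "norm (integral {y..t} f - (t - y) *\<^sub>R f t) \<le> e * (t - y)"
            using sc[OF d2(2)[of "t - y"]] y 3 by auto
          moreover have "integral {a..y} f - integral {a..t} f - (y - t) *\<^sub>R f t = - (integral {y..t} f - (t - y) *\<^sub>R f t)"
            using comb[of a y t] 3 y by (simp add: algebra_simps)
          ultimately show ?thesis using 3 by (metis abs_minus_commute abs_of_pos diff_gt_0_iff_gt norm_minus_cancel real_norm_def)
        qed (simp)
      qed
      moreover have "min (min d1 d2) (t - a) > 0" using d1 d2 at by simp
      ultimately show "\<exists>d>0. \<forall>y. norm (y - t) < d \<longrightarrow>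
          norm (integral {a..y} f - integral {a..t} f - (y - t) *\<^sub>R f t) \<le> e * norm (y - t)" by blast
    qed
  qed
qed

text \<open>
  For the sup norm weighted by \<open>exp (- 2 Z (t - a))\<close>, the Picard operator contracts with factor \<open>1/2\<close> on
  the whole of \<open>[a,b]\<close>. The weight is absorbed by the substitution \<open>\<xi> t = exp (2 Z (t - a)) y t\<close>: in the
  proof, \<open>w\<close> is the passage from \<open>y\<close> to \<open>\<xi>\<close>, and \<open>P\<close> is the operator acting on \<open>y\<close>. Clamping the time
  to \<open>[a,b]\<close> by \<open>\<tau>\<close> produces bounded continuous functions on the whole line, which form a complete space.
\<close>

lemma caratheodory_existence:
  fixes g :: "real \<Rightarrow> 'a::euclidean_space \<Rightarrow> 'a"
  assumes ab: "a \<le> b" and Z: "Z > 0" and lip: "\<And>t x y. norm (g t x - g t y) \<le> Z * norm (x - y)"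
    and bound: "\<And>t x. norm (g t x) \<le> M"
    and meas: "\<And>\<xi>. continuous_on UNIV \<xi> \<Longrightarrow> (\<lambda>t. g t (\<xi> t)) \<in> borel_measurable lebesgue"
  obtains \<xi> where "\<xi> a = x" "M-lipschitz_on {a..b} \<xi>"
    "AE t in lebesgue_on {a..b}. (\<xi> has_vector_derivative g t (\<xi> t)) (at t)"
proof -
  have M0: "M \<ge> 0" using bound[of 0 0] norm_ge_zero order_trans by blast
  have int: "(\<lambda>t. g t (\<xi> t)) integrable_on {u..v}" if "continuous_on UNIV \<xi>" for \<xi> u v
    by (rule measurable_bounded_by_integrable_imp_integrable[where g = "\<lambda>_. M"])
      (use meas[OF that] bound in \<open>auto intro: measurable_restrict_space1\<close>)
  define \<tau> where "\<tau> = (\<lambda>t. max a (min b t))"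
  define w where "w = (\<lambda>(y :: real \<Rightarrow>\<^sub>C 'a) s. exp (2 * Z * (s - a)) *\<^sub>R apply_bcontfun y s)"
  define P where "P = (\<lambda>y r. exp (- 2 * Z * (r - a)) *\<^sub>R (x + integral {a..r} (\<lambda>s. g s (w y s))))"
  have wc: "continuous_on UNIV (w y)" for y
    unfolding w_def using continuous_on_apply_bcontfun by (auto intro!: continuous_intros)
  have \<tau>: "\<tau> t \<in> {a..b}" for t using ab by (auto simp: \<tau>_def)
  have Pc: "continuous_on {a..b} (P y)" for y
    unfolding P_def by (intro continuous_intros indefinite_integral_continuous_1 int wc)
  have "(\<lambda>t. P y (\<tau> t)) \<in> bcontfun" for y
  proof -
    have "continuous_on UNIV \<tau>" unfolding \<tau>_def by (intro continuous_intros)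
    then have "continuous_on UNIV (\<lambda>t. P y (\<tau> t))"
      by (rule continuous_on_compose2[OF Pc]) (use \<tau> in auto)
    moreover have "bounded (P y ` {a..b})" using Pc by (intro compact_imp_bounded compact_continuous_image) auto
    then have "bounded (range (\<lambda>t. P y (\<tau> t)))" by (rule bounded_subset) (use \<tau> in auto)
    ultimately show ?thesis by (simp add: bcontfun_def)
  qed
  then have ap: "apply_bcontfun (Bcontfun (\<lambda>t. P y (\<tau> t))) t = P y (\<tau> t)" for y t
    by (simp add: Bcontfun_inverse)
  have Pdist: "norm (P y r - P z r) \<le> (1/2) * dist y z" if r: "r \<in> {a..b}" for y z r
  proof -
    have "norm (integral {a..r} (\<lambda>s. g s (w y s)) - integral {a..r} (\<lambda>s. g s (w z s)))
        = norm (integral {a..r} (\<lambda>s. g s (w y s) - g s (w z s)))"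
      by (subst Henstock_Kurzweil_Integration.integral_diff) (auto intro: int wc)
    also have "\<dots> \<le> integral {a..r} (\<lambda>s. Z * (exp (2 * Z * (s - a)) * dist y z))"
    proof (rule integral_norm_bound_integral)
      show "(\<lambda>s. g s (w y s) - g s (w z s)) integrable_on {a..r}"
        by (intro Henstock_Kurzweil_Integration.integrable_diff int wc)
      show "(\<lambda>s. Z * (exp (2 * Z * (s - a)) * dist y z)) integrable_on {a..r}"
        by (intro integrable_continuous_interval continuous_intros)
      fix s assume "s \<in> {a..r}"
      have "norm (w y s - w z s) = exp (2 * Z * (s - a)) * dist (y s) (z s)"
        unfolding w_def dist_norm by (simp flip: scaleR_diff_right)
      also have "\<dots> \<le> exp (2 * Z * (s - a)) * dist y z" by (intro mult_left_mono dist_bounded) auto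
      finally show "norm (g s (w y s) - g s (w z s)) \<le> Z * (exp (2 * Z * (s - a)) * dist y z)"
        using lip[of s "w y s" "w z s"] Z by (meson less_imp_le mult_left_mono order_trans)
    qed
    also have "\<dots> = exp (2 * Z * (r - a)) * (dist y z / 2) - exp (2 * Z * (a - a)) * (dist y z / 2)"
    proof (rule integral_unique, rule fundamental_theorem_of_calculus)
      show "((\<lambda>s. exp (2 * Z * (s - a)) * (dist y z / 2)) has_vector_derivative
          Z * (exp (2 * Z * (s - a)) * dist y z)) (at s within {a..r})" for s
        unfolding has_real_derivative_iff_has_vector_derivative[symmetric]
        by (auto intro!: derivative_eq_intros)
    qed (use r in auto)
    also have "\<dots> \<le> exp (2 * Z * (r - a)) * (dist y z / 2)" by simp
    finally have *: "norm (integral {a..r} (\<lambda>s. g s (w y s)) - integral {a..r} (\<lambda>s. g s (w z s)))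
      \<le> exp (2 * Z * (r - a)) * (dist y z / 2)" .
    have "norm (P y r - P z r) = exp (- 2 * Z * (r - a)) * norm (integral {a..r} (\<lambda>s. g s (w y s)) - integral {a..r} (\<lambda>s. g s (w z s)))"
      unfolding P_def by (simp flip: scaleR_diff_right)
    also have "\<dots> \<le> exp (- 2 * Z * (r - a)) * (exp (2 * Z * (r - a)) * (dist y z / 2))"
      using * by (intro mult_left_mono) auto
    also have "\<dots> = dist y z / 2" by (simp flip: mult.assoc exp_add)
    finally show ?thesis by simp
  qed
  have "\<exists>!y. Bcontfun (\<lambda>t. P y (\<tau> t)) = y"
  proof (rule banach_fix_type[of "1/2"])
    show "\<forall>y z. dist (Bcontfun (\<lambda>t. P y (\<tau> t))) (Bcontfun (\<lambda>t. P z (\<tau> t))) \<le> 1 / 2 * dist y z"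
      by (intro allI dist_bound) (simp only: ap dist_norm[of "P _ _"] Pdist[OF \<tau>])
  qed auto
  then obtain y where y: "Bcontfun (\<lambda>t. P y (\<tau> t)) = y" by blast
  define \<xi> where "\<xi> = w y"
  have yt: "apply_bcontfun y t = P y t" if "t \<in> {a..b}" for t
    using ap[of y t] that unfolding y by (simp add: \<tau>_def)
  have \<xi>: "\<xi> t = x + integral {a..t} (\<lambda>s. g s (\<xi> s))" if "t \<in> {a..b}" for t
  proof -
    have "\<xi> t = exp (2 * Z * (t - a)) *\<^sub>R (exp (- 2 * Z * (t - a)) *\<^sub>R (x + integral {a..t} (\<lambda>s. g s (\<xi> s))))"
      using yt[OF that] unfolding \<xi>_def P_def by (subst w_def) simp
    then show ?thesis by (simp flip: exp_add)
  qed
  have \<xi>c: "continuous_on UNIV \<xi>" unfolding \<xi>_def by (rule wc)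
  show thesis
  proof
    show "\<xi> a = x" using \<xi>[of a] ab by simp
    have main: "norm (\<xi> t - \<xi> s) \<le> M * (t - s)" if st: "s \<in> {a..b}" "t \<in> {a..b}" "s \<le> t" for s t
    proof -
      have "\<xi> t - \<xi> s = integral {s..t} (\<lambda>s. g s (\<xi> s))"
        using \<xi>[OF st(1)] \<xi>[OF st(2)]
          Henstock_Kurzweil_Integration.integral_combine[of a s t, OF _ st(3) int[OF \<xi>c]] st by (simp add: algebra_simps)
      moreover have "norm (integral {s..t} (\<lambda>s. g s (\<xi> s))) \<le> integral {s..t} (\<lambda>_. M)"
        using int[OF \<xi>c] by (intro integral_norm_bound_integral) (auto intro: bound)
      ultimately show ?thesis using st by (simp add: mult.commute)
    qed
    show "M-lipschitz_on {a..b} \<xi>"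
    proof (rule lipschitz_onI[OF _ M0])
      fix s t assume "s \<in> {a..b}" "t \<in> {a..b}"
      then show "dist (\<xi> s) (\<xi> t) \<le> M * dist s t"
        using main[of s t] main[of t s] by (cases "s \<le> t") (auto simp: dist_norm norm_minus_commute)
    qed
    obtain N where N: "negligible N" "\<And>a t. t \<notin> N \<Longrightarrow> a < t \<Longrightarrow>
        ((\<lambda>r. integral {a..r} (\<lambda>s. g s (\<xi> s))) has_vector_derivative g t (\<xi> t)) (at t)"
      using indefinite_integral_ae_derivative[OF int[OF \<xi>c]] by blast
    show "AE t in lebesgue_on {a..b}. (\<xi> has_vector_derivative g t (\<xi> t)) (at t)"
    proof (rule negligible_imp_AE_lebesgue_on)
      show "negligible (N \<union> {a, b})" using N by auto
      fix t assume t: "t \<in> {a..b}" "t \<notin> N \<union> {a, b}"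
      have "((\<lambda>r. x + integral {a..r} (\<lambda>s. g s (\<xi> s))) has_vector_derivative g t (\<xi> t)) (at t)"
        using N(2)[of t a] t by (auto intro!: derivative_eq_intros)
      then show "(\<xi> has_vector_derivative g t (\<xi> t)) (at t)"
        by (rule has_vector_derivative_transform_within_open[of _ _ _ "{a<..<b}"]) (use t \<xi> in auto)
    qed simp
  qed
qed

section \<open>Uniform first-order estimates for smooth maps\<close>

lemma smooth_on_imp_differentiable: "smooth_on W g \<Longrightarrow> x \<in> W \<Longrightarrow> g differentiable (at x)"
  unfolding smooth_on_def by (metis Ck_on.simps(2))

lemma smooth_on_imp_continuous_derivative:
  "smooth_on W g \<Longrightarrow> continuous_on W (\<lambda>x. frechet_derivative g (at x) v)"
  unfolding smooth_on_def by (metis Ck_on.simps)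

lemma smooth_on_has_derivative:
  "smooth_on W g \<Longrightarrow> x \<in> W \<Longrightarrow> (g has_derivative frechet_derivative g (at x)) (at x)"
  using smooth_on_imp_differentiable frechet_derivative_works by blast

lemma linear_norm_le_Basis:
  fixes h :: "'a::euclidean_space \<Rightarrow> 'b::real_normed_vector"
  assumes "linear h" "\<And>b. b \<in> Basis \<Longrightarrow> norm (h b) \<le> e"
  shows "norm (h v) \<le> e * DIM('a) * norm v"
proof -
  have "h v = h (\<Sum>b\<in>Basis. (v \<bullet> b) *\<^sub>R b)" by (simp add: euclidean_representation)
  also have "\<dots> = (\<Sum>b\<in>Basis. (v \<bullet> b) *\<^sub>R h b)"
    using assms(1) by (simp add: linear_sum linear_scale o_def)
  finally have "norm (h v) \<le> (\<Sum>b\<in>Basis. norm ((v \<bullet> b) *\<^sub>R h b))" by (metis norm_sum)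
  also have "\<dots> \<le> (\<Sum>b\<in>(Basis :: 'a set). norm v * e)"
  proof (rule sum_mono)
    fix b :: 'a assume b: "b \<in> Basis"
    show "norm ((v \<bullet> b) *\<^sub>R h b) \<le> norm v * e"
      using assms(2)[OF b] Basis_le_norm[OF b] by (simp add: mult_mono)
  qed
  finally show ?thesis by (simp add: mult.commute mult.left_commute)
qed

text \<open>
  The derivative is uniformly continuous on the compact set \<open>S\<close>, so that the mean value inequality
  applied to \<open>g\<close> minus its linear part at \<open>p\<close> has a small Lipschitz constant near \<open>p\<close>.
\<close>

lemma smooth_on_uniform_linearisation:
  fixes g :: "'a::euclidean_space \<Rightarrow> 'b::real_normed_vector"
  assumes g: "smooth_on W g" and S: "compact S" "convex S" "S \<subseteq> W" and e: "e > 0"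
  obtains \<eta> where "\<eta> > 0"
    "\<And>p q. \<lbrakk>p \<in> S; q \<in> S; norm (q - p) < \<eta>\<rbrakk> \<Longrightarrow>
       norm (g q - g p - frechet_derivative g (at p) (q - p)) \<le> e * norm (q - p)"
proof -
  let ?D = "\<lambda>p. frechet_derivative g (at p)"
  define e' where "e' = e / DIM('a)"
  have e': "e' > 0" using e by (simp add: e'_def)
  have "\<exists>d>0. \<forall>p\<in>S. \<forall>q\<in>S. dist q p < d \<longrightarrow> dist (?D q b) (?D p b) < e'" for b
  proof -
    have "uniformly_continuous_on S (\<lambda>p. ?D p b)"
      using compact_uniformly_continuous[OF _ S(1)] continuous_on_subset[OF smooth_on_imp_continuous_derivative[OF g] S(3)] by blast
    then show ?thesis using e' unfolding uniformly_continuous_on_def by blast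
  qed
  then obtain d where d: "\<And>b. d b > 0"
    "\<And>b p q. \<lbrakk>p \<in> S; q \<in> S; dist q p < d b\<rbrakk> \<Longrightarrow> dist (?D q b) (?D p b) < e'" by metis
  define \<eta> where "\<eta> = Min (d ` (Basis :: 'a set))"
  have \<eta>: "\<eta> > 0" "\<And>b. b \<in> Basis \<Longrightarrow> \<eta> \<le> d b" using d(1) by (auto simp: \<eta>_def)
  have lin: "linear (?D p)" if "p \<in> S" for p
    using smooth_on_has_derivative[OF g] S(3) that has_derivative_linear by blast
  show thesis
  proof
    fix p q assume pq: "p \<in> S" "q \<in> S" "norm (q - p) < \<eta>"
    have seg: "closed_segment p q \<subseteq> S" using pq S(2) by (simp add: closed_segment_subset)
    have "norm (g q - g p - ?D p (q - p)) \<le> norm (q - p) * e"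
    proof (rule differentiable_bound_linearization)
      show "p + t *\<^sub>R (q - p) \<in> closed_segment p q" if "t \<in> {0..1}" for t
        using that by (auto simp: closed_segment_def algebra_simps intro!: exI[of _ t])
      fix z assume z: "z \<in> closed_segment p q"
      show "(g has_derivative ?D z) (at z within closed_segment p q)"
        using smooth_on_has_derivative[OF g] seg S(3) z by (meson has_derivative_at_withinI subsetD)
      show "onorm (?D z - ?D p) \<le> e"
      proof (rule onorm_le)
        fix v
        have "norm (z - p) \<le> norm (q - p)" using z by (simp add: segment_bound(1))
        then have dz: "dist z p < \<eta>" using pq by (simp add: dist_norm)
        have "norm ((\<lambda>v. ?D z v - ?D p v) v) \<le> e' * DIM('a) * norm v"
        proof (rule linear_norm_le_Basis)
          show "linear (\<lambda>v. ?D z v - ?D p v)" using lin z seg pq by (intro linear_compose_sub) auto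
          fix b :: 'a assume "b \<in> Basis"
          then show "norm (?D z b - ?D p b) \<le> e'"
            using d(2)[of p z b] \<eta>(2)[of b] dz pq z seg by (force simp: dist_norm)
        qed
        then show "norm ((?D z - ?D p) v) \<le> e * norm v" by (simp add: e'_def)
      qed
    qed auto
    then show "norm (g q - g p - ?D p (q - p)) \<le> e * norm (q - p)" by (simp add: mult.commute)
  qed (rule \<eta>)
qed

lemma smooth_on_imp_lipschitz:
  fixes g :: "'a::euclidean_space \<Rightarrow> 'b::real_normed_vector"
  assumes g: "smooth_on W g" and S: "compact S" "convex S" "S \<subseteq> W"
  obtains L where "L > 0" "L-lipschitz_on S g"
proof -
  let ?D = "\<lambda>p. frechet_derivative g (at p)"
  have "\<exists>B\<ge>0. \<forall>p\<in>S. norm (?D p b) \<le> B" for b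
    using continuous_on_compact_bound[OF S(1) continuous_on_subset[OF smooth_on_imp_continuous_derivative[OF g] S(3)], of b]
    by metis
  then obtain B where B: "\<And>b. B b \<ge> 0" "\<And>p b. p \<in> S \<Longrightarrow> norm (?D p b) \<le> B b" by metis
  define L where "L = (\<Sum>b\<in>(Basis :: 'a set). B b) * DIM('a) + 1"
  have "(\<Sum>b\<in>(Basis :: 'a set). B b) \<ge> 0" using B by (simp add: sum_nonneg)
  then have L: "L > 0" unfolding L_def by (simp add: add_nonneg_pos)
  have "norm (g x - g y) \<le> L * norm (x - y)" if "x \<in> S" "y \<in> S" for x y
  proof (rule differentiable_bound[OF S(2) _ _ that])
    fix z assume z: "z \<in> S"
    show "(g has_derivative ?D z) (at z within S)"
      using smooth_on_has_derivative[OF g] S(3) z by (meson has_derivative_at_withinI subsetD)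
    show "onorm (?D z) \<le> L"
    proof (rule onorm_le)
      fix v
      have "norm (?D z v) \<le> (\<Sum>b\<in>(Basis :: 'a set). B b) * DIM('a) * norm v"
      proof (rule linear_norm_le_Basis)
        show "linear (?D z)"
          using smooth_on_has_derivative[OF g] S(3) z has_derivative_linear by blast
        fix b :: 'a assume b: "b \<in> Basis"
        have "B b \<le> (\<Sum>b\<in>(Basis :: 'a set). B b)" using b B by (intro member_le_sum) auto
        then show "norm (?D z b) \<le> (\<Sum>b\<in>(Basis :: 'a set). B b)" using B(2)[OF z, of b] by linarith
      qed
      also have "\<dots> \<le> L * norm v" unfolding L_def by (intro mult_right_mono) auto
      finally show "norm (?D z v) \<le> L * norm v" .
    qed
  qed
  then have "L-lipschitz_on S g" using L by (intro lipschitz_onI) (auto simp: dist_norm)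
  then show thesis using that L by blast
qed

section \<open>Quadratic forms\<close>

lemma form_sum: "form H I J = (\<Sum>i\<in>UNIV. \<Sum>j\<in>UNIV. I $ i * (H $ i $ j * J $ j))"
  by (simp add: form_def inner_vec_def matrix_vector_mult_def sum_distrib_left)

lemma form_simps:
  "form H (I + I') J = form H I J + form H I' J" "form H I (J + J') = form H I J + form H I J'"
  "form H (I - I') J = form H I J - form H I' J" "form H I (J - J') = form H I J - form H I J'"
  "form H (c *\<^sub>R I) J = c * form H I J" "form H I (c *\<^sub>R J) = c * form H I J"
  "form (H + H') I J = form H I J + form H' I J"
  "form H 0 J = 0" "form H I 0 = 0"
  by (auto simp: form_def algebra_simps inner_add_left inner_add_right inner_diff_left inner_diff_right
      matrix_vector_mult_add_rdistrib)

lemma form_commute: "transpose H = H \<Longrightarrow> form H I J = form H J I"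
  unfolding form_def by (metis dot_lmul_matrix inner_commute vector_transpose_matrix)

definition gnorm :: "real^'k^'k \<Rightarrow> real^'k \<Rightarrow> real" where
  "gnorm H v = sqrt (form H v v)"

definition posdef :: "real^'k^'k \<Rightarrow> bool" where
  "posdef H \<longleftrightarrow> transpose H = H \<and> (\<forall>v. v \<noteq> 0 \<longrightarrow> 0 < form H v v)"

lemma riemannian_metric_posdef: "riemannian_metric G \<Longrightarrow> posdef (G x)"
  by (simp add: riemannian_metric_def posdef_def)

lemma posdef_nonneg: "posdef H \<Longrightarrow> 0 \<le> form H v v"
  by (cases "v = 0") (auto simp: posdef_def form_simps less_imp_le)

lemma gnorm_nonneg: "posdef H \<Longrightarrow> 0 \<le> gnorm H v"
  by (simp add: gnorm_def posdef_nonneg)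

lemma gnorm_power2: "posdef H \<Longrightarrow> (gnorm H v)\<^sup>2 = form H v v"
  by (simp add: gnorm_def posdef_nonneg)

lemma gnorm_scaleR: "gnorm H (c *\<^sub>R v) = \<bar>c\<bar> * gnorm H v"
  by (simp add: gnorm_def form_simps real_sqrt_mult flip: mult.assoc)

lemma form_cauchy_schwarz:
  assumes H: "posdef H" shows "form H u v \<le> gnorm H u * gnorm H v"
proof (cases "v = 0")
  case True
  then show ?thesis using gnorm_nonneg[OF H] by (simp add: form_simps gnorm_def)
next
  case False
  then have C: "form H v v > 0" using H by (simp add: posdef_def)
  define k where "k = form H u v / form H v v"
  have sym: "form H v u = form H u v" using H form_commute unfolding posdef_def by metis
  have "0 \<le> form H (u - k *\<^sub>R v) (u - k *\<^sub>R v)" by (rule posdef_nonneg[OF H])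
  also have "\<dots> = form H u u - 2 * k * form H u v + k * (k * form H v v)"
    by (simp add: form_simps sym algebra_simps)
  also have "k * form H v v = form H u v" using C by (simp add: k_def)
  finally have "k * form H u v \<le> form H u u" by (simp add: algebra_simps)
  then have "(form H u v)\<^sup>2 \<le> form H u u * form H v v" using C by (simp add: k_def field_simps power2_eq_square)
  then have "form H u v \<le> sqrt (form H u u * form H v v)" by (rule real_le_rsqrt)
  then show ?thesis by (simp add: gnorm_def real_sqrt_mult)
qed

lemma continuous_on_form:
  assumes "continuous_on S H" "continuous_on S I" "continuous_on S J"
  shows "continuous_on S (\<lambda>x. form (H x) (I x) (J x))"
  unfolding form_sum using assms by (intro continuous_intros) auto

lemma riemannian_metric_continuous: "riemannian_metric G \<Longrightarrow> continuous_on S G"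
  unfolding riemannian_metric_def smooth_on_def by (metis Ck_on.simps(1) continuous_on_subset subset_UNIV)

text \<open>
  By homogeneity only unit vectors matter, and over a ball they form a compact set on which the form
  is continuous and positive.
\<close>

lemma riemannian_form_bounds:
  fixes G :: "real^'n \<Rightarrow> real^'n^'n"
  assumes G: "riemannian_metric G"
  obtains c C where "c > 0" "C > 0" "\<And>x v. x \<in> cball 0 R \<Longrightarrow> c * (norm v)\<^sup>2 \<le> form (G x) v v"
    "\<And>x v. x \<in> cball 0 R \<Longrightarrow> form (G x) v v \<le> C * (norm v)\<^sup>2"
proof (cases "cball 0 R = ({} :: (real^'n) set)")
  case True
  then show thesis using that[of 1 1] by auto
next
  case False
  let ?S = "cball 0 R \<times> sphere 0 1 :: ((real^'n) \<times> (real^'n)) set"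
  let ?F = "\<lambda>(x, v). form (G x) v v"
  have ne: "?S \<noteq> {}" using False by (simp add: sphere_eq_empty)
  have comp: "compact ?S" by (intro compact_Times) auto
  have "continuous_on ?S (\<lambda>z. G (fst z))"
    by (rule continuous_on_compose2[OF riemannian_metric_continuous[OF G, of UNIV]]) (auto intro: continuous_intros)
  then have cont: "continuous_on ?S ?F"
    unfolding case_prod_unfold by (intro continuous_on_form continuous_intros)
  obtain z1 where z1: "z1 \<in> ?S" "\<And>z. z \<in> ?S \<Longrightarrow> ?F z1 \<le> ?F z" using continuous_attains_inf[OF comp ne cont] by blast
  obtain z2 where z2: "z2 \<in> ?S" "\<And>z. z \<in> ?S \<Longrightarrow> ?F z \<le> ?F z2" using continuous_attains_sup[OF comp ne cont] by blast
  have pos: "?F z > 0" if "z \<in> ?S" for z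
  proof -
    have "snd z \<noteq> 0" using that by auto
    then show ?thesis using riemannian_metric_posdef[OF G] unfolding posdef_def by (simp add: case_prod_unfold)
  qed
  have hom: "form (G x) v v = (norm v)\<^sup>2 * form (G x) (v /\<^sub>R norm v) (v /\<^sub>R norm v)" if "v \<noteq> 0" for x v
    using that by (simp add: form_simps power2_eq_square field_simps)
  have un: "(x, v /\<^sub>R norm v) \<in> ?S" if "x \<in> cball 0 R" "v \<noteq> 0" for x v using that by auto
  show thesis
  proof
    show "?F z1 > 0" "?F z2 > 0" using pos z1 z2 by auto
    fix x v :: "real^'n" assume x: "x \<in> cball 0 R"
    show "?F z1 * (norm v)\<^sup>2 \<le> form (G x) v v"
    proof (cases "v = 0")
      case False
      then show ?thesis using z1(2)[OF un[OF x False]] hom[OF False, of x] by (simp add: mult.commute)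
    qed (simp add: form_simps)
    show "form (G x) v v \<le> ?F z2 * (norm v)\<^sup>2"
    proof (cases "v = 0")
      case False
      then show ?thesis using z2(2)[OF un[OF x False]] hom[OF False, of x] by (simp add: mult.commute)
    qed (simp add: form_simps)
  qed
qed

lemma gnorm_bounds:
  fixes G :: "real^'n \<Rightarrow> real^'n^'n"
  assumes G: "riemannian_metric G"
  obtains c C where "c > 0" "C > 0" "\<And>x v. x \<in> cball 0 R \<Longrightarrow> c * norm v \<le> gnorm (G x) v"
    "\<And>x v. x \<in> cball 0 R \<Longrightarrow> gnorm (G x) v \<le> C * norm v"
proof -
  obtain c C where *: "c > 0" "C > 0" "\<And>x v. x \<in> cball 0 R \<Longrightarrow> c * (norm v)\<^sup>2 \<le> form (G x) v v"
    "\<And>x v. x \<in> cball 0 R \<Longrightarrow> form (G x) v v \<le> C * (norm v)\<^sup>2" by (rule riemannian_form_bounds[OF G, of R]) (rule that, assumption+)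
  show thesis
  proof
    show "sqrt c > 0" "sqrt C > 0" using * by auto
    fix x v :: "real^'n" assume x: "x \<in> cball 0 R"
    show "sqrt c * norm v \<le> gnorm (G x) v" using real_sqrt_le_mono[OF *(3)[OF x, of v]]
      by (simp add: gnorm_def real_sqrt_mult)
    show "gnorm (G x) v \<le> sqrt C * norm v" using real_sqrt_le_mono[OF *(4)[OF x, of v]]
      by (simp add: gnorm_def real_sqrt_mult)
  qed
qed

lemma form_abs_le: "\<bar>form H v v\<bar> \<le> norm H * (norm v)\<^sup>2 * CARD('k)\<^sup>2" for H :: "real^'k^'k"
proof -
  have "\<bar>form H v v\<bar> \<le> (\<Sum>i\<in>(UNIV :: 'k set). \<Sum>j\<in>(UNIV :: 'k set). \<bar>v $ i * (H $ i $ j * v $ j)\<bar>)"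
    unfolding form_sum by (intro order_trans[OF sum_abs] sum_mono order_refl)
  also have "\<dots> \<le> (\<Sum>i\<in>(UNIV :: 'k set). \<Sum>j\<in>(UNIV :: 'k set). norm v * (norm H * norm v))"
  proof (intro sum_mono)
    fix i j :: 'k
    have "\<bar>H $ i $ j\<bar> \<le> norm H"
      using Finite_Cartesian_Product.norm_nth_le[of "H $ i" j] Finite_Cartesian_Product.norm_nth_le[of H i] by simp
    then show "\<bar>v $ i * (H $ i $ j * v $ j)\<bar> \<le> norm v * (norm H * norm v)"
      unfolding abs_mult using Finite_Cartesian_Product.norm_nth_le[of v i] Finite_Cartesian_Product.norm_nth_le[of v j] by (intro mult_mono) auto
  qed
  also have "\<dots> = norm H * (norm v)\<^sup>2 * CARD('k)\<^sup>2" by (simp add: power2_eq_square)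
  finally show ?thesis .
qed

text \<open>
  Over short distances \<open>G\<close> changes by less than the lower bound \<open>c\<close> of its forms, which at most doubles
  a form.
\<close>

lemma gnorm_comparable:
  fixes G :: "real^'n \<Rightarrow> real^'n^'n"
  assumes G: "riemannian_metric G"
  obtains r where "r > 0"
    "\<And>x y v. \<lbrakk>x \<in> cball 0 R; norm (y - x) \<le> r\<rbrakk> \<Longrightarrow> gnorm (G y) v \<le> 2 * gnorm (G x) v"
    "\<And>x y v. \<lbrakk>x \<in> cball 0 R; norm (y - x) \<le> r\<rbrakk> \<Longrightarrow> gnorm (G x) v \<le> 2 * gnorm (G y) v"
proof -
  obtain c where c: "c > 0" "\<And>x v. x \<in> cball 0 (R + 1) \<Longrightarrow> c * (norm v)\<^sup>2 \<le> form (G x) v v"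
    by (rule riemannian_form_bounds[OF G, of "R + 1"]) (rule that, assumption+)
  have "uniformly_continuous_on (cball 0 (R + 1)) G"
    using riemannian_metric_continuous[OF G] by (intro compact_uniformly_continuous) auto
  moreover define e where "e = c / CARD('n)\<^sup>2"
  have e: "e > 0" using c by (simp add: e_def)
  ultimately obtain d where d: "d > 0"
    "\<And>x y. \<lbrakk>x \<in> cball 0 (R + 1); y \<in> cball 0 (R + 1); dist y x < d\<rbrakk> \<Longrightarrow> dist (G y) (G x) < e"
    unfolding uniformly_continuous_on_def by metis
  have close: "\<bar>form (G y) v v - form (G x) v v\<bar> \<le> c * (norm v)\<^sup>2"
    if "x \<in> cball 0 (R + 1)" "y \<in> cball 0 (R + 1)" "dist y x < d" for x y v
  proof -
    have "form (G y) v v - form (G x) v v = form (G y - G x) v v"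
      by (simp add: form_def matrix_vector_mult_diff_rdistrib inner_diff_right)
    also have "\<bar>\<dots>\<bar> \<le> norm (G y - G x) * (norm v)\<^sup>2 * CARD('n)\<^sup>2" by (rule form_abs_le)
    also have "\<dots> \<le> e * (norm v)\<^sup>2 * CARD('n)\<^sup>2"
      using d(2)[OF that] by (intro mult_right_mono) (auto simp: dist_norm)
    finally show ?thesis by (simp add: e_def)
  qed
  have four: "gnorm (G y) v \<le> 2 * gnorm (G x) v"
    if "x \<in> cball 0 (R + 1)" "y \<in> cball 0 (R + 1)" "dist y x < d" for x y v
  proof -
    have "form (G y) v v \<le> 4 * form (G x) v v"
      using close[OF that, of v] c(2)[OF that(1), of v] posdef_nonneg[OF riemannian_metric_posdef[OF G], of x v] by linarith
    then have "sqrt (form (G y) v v) \<le> sqrt (4 * form (G x) v v)" by (rule real_sqrt_le_mono)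
    then show ?thesis by (simp add: gnorm_def real_sqrt_mult)
  qed
  show thesis
  proof (rule that[of "min (d / 2) 1"])
    fix x y v :: "real^'n" assume xy: "x \<in> cball 0 R" "norm (y - x) \<le> min (d / 2) 1"
    have "norm y \<le> norm x + norm (y - x)" using norm_triangle_sub by blast
    then have "x \<in> cball 0 (R + 1)" "y \<in> cball 0 (R + 1)" "dist y x < d" "dist x y < d"
      using xy d by (auto simp: dist_norm norm_minus_commute)
    then show "gnorm (G y) v \<le> 2 * gnorm (G x) v" "gnorm (G x) v \<le> 2 * gnorm (G y) v" using four by blast+
  qed (use d in auto)
qed

section \<open>Lengths of curves and the Riemannian distance\<close>

lemma Ck_on_const: "Ck_on k S (\<lambda>x. c)"
  by (induction k arbitrary: c) auto

lemma smooth_on_affine: "smooth_on S (\<lambda>s :: real. x + s *\<^sub>R v)"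
proof -
  have d: "((\<lambda>s. x + s *\<^sub>R v) has_derivative (\<lambda>h. h *\<^sub>R v)) (at t)" for t :: real
    by (auto intro!: derivative_eq_intros)
  then have "frechet_derivative (\<lambda>s. x + s *\<^sub>R v) (at t) = (\<lambda>h. h *\<^sub>R v)" for t :: real
    using frechet_derivative_at by metis
  then have "Ck_on k S (\<lambda>s :: real. x + s *\<^sub>R v)" for k
    using d by (cases k) (auto simp: Ck_on_const differentiable_def intro!: continuous_intros)
  then show ?thesis by (simp add: smooth_on_def)
qed

definition speed :: "(real^'n \<Rightarrow> real^'n^'n) \<Rightarrow> (real \<Rightarrow> real^'n) \<Rightarrow> real \<Rightarrow> real" where
  "speed G \<phi> s = gnorm (G (\<phi> s)) (vector_derivative \<phi> (at s))"

lemma curve_length_speed: "curve_length G \<phi> = (\<integral>\<^sup>+ s. ennreal (speed G \<phi> s) \<partial>lebesgue_on {0..1})"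
  by (simp add: curve_length_def speed_def gnorm_def)

lemma segment_curve:
  assumes G: "riemannian_metric G" and L: "\<And>\<sigma>. \<sigma> \<in> {0..1} \<Longrightarrow> gnorm (G (x + \<sigma> *\<^sub>R (y - x))) (y - x) \<le> L"
  shows "piecewise_smooth_curve (\<lambda>s. x + s *\<^sub>R (y - x))" "curve_length G (\<lambda>s. x + s *\<^sub>R (y - x)) \<le> ennreal L"
proof -
  show "piecewise_smooth_curve (\<lambda>s. x + s *\<^sub>R (y - x))"
    unfolding piecewise_smooth_curve_def
    by (intro conjI continuous_intros exI[of _ "{}"] smooth_on_affine) auto
  have "vector_derivative (\<lambda>s. x + s *\<^sub>R (y - x)) (at s) = y - x" for s :: real
    by (rule vector_derivative_at) (auto intro!: derivative_eq_intros)
  then have "curve_length G (\<lambda>s. x + s *\<^sub>R (y - x)) \<le> (\<integral>\<^sup>+ s. ennreal L \<partial>lebesgue_on {0..1 :: real})"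
    unfolding curve_length_speed speed_def using L by (intro nn_integral_mono ennreal_leI) auto
  also have "\<dots> = ennreal L * emeasure lebesgue {0..1 :: real}"
    by (simp add: emeasure_restrict_space)
  finally show "curve_length G (\<lambda>s. x + s *\<^sub>R (y - x)) \<le> ennreal L" by simp
qed

lemma segment_speed_bounded:
  assumes G: "riemannian_metric G"
  obtains L where "L \<ge> 0" "\<And>\<sigma>. \<sigma> \<in> {0..1} \<Longrightarrow> gnorm (G (x + \<sigma> *\<^sub>R (y - x))) (y - x) \<le> L"
proof -
  define R where "R = norm x + norm (y - x)"
  obtain C where C: "C > 0" "\<And>z v. z \<in> cball 0 R \<Longrightarrow> gnorm (G z) v \<le> C * norm v"
    by (rule gnorm_bounds[OF G, of R]) (rule that, assumption+)
  show thesis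
  proof (rule that)
    show "C * norm (y - x) \<ge> 0" using C by simp
    fix \<sigma> :: real assume \<sigma>: "\<sigma> \<in> {0..1}"
    have "norm (x + \<sigma> *\<^sub>R (y - x)) \<le> norm x + \<bar>\<sigma>\<bar> * norm (y - x)" by (metis norm_scaleR norm_triangle_ineq)
    also have "\<dots> \<le> norm x + 1 * norm (y - x)" using \<sigma> by (intro add_left_mono mult_right_mono) auto
    finally have "norm (x + \<sigma> *\<^sub>R (y - x)) \<le> R" by (simp add: R_def)
    then show "gnorm (G (x + \<sigma> *\<^sub>R (y - x))) (y - x) \<le> C * norm (y - x)" by (intro C(2)) simp
  qed
qed

text \<open>
  The infimum is kept in the extended reals as long as curves of infinite length are among the
  competitors. Line segments show that it is finite.
\<close>

definition length_inf :: "(real^'n \<Rightarrow> real^'n^'n) \<Rightarrow> real^'n \<Rightarrow> real^'n \<Rightarrow> ennreal" where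
  "length_inf G x y = (INF \<phi> \<in> {\<phi>. piecewise_smooth_curve \<phi> \<and> \<phi> 0 = x \<and> \<phi> 1 = y}. curve_length G \<phi>)"

lemma length_inf_segment:
  assumes G: "riemannian_metric G" and L: "\<And>\<sigma>. \<sigma> \<in> {0..1} \<Longrightarrow> gnorm (G (x + \<sigma> *\<^sub>R (y - x))) (y - x) \<le> L"
  shows "length_inf G x y \<le> ennreal L"
  unfolding length_inf_def
  by (rule INF_lower2[where i = "\<lambda>s. x + s *\<^sub>R (y - x)"]) (use segment_curve[OF assms] in auto)

lemma length_inf_finite:
  assumes G: "riemannian_metric G" shows "length_inf G x y < top"
  using segment_speed_bounded[OF G, of x y] length_inf_segment[OF G, of x y] by (metis ennreal_less_top le_less_trans)

lemma riemannian_dist_eq_length_inf: "riemannian_dist G x y = enn2real (length_inf G x y)"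
  by (simp add: riemannian_dist_def length_inf_def)

lemma ennreal_riemannian_dist:
  assumes G: "riemannian_metric G" shows "ennreal (riemannian_dist G x y) = length_inf G x y"
  using length_inf_finite[OF G] by (simp add: riemannian_dist_eq_length_inf)

lemma riemannian_dist_segment:
  assumes G: "riemannian_metric G" and L: "\<And>\<sigma>. \<sigma> \<in> {0..1} \<Longrightarrow> gnorm (G (x + \<sigma> *\<^sub>R (y - x))) (y - x) \<le> L"
  shows "riemannian_dist G x y \<le> L"
proof -
  have "0 \<le> gnorm (G (x + 0 *\<^sub>R (y - x))) (y - x)" by (rule gnorm_nonneg[OF riemannian_metric_posdef[OF G]])
  also have "\<dots> \<le> L" by (rule L) simp
  finally show ?thesis unfolding riemannian_dist_eq_length_inf using length_inf_segment[OF assms] by (intro enn2real_leI)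
qed

lemma piecewise_smoothE:
  assumes "piecewise_smooth_curve \<phi>"
  obtains P where "finite P" "continuous_on {0..1} \<phi>"
    "\<And>s. s \<in> {0<..<1} - P \<Longrightarrow> (\<phi> has_vector_derivative vector_derivative \<phi> (at s)) (at s)"
    "continuous_on ({0<..<1} - P) (\<lambda>s. vector_derivative \<phi> (at s))"
proof -
  obtain P where P: "finite P" "continuous_on {0..1} \<phi>" "smooth_on ({0<..<1} - P) \<phi>"
    using assms unfolding piecewise_smooth_curve_def by blast
  have der: "(\<phi> has_vector_derivative vector_derivative \<phi> (at s)) (at s)" if "s \<in> {0<..<1} - P" for s
    using smooth_on_imp_differentiable[OF P(3) that] by (simp flip: vector_derivative_works)
  have eq: "frechet_derivative \<phi> (at s) 1 = vector_derivative \<phi> (at s)" if "s \<in> {0<..<1} - P" for s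
    using frechet_derivative_at[OF der[OF that, unfolded has_vector_derivative_def]] by (metis scaleR_one)
  have "continuous_on ({0<..<1} - P) (\<lambda>s. vector_derivative \<phi> (at s))"
    using smooth_on_imp_continuous_derivative[OF P(3), of 1] eq by (metis (no_types, lifting) continuous_on_cong)
  then show thesis using that P der by blast
qed

lemma speed_measurable:
  assumes G: "riemannian_metric G" and \<phi>: "piecewise_smooth_curve \<phi>"
  shows "speed G \<phi> \<in> borel_measurable (lebesgue_on {0..1})"
proof -
  obtain P where P: "finite P" "continuous_on {0..1} \<phi>"
    "continuous_on ({0<..<1} - P) (\<lambda>s. vector_derivative \<phi> (at s))"
    by (rule piecewise_smoothE[OF \<phi>]) (rule that, assumption+)
  define X where "X = P \<union> {0, 1}"
  have "continuous_on ({0<..<1} - P) (\<lambda>s. G (\<phi> s))"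
    by (rule continuous_on_compose2[OF riemannian_metric_continuous[OF G, of UNIV] continuous_on_subset[OF P(2)]]) auto
  then have "continuous_on ({0<..<1} - P) (speed G \<phi>)"
    unfolding speed_def gnorm_def by (intro continuous_intros continuous_on_form P)
  moreover have "{0<..<1} - P \<in> sets lebesgue"
    using P(1) by (intro fmeasurableD lmeasurable_open open_Diff finite_imp_closed) (auto intro: bounded_subset[of "{0..1}"])
  ultimately have "speed G \<phi> \<in> borel_measurable (lebesgue_on ({0<..<1} - P))"
    by (rule continuous_imp_measurable_on_sets_lebesgue)
  moreover have "restrict_space (lebesgue_on {0..1}) (- (X \<inter> {0..1})) = lebesgue_on ({0<..<1} - P)"
  proof -
    have "{0..1} \<inter> - (X \<inter> {0..1}) = {0<..<1} - P" by (auto simp: X_def)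
    moreover have "- (X \<inter> {0..1}) \<in> sets lebesgue"
      using P(1) by (intro sets.compl_sets[of _ lebesgue, simplified, unfolded Compl_eq_Diff_UNIV[symmetric]]
        negligible_imp_sets negligible_finite) (auto simp: X_def)
    ultimately show ?thesis by (simp add: restrict_restrict_space)
  qed
  ultimately have "speed G \<phi> \<in> borel_measurable (restrict_space (lebesgue_on {0..1}) (- (X \<inter> {0..1})))"
    by simp
  then show ?thesis
    by (rule measurable_restrict_countable[rotated 3])
      (use P(1) in \<open>auto simp: X_def sets_restrict_space_iff intro: countable_finite\<close>)
qed

text \<open>
  All arcs are measured by restricting one integral over \<open>[0,1]\<close>, so that disjoint arcs add up
  to at most the length of the curve without reparametrisation.
\<close>

definition arc_length :: "(real^'n \<Rightarrow> real^'n^'n) \<Rightarrow> (real \<Rightarrow> real^'n) \<Rightarrow> real \<Rightarrow> real \<Rightarrow> ennreal" where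
  "arc_length G \<phi> a b = (\<integral>\<^sup>+ s. ennreal (speed G \<phi> s) * indicator {a<..<b} s \<partial>lebesgue_on {0..1})"

lemma arc_length_le_curve_length: "arc_length G \<phi> a b \<le> curve_length G \<phi>"
  unfolding arc_length_def curve_length_speed by (intro nn_integral_mono) (auto simp: indicator_def)

lemma sum_arc_length_le:
  assumes G: "riemannian_metric G" and \<phi>: "piecewise_smooth_curve \<phi>"
    and disj: "disjoint_family_on (\<lambda>i. {a i<..<b i}) I" and fin: "finite I"
  shows "(\<Sum>i\<in>I. arc_length G \<phi> (a i) (b i)) \<le> curve_length G \<phi>"
proof -
  have [measurable]: "speed G \<phi> \<in> borel_measurable (lebesgue_on {0..1})" by (rule speed_measurable[OF G \<phi>])
  have ind: "(\<lambda>s. indicator {u<..<v} s :: ennreal) \<in> borel_measurable (lebesgue_on {0..1})" for u v :: real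
    by (intro measurable_restrict_space1 borel_measurable_indicator) auto
  have "(\<Sum>i\<in>I. arc_length G \<phi> (a i) (b i))
    = (\<integral>\<^sup>+ s. (\<Sum>i\<in>I. ennreal (speed G \<phi> s) * indicator {a i<..<b i} s) \<partial>lebesgue_on {0..1})"
    unfolding arc_length_def by (rule nn_integral_sum[symmetric]) (use ind in measurable)
  also have "\<dots> \<le> (\<integral>\<^sup>+ s. ennreal (speed G \<phi> s) \<partial>lebesgue_on {0..1})"
  proof (rule nn_integral_mono)
    fix s
    have "(\<Sum>i\<in>I. indicator {a i<..<b i} s :: ennreal) = indicator (\<Union>i\<in>I. {a i<..<b i}) s"
      by (rule indicator_UN_disjoint[OF fin disj, symmetric])
    also have "\<dots> \<le> 1" by (simp add: indicator_def)
    finally have "ennreal (speed G \<phi> s) * (\<Sum>i\<in>I. indicator {a i<..<b i} s) \<le> ennreal (speed G \<phi> s) * 1"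
      by (intro mult_left_mono) auto
    then show "(\<Sum>i\<in>I. ennreal (speed G \<phi> s) * indicator {a i<..<b i} s) \<le> ennreal (speed G \<phi> s)"
      by (simp add: sum_distrib_left)
  qed
  finally show ?thesis by (simp add: curve_length_speed)
qed

text \<open>
  Pair the velocity with the chord \<open>\<delta>\<close> in the inner product of \<open>H\<close>: by the fundamental theorem of
  calculus, \<open>|\<delta>|\<^sup>2 = \<integral> \<langle>\<delta>, \<phi>'\<rangle> \<le> |\<delta>| \<integral> |\<phi>'|\<close>. For \<open>H\<close> the metric at the first
  point of the arc will be taken.
\<close>

lemma chord_le_arc_length:
  fixes \<phi> :: "real \<Rightarrow> real^'n"
  assumes G: "riemannian_metric G" and \<phi>: "piecewise_smooth_curve \<phi>" and ab: "0 \<le> a" "a \<le> b" "b \<le> 1" and H: "posdef H"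
    and K: "K > 0" "\<And>s v. s \<in> {a<..<b} \<Longrightarrow> gnorm H v \<le> K * gnorm (G (\<phi> s)) v"
  shows "ennreal (gnorm H (\<phi> b - \<phi> a)) \<le> ennreal K * arc_length G \<phi> a b"
proof (cases "arc_length G \<phi> a b = top")
  case True
  then show ?thesis using K(1) by (simp add: ennreal_mult_eq_top_iff)
next
  case False
  obtain P where P: "finite P" "continuous_on {0..1} \<phi>"
    "\<And>s. s \<in> {0<..<1} - P \<Longrightarrow> (\<phi> has_vector_derivative vector_derivative \<phi> (at s)) (at s)"
    by (rule piecewise_smoothE[OF \<phi>]) (rule that, assumption+)
  define \<delta> where "\<delta> = \<phi> b - \<phi> a"
  define D where "D = gnorm H \<delta>"
  have D0: "D \<ge> 0" unfolding D_def by (rule gnorm_nonneg[OF H])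
  have sp0: "speed G \<phi> s \<ge> 0" for s
    unfolding speed_def by (rule gnorm_nonneg[OF riemannian_metric_posdef[OF G]])
  define f where "f = (\<lambda>s. speed G \<phi> s * indicator {a<..<b} s)"
  have ar: "arc_length G \<phi> a b = (\<integral>\<^sup>+ s. ennreal (f s) \<partial>lebesgue_on {0..1})"
    unfolding arc_length_def f_def by (intro nn_integral_cong) (auto simp: indicator_def)
  have f0: "f s \<ge> 0" for s using sp0 by (simp add: f_def)
  have "(\<lambda>s. indicator {a<..<b} s :: real) \<in> borel_measurable (lebesgue_on {0..1})"
    by (intro measurable_restrict_space1 borel_measurable_indicator) auto
  then have fm: "f \<in> borel_measurable (lebesgue_on {0..1})"
    unfolding f_def using speed_measurable[OF G \<phi>] by measurable
  have fint: "integrable (lebesgue_on {0..1}) f"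
    by (rule integrableI_nonneg[OF fm]) (use f0 False ar in \<open>auto simp: top.not_eq_extremum\<close>)
  define I where "I = integral\<^sup>L (lebesgue_on {0..1}) f"
  have arI: "arc_length G \<phi> a b = ennreal I"
    unfolding ar I_def by (rule nn_integral_eq_integral[OF fint]) (use f0 in auto)
  have fI: "(f has_integral I) {0..1}"
    unfolding I_def by (rule has_integral_integral_lebesgue_on[OF fint]) simp
  define g where "g = (\<lambda>s. if s \<in> {a<..<b} - P then vector_derivative \<phi> (at s) else 0)"
  have "(g has_integral \<phi> b - \<phi> a) {a..b}"
  proof (rule fundamental_theorem_of_calculus_interior_strong[OF P(1) ab(2)])
    show "continuous_on {a..b} \<phi>" using P(2) by (rule continuous_on_subset) (use ab in auto)
    show "(\<phi> has_vector_derivative g x) (at x)" if "x \<in> {a<..<b} - P" for x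
      using that P(3)[of x] ab by (simp add: g_def)
  qed
  then have "(g has_integral \<delta>) {0..1}"
    unfolding \<delta>_def[symmetric] by (rule has_integral_on_superset) (use ab in \<open>auto simp: g_def\<close>)
  then have "((\<lambda>s. form H \<delta> (g s)) has_integral form H \<delta> \<delta>) {0..1}"
  proof -
    have "bounded_linear (\<lambda>v. form H \<delta> v)"
      unfolding form_def
      by (intro bounded_linear_compose[OF bounded_linear_inner_right] linear_conv_bounded_linear[THEN iffD1]) simp
    from has_integral_linear[OF \<open>(g has_integral \<delta>) {0..1}\<close> this] show ?thesis by (simp add: o_def)
  qed
  moreover have "((\<lambda>s. (D * K) * f s) has_integral (D * K) * I) {0..1}"
    by (rule has_integral_mult_right[OF fI])
  ultimately have "form H \<delta> \<delta> \<le> (D * K) * I"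
  proof (rule has_integral_le)
    fix s :: real assume "s \<in> {0..1}"
    show "form H \<delta> (g s) \<le> D * K * f s"
    proof (cases "s \<in> {a<..<b} - P")
      case True
      have "form H \<delta> (g s) \<le> D * gnorm H (g s)" unfolding D_def by (rule form_cauchy_schwarz[OF H])
      also have "\<dots> \<le> D * (K * gnorm (G (\<phi> s)) (g s))" using True D0 by (intro mult_left_mono K) auto
      also have "\<dots> = D * K * f s" using True by (simp add: f_def g_def speed_def)
      finally show ?thesis .
    next
      case False
      then have "g s = 0" unfolding g_def by (rule if_not_P)
      then show ?thesis using D0 K(1) f0[of s] by (simp add: form_simps)
    qed
  qed
  then have "D * D \<le> D * (K * I)" using gnorm_power2[OF H, of \<delta>] by (simp add: D_def power2_eq_square mult.assoc)
  moreover have "I \<ge> 0" unfolding I_def using f0 by simp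
  ultimately have "D \<le> K * I" using D0 K(1) by (cases "D = 0") (auto simp: mult_le_cancel_left)
  then show ?thesis using K(1) \<open>I \<ge> 0\<close> by (simp add: arI D_def \<delta>_def flip: ennreal_mult)
qed

text \<open>
  Convergence in the Riemannian distance implies Euclidean convergence, uniformly over a ball: a curve
  starting at \<open>p\<close> has to reach the sphere of radius \<open>m\<close> around \<open>p\<close> before it can leave, and up to
  that moment the metric is comparable with \<open>G p\<close>, which makes the curve at least \<open>c m / 2\<close> long.
\<close>

lemma riemannian_dist_small_imp_close:
  fixes G :: "real^'n \<Rightarrow> real^'n^'n"
  assumes G: "riemannian_metric G" and e: "\<epsilon> > 0"
  obtains \<eta> where "\<eta> > 0" "\<And>p y. \<lbrakk>p \<in> cball 0 R; riemannian_dist G p y < \<eta>\<rbrakk> \<Longrightarrow> norm (y - p) < \<epsilon>"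
proof -
  obtain c where c: "c > 0" "\<And>x v. x \<in> cball 0 R \<Longrightarrow> c * norm v \<le> gnorm (G x) v"
    by (rule gnorm_bounds[OF G, of R]) (rule that, assumption+)
  obtain r where r: "r > 0"
    "\<And>x y v. \<lbrakk>x \<in> cball 0 R; norm (y - x) \<le> r\<rbrakk> \<Longrightarrow> gnorm (G x) v \<le> 2 * gnorm (G y) v"
    by (rule gnorm_comparable[OF G, of R]) (rule that, assumption+)
  define m where "m = min \<epsilon> r"
  have m: "m > 0" "m \<le> \<epsilon>" "m \<le> r" using e r by (auto simp: m_def)
  have len: "ennreal (c * m / 2) \<le> curve_length G \<phi>"
    if p: "p \<in> cball 0 R" and \<phi>: "piecewise_smooth_curve \<phi>" "\<phi> 0 = p" "m \<le> norm (\<phi> 1 - p)" for p \<phi>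
  proof -
    have cont: "continuous_on {0..1} \<phi>" using \<phi>(1) by (simp add: piecewise_smooth_curve_def)
    define S where "S = {s \<in> {0..1}. m \<le> norm (\<phi> s - p)}"
    \<comment> \<open>The first time \<open>b\<close> at which the curve is at distance \<open>m\<close> from \<open>p\<close>.\<close>
    have "closed ({0..1} \<inter> (\<lambda>s. norm (\<phi> s - p)) -` {m..})"
      using cont by (intro continuous_closed_preimage continuous_intros) auto
    moreover have "S = {0..1} \<inter> (\<lambda>s. norm (\<phi> s - p)) -` {m..}" by (auto simp: S_def)
    moreover have "bounded S" by (rule bounded_subset[of "{0..1}"]) (auto simp: S_def)
    ultimately have "compact S" by (simp add: compact_eq_bounded_closed)
    moreover have "S \<noteq> {}" using \<phi>(3) by (auto simp: S_def intro!: exI[of _ 1])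
    ultimately obtain b where b: "b \<in> S" "\<And>s. s \<in> S \<Longrightarrow> b \<le> s" using compact_attains_inf by metis
    have "ennreal (gnorm (G p) (\<phi> b - \<phi> 0)) \<le> ennreal 2 * arc_length G \<phi> 0 b"
    proof (rule chord_le_arc_length[OF G \<phi>(1)])
      show "posdef (G p)" by (rule riemannian_metric_posdef[OF G])
      fix s v assume s: "s \<in> {0<..<b}"
      have "s \<notin> S" using b(2)[of s] s by auto
      moreover have "s \<in> {0..1}" using b(1) s by (auto simp: S_def)
      ultimately have "\<not> m \<le> norm (\<phi> s - p)" by (simp add: S_def)
      then have "norm (\<phi> s - p) \<le> r" using m by simp
      then show "gnorm (G p) v \<le> 2 * gnorm (G (\<phi> s)) v" using r(2) p by blast
    qed (use b in \<open>auto simp: S_def\<close>)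
    moreover have "c * m \<le> gnorm (G p) (\<phi> b - \<phi> 0)"
    proof -
      have "c * m \<le> c * norm (\<phi> b - p)" using b(1) c(1) by (auto simp: S_def)
      also have "\<dots> \<le> gnorm (G p) (\<phi> b - \<phi> 0)" using c(2)[OF p] \<phi>(2) by simp
      finally show ?thesis .
    qed
    ultimately have "ennreal (c * m) \<le> ennreal 2 * curve_length G \<phi>"
      by (meson arc_length_le_curve_length ennreal_leI mult_left_mono order_trans zero_le)
    then have "ennreal (1/2) * ennreal (c * m) \<le> ennreal (1/2) * (ennreal 2 * curve_length G \<phi>)"
      by (intro mult_left_mono) auto
    also have "\<dots> = (ennreal (1/2) * ennreal 2) * curve_length G \<phi>" by (simp only: mult.assoc)
    also have "ennreal (1/2) * ennreal 2 = ennreal (1/2 * 2)" by (rule ennreal_mult[symmetric]) auto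
    also have "ennreal (1/2 * 2) * curve_length G \<phi> = curve_length G \<phi>" by simp
    also have "ennreal (1/2) * ennreal (c * m) = ennreal (1/2 * (c * m))" using c m by (intro ennreal_mult[symmetric]) auto
    finally show ?thesis by simp
  qed
  show thesis
  proof
    show "c * m / 2 > 0" using c m by simp
    fix p y assume p: "p \<in> cball 0 R" and d: "riemannian_dist G p y < c * m / 2"
    have "norm (y - p) < m"
    proof (rule ccontr)
      assume "\<not> norm (y - p) < m"
      then have "ennreal (c * m / 2) \<le> length_inf G p y"
        unfolding length_inf_def using len[OF p] by (intro INF_greatest) auto
      then have "ennreal (c * m / 2) \<le> ennreal (riemannian_dist G p y)"
        by (simp add: ennreal_riemannian_dist[OF G])
      then have "c * m / 2 \<le> riemannian_dist G p y"
        by (subst (asm) ennreal_le_iff) (auto simp: riemannian_dist_def)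
      then show False using d by simp
    qed
    then show "norm (y - p) < \<epsilon>" using m by simp
  qed
qed

text \<open>
  Vertices are taken along an almost shortest curve. Passing from arcs to chords costs a factor 2,
  and so does passing from the metric at the first vertex of an edge to the metric along the edge.
\<close>

lemma riemannian_dist_polygon:
  fixes G :: "real^'n \<Rightarrow> real^'n^'n"
  assumes G: "riemannian_metric G" and L: "riemannian_dist G x y < L"
  obtains N :: nat and p :: "nat \<Rightarrow> real^'n" and l :: "nat \<Rightarrow> real" where
    "N > 0" "p 0 = x" "p N = y" "(\<Sum>i<N. l i) \<le> 4 * L"
    "\<And>i \<sigma>. i < N \<Longrightarrow> \<sigma> \<in> {0..1} \<Longrightarrow> gnorm (G (p i + \<sigma> *\<^sub>R (p (Suc i) - p i))) (p (Suc i) - p i) \<le> l i"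
proof -
  have L0: "L > 0" using L enn2real_nonneg unfolding riemannian_dist_def by (rule order_le_less_trans[rotated])
  have "length_inf G x y < ennreal L"
    unfolding ennreal_riemannian_dist[OF G, symmetric] using L L0 by (simp add: ennreal_less_iff riemannian_dist_def)
  then obtain \<phi> where \<phi>: "piecewise_smooth_curve \<phi>" "\<phi> 0 = x" "\<phi> 1 = y" "curve_length G \<phi> < ennreal L"
    unfolding length_inf_def INF_less_iff by blast
  have cont: "continuous_on {0..1} \<phi>" using \<phi>(1) by (simp add: piecewise_smooth_curve_def)
  obtain R where R: "\<And>s. s \<in> {0..1} \<Longrightarrow> norm (\<phi> s) \<le> R"
    using continuous_on_compact_bound[OF compact_Icc cont] by blast
  obtain r where r: "r > 0"
    "\<And>x y v. \<lbrakk>x \<in> cball 0 R; norm (y - x) \<le> r\<rbrakk> \<Longrightarrow> gnorm (G y) v \<le> 2 * gnorm (G x) v"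
    "\<And>x y v. \<lbrakk>x \<in> cball 0 R; norm (y - x) \<le> r\<rbrakk> \<Longrightarrow> gnorm (G x) v \<le> 2 * gnorm (G y) v"
    by (rule gnorm_comparable[OF G, of R]) (rule that, assumption+)
  have "uniformly_continuous_on {0..1} \<phi>" using cont by (intro compact_uniformly_continuous) auto
  then obtain d where d: "d > 0" "\<And>s t. \<lbrakk>s \<in> {0..1}; t \<in> {0..1}; dist t s < d\<rbrakk> \<Longrightarrow> dist (\<phi> t) (\<phi> s) < r"
    using r(1) unfolding uniformly_continuous_on_def by metis
  obtain N :: nat where N: "N > 0" "1 / N < d" using d(1) by (metis nat_approx_posE zero_less_Suc)
  define t where "t = (\<lambda>i :: nat. i / N)"
  define p where "p = (\<lambda>i. \<phi> (t i))"
  define l where "l = (\<lambda>i. 2 * gnorm (G (p i)) (p (Suc i) - p i))"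
  have t01: "t i \<in> {0..1}" if "i \<le> N" for i using that N by (simp add: t_def)
  have tS: "t (Suc i) = t i + 1 / N" for i by (simp add: t_def add_divide_distrib)
  have pR: "p i \<in> cball 0 R" if "i \<le> N" for i using R t01[OF that] by (simp add: p_def)
  have near: "norm (\<phi> s - p i) \<le> r" if "i < N" "s \<in> {t i..t (Suc i)}" for i s
  proof -
    have "s \<in> {0..1}" using that t01[of i] t01[of "Suc i"] by simp
    moreover have "dist s (t i) < d" using that tS N by (simp add: dist_real_def)
    ultimately show ?thesis using d(2)[of "t i" s] that t01[of i] by (simp add: p_def dist_norm)
  qed
  have l: "ennreal (l i) \<le> ennreal 4 * arc_length G \<phi> (t i) (t (Suc i))" if i: "i < N" for i
  proof -
    have "ennreal (gnorm (G (p i)) (\<phi> (t (Suc i)) - \<phi> (t i))) \<le> ennreal 2 * arc_length G \<phi> (t i) (t (Suc i))"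
    proof (rule chord_le_arc_length[OF G \<phi>(1)])
      show "posdef (G (p i))" by (rule riemannian_metric_posdef[OF G])
      show "0 \<le> t i" "t i \<le> t (Suc i)" "t (Suc i) \<le> 1" using t01[of i] t01[of "Suc i"] i tS N by auto
      fix s v assume "s \<in> {t i<..<t (Suc i)}"
      then show "gnorm (G (p i)) v \<le> 2 * gnorm (G (\<phi> s)) v"
        using near[of i s] pR[of i] i by (intro r(3)) auto
    qed simp
    then have "ennreal 2 * ennreal (gnorm (G (p i)) (p (Suc i) - p i)) \<le> ennreal 2 * (ennreal 2 * arc_length G \<phi> (t i) (t (Suc i)))"
      unfolding p_def by (intro mult_left_mono) auto
    then show ?thesis
      using gnorm_nonneg[OF riemannian_metric_posdef[OF G]] by (simp add: l_def ennreal_mult flip: mult.assoc)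
  qed
  have l0: "l i \<ge> 0" for i unfolding l_def using gnorm_nonneg[OF riemannian_metric_posdef[OF G]] by simp
  have "ennreal (\<Sum>i<N. l i) = (\<Sum>i<N. ennreal (l i))" by (rule sum_ennreal[symmetric]) (rule l0)
  also have "\<dots> \<le> (\<Sum>i<N. ennreal 4 * arc_length G \<phi> (t i) (t (Suc i)))" by (intro sum_mono l) auto
  also have "\<dots> = ennreal 4 * (\<Sum>i<N. arc_length G \<phi> (t i) (t (Suc i)))" by (simp add: sum_distrib_left)
  also have "\<dots> \<le> ennreal 4 * curve_length G \<phi>"
  proof (intro mult_left_mono sum_arc_length_le[OF G \<phi>(1)])
    have "{t i<..<t (Suc i)} \<inter> {t j<..<t (Suc j)} = {}" if "i < j" for i j
    proof -
      have "t (Suc i) \<le> t j" using that N unfolding t_def by (intro divide_right_mono) auto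
      then show ?thesis by auto
    qed
    then show "disjoint_family_on (\<lambda>i. {t i<..<t (Suc i)}) {..<N}"
      unfolding disjoint_family_on_def by (metis Int_commute linorder_neqE_nat)
  qed auto
  also have "\<dots> \<le> ennreal 4 * ennreal L" using \<phi>(4) by (intro mult_left_mono) auto
  also have "\<dots> = ennreal (4 * L)" using L0 by (simp add: ennreal_mult)
  finally have suml: "(\<Sum>i<N. l i) \<le> 4 * L" using L0 by (simp add: ennreal_le_iff)
  show thesis
  proof (rule that[OF N(1) _ _ suml])
    show "p 0 = x" "p N = y" using \<phi> N by (auto simp: p_def t_def)
    fix i \<sigma> assume i: "i < N" and \<sigma>: "\<sigma> \<in> {0..1 :: real}"
    have "norm (p (Suc i) - p i) \<le> r" using near[OF i, of "t (Suc i)"] tS N by (simp add: p_def)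
    moreover have "\<bar>\<sigma>\<bar> * norm (p (Suc i) - p i) \<le> 1 * norm (p (Suc i) - p i)" using \<sigma> by (intro mult_right_mono) auto
    ultimately have "norm (p i + \<sigma> *\<^sub>R (p (Suc i) - p i) - p i) \<le> r" by simp
    then show "gnorm (G (p i + \<sigma> *\<^sub>R (p (Suc i) - p i))) (p (Suc i) - p i) \<le> l i"
      unfolding l_def using pR[of i] i by (intro r(2)) auto
  qed
qed

section \<open>Solutions on compact time intervals\<close>

text \<open>
  While the input takes its values in a compact set, a solution has bounded velocity on compact
  intervals. Its absolute continuity then amounts to being Lipschitz, a property that is easier to
  transport through smooth maps.
\<close>

definition solves :: "('a::real_normed_vector \<Rightarrow> 'b \<Rightarrow> 'a) \<Rightarrow> (real \<Rightarrow> 'b) \<Rightarrow> real \<Rightarrow> real \<Rightarrow> (real \<Rightarrow> 'a) \<Rightarrow> bool" where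
  "solves f u a b \<xi> \<longleftrightarrow> (\<exists>L. L-lipschitz_on {a..b} \<xi>) \<and>
     (AE t in lebesgue_on {a..b}. (\<xi> has_vector_derivative f (\<xi> t) (u t)) (at t))"

definition admissible :: "'b::topological_space set \<Rightarrow> real \<Rightarrow> real \<Rightarrow> (real \<Rightarrow> 'b) \<Rightarrow> bool" where
  "admissible K a b u \<longleftrightarrow> u \<in> borel_measurable (lebesgue_on {a..b}) \<and> (AE t in lebesgue_on {a..b}. u t \<in> K)"

lemma AE_lebesgue_on_subset:
  fixes S T :: "real set"
  assumes "AE t in lebesgue_on T. P t" "S \<subseteq> T" "S \<in> sets lebesgue" "T \<in> sets lebesgue"
  shows "AE t in lebesgue_on S. P t"
  using assms by (auto simp: AE_restrict_space_iff elim: AE_mp)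

lemma solves_imp_continuous_on: "solves f u a b \<xi> \<Longrightarrow> continuous_on {a..b} \<xi>"
  unfolding solves_def using lipschitz_on_continuous_on by blast

lemma solves_bounded:
  assumes "solves f u a b \<xi>" obtains R where "R \<ge> 0" "\<And>t. t \<in> {a..b} \<Longrightarrow> norm (\<xi> t) \<le> R"
  by (rule continuous_on_compact_bound[OF compact_Icc solves_imp_continuous_on[OF assms]]) (rule that, assumption+)

lemma solves_subinterval:
  assumes "solves f u a b \<xi>" "a \<le> c" "d \<le> b" shows "solves f u c d \<xi>"
proof -
  have "{c..d} \<subseteq> {a..b}" using assms by auto
  then show ?thesis
    using assms(1) unfolding solves_def by (meson AE_lebesgue_on_subset lipschitz_on_subset lmeasurable_interval(1) fmeasurableD
      lmeasurable_cbox box_real)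
qed

lemma admissible_subinterval:
  assumes "admissible K a b u" "a \<le> c" "d \<le> b" shows "admissible K c d u"
proof -
  have sub: "{c..d} \<subseteq> {a..b}" using assms by auto
  have "u \<in> borel_measurable (restrict_space (lebesgue_on {a..b}) {c..d})"
    using assms(1) by (auto simp: admissible_def intro: measurable_restrict_space1)
  moreover have "restrict_space (lebesgue_on {a..b}) {c..d} = lebesgue_on {c..d}"
    using sub by (subst restrict_restrict_space) (simp_all add: Int_absorb1 del: Int_atLeastAtMost)
  ultimately show ?thesis
    using assms(1) AE_lebesgue_on_subset[OF _ sub] unfolding admissible_def by auto
qed

text \<open>
  The Lipschitz condition concerns state and input jointly: it also controls the effect of changing
  the input.
\<close>

definition lipschitz_field :: "'b::euclidean_space set \<Rightarrow> ('a::euclidean_space \<Rightarrow> 'b \<Rightarrow> 'a) \<Rightarrow> bool" where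
  "lipschitz_field K f \<longleftrightarrow> compact K \<and> K \<noteq> {} \<and> (\<forall>R. \<exists>L. L-lipschitz_on (cball 0 R \<times> K) (\<lambda>(x, u). f x u))"

lemma lipschitz_fieldE:
  fixes f :: "'a::euclidean_space \<Rightarrow> 'b::euclidean_space \<Rightarrow> 'a"
  assumes "lipschitz_field K f"
  obtains Z where "Z > 0"
    "\<And>x y u w. \<lbrakk>norm x \<le> R; norm y \<le> R; u \<in> K; w \<in> K\<rbrakk> \<Longrightarrow> norm (f x u - f y w) \<le> Z * (norm (x - y) + norm (u - w))"
proof -
  obtain L where L: "L-lipschitz_on (cball 0 R \<times> K) (\<lambda>(x, u). f x u)" using assms by (auto simp: lipschitz_field_def)
  show thesis
  proof (rule that[of "\<bar>L\<bar> + 1"])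
    fix x y :: 'a and u w :: 'b assume *: "norm x \<le> R" "norm y \<le> R" "u \<in> K" "w \<in> K"
    have "norm (f x u - f y w) \<le> L * dist (x, u) (y, w)"
      using lipschitz_onD[OF L, of "(x, u)" "(y, w)"] * by (simp add: dist_norm)
    also have "\<dots> \<le> (\<bar>L\<bar> + 1) * (norm (x - y) + norm (u - w))"
    proof (intro mult_mono)
      show "dist (x, u) (y, w) \<le> norm (x - y) + norm (u - w)"
        unfolding dist_Pair_Pair by (simp add: dist_norm sqrt_sum_squares_le_sum)
    qed auto
    finally show "norm (f x u - f y w) \<le> (\<bar>L\<bar> + 1) * (norm (x - y) + norm (u - w))" .
  qed auto
qed

text \<open>
  Composing with the projection onto a ball makes the field bounded and globally Lipschitz in the
  state. Of the input it is only known that almost all values lie in \<open>K\<close>; it is first changed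
  on a null set so as to take all its values there.
\<close>

lemma truncated_solution:
  fixes f :: "'a::euclidean_space \<Rightarrow> 'b::euclidean_space \<Rightarrow> 'a"
  assumes K: "lipschitz_field K f" and R: "R \<ge> 0"
  obtains M where "M \<ge> 0"
    "\<And>a b w x. a \<le> b \<Longrightarrow> admissible K a b w \<Longrightarrow> \<exists>\<zeta>. \<zeta> a = x \<and> M-lipschitz_on {a..b} \<zeta> \<and>
       (AE t in lebesgue_on {a..b}. (\<zeta> has_vector_derivative f (closest_point (cball 0 R) (\<zeta> t)) (w t)) (at t))"
proof -
  let ?B = "cball 0 R :: 'a set"
  let ?cp = "closest_point ?B"
  obtain Z where Z: "Z > 0"
    "\<And>x y u w. \<lbrakk>norm x \<le> R; norm y \<le> R; u \<in> K; w \<in> K\<rbrakk> \<Longrightarrow> norm (f x u - f y w) \<le> Z * (norm (x - y) + norm (u - w))"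
    by (rule lipschitz_fieldE[OF K, of R]) (rule that, assumption+)
  have Bne: "?B \<noteq> {}" using R by auto
  have cpB: "norm (?cp x) \<le> R" for x using closest_point_in_set[OF closed_cball Bne, of x] by simp
  have cpl: "norm (?cp x - ?cp y) \<le> norm (x - y)" for x y
    using closest_point_lipschitz[OF convex_cball closed_cball Bne, of x y] by (simp add: dist_norm)
  have compK: "compact K" and Kne: "K \<noteq> {}" using K by (auto simp: lipschitz_field_def)
  obtain k0 where k0: "k0 \<in> K" using Kne by blast
  obtain L where L: "L-lipschitz_on (?B \<times> K) (\<lambda>(x, u). f x u)" using K by (auto simp: lipschitz_field_def)
  have cont: "continuous_on (?B \<times> K) (\<lambda>(x, u). f x u)" by (rule lipschitz_on_continuous_on[OF L])
  obtain M where M: "M \<ge> 0" "\<And>s. s \<in> ?B \<times> K \<Longrightarrow> norm (case s of (x, u) \<Rightarrow> f x u) \<le> M"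
    by (rule continuous_on_compact_bound[OF compact_Times[OF compact_cball compK] cont]) (rule that, assumption+)
  show thesis
  proof (rule that[OF M(1)])
    fix a b :: real and w x assume ab: "a \<le> b" and w: "admissible K a b w"
    define v where "v = (\<lambda>t. if t \<in> {a..b} then w t else k0)"
    define v' where "v' = (\<lambda>t. if v t \<in> K then v t else k0)"
    have "v \<in> borel_measurable lebesgue"
      unfolding v_def using w measurable_restrict_space_iff[of "{a..b}" lebesgue k0 borel w]
      by (simp add: admissible_def)
    moreover have "K \<in> sets borel" using compK by (intro borel_closed compact_imp_closed)
    ultimately have v'm: "v' \<in> borel_measurable lebesgue" unfolding v'_def by measurable
    have v'K: "v' t \<in> K" for t using k0 by (simp add: v'_def)
    define g where "g = (\<lambda>t y. f (?cp y) (v' t))"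
    obtain \<zeta> where \<zeta>: "\<zeta> a = x" "M-lipschitz_on {a..b} \<zeta>"
      "AE t in lebesgue_on {a..b}. (\<zeta> has_vector_derivative g t (\<zeta> t)) (at t)"
    proof (rule caratheodory_existence[OF ab Z(1), of g M x])
      show "norm (g t y - g t z) \<le> Z * norm (y - z)" for t y z
      proof -
        have "norm (g t y - g t z) \<le> Z * (norm (?cp y - ?cp z) + norm (v' t - v' t))"
          unfolding g_def by (intro Z(2) cpB v'K)
        also have "\<dots> \<le> Z * norm (y - z)" using cpl Z(1) by simp
        finally show ?thesis .
      qed
      show "norm (g t y) \<le> M" for t y
        using M(2)[of "(?cp y, v' t)"] cpB[of y] v'K by (simp add: g_def)
      fix \<xi> :: "real \<Rightarrow> 'a" assume \<xi>: "continuous_on UNIV \<xi>"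
      let ?h = "\<lambda>z. indicator (?B \<times> K) z *\<^sub>R (case z of (x, u) \<Rightarrow> f x u)"
      have "?B \<times> K \<in> sets borel"
        using compact_Times[OF compact_cball compK] by (intro borel_closed compact_imp_closed)
      then have h: "?h \<in> borel_measurable borel" by (rule borel_measurable_continuous_on_indicator[OF _ cont])
      have "continuous_on UNIV (\<lambda>t. ?cp (\<xi> t))"
        by (rule continuous_on_compose2[OF continuous_on_closest_point[OF convex_cball closed_cball Bne] \<xi>]) auto
      then have "(\<lambda>t. ?cp (\<xi> t)) \<in> borel_measurable lebesgue"
        by (intro measurable_completion) (simp add: borel_measurable_continuous_onI)
      from borel_measurable_Pair[OF this v'm] have "(\<lambda>t. ?h (?cp (\<xi> t), v' t)) \<in> borel_measurable lebesgue"
        by (rule measurable_compose[OF _ h])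
      moreover have "?h (?cp (\<xi> t), v' t) = g t (\<xi> t)" for t using cpB v'K by (simp add: g_def)
      ultimately show "(\<lambda>t. g t (\<xi> t)) \<in> borel_measurable lebesgue" by simp
    qed (rule that, assumption+)
    have "AE t in lebesgue_on {a..b}. v' t = w t"
    proof -
      have "AE t in lebesgue_on {a..b}. w t \<in> K" "AE t in lebesgue_on {a..b}. t \<in> {a..b}"
        using w by (auto simp: admissible_def)
      then show ?thesis by eventually_elim (auto simp: v'_def v_def)
    qed
    with \<zeta>(3) have "AE t in lebesgue_on {a..b}. (\<zeta> has_vector_derivative f (?cp (\<zeta> t)) (w t)) (at t)"
      unfolding g_def by eventually_elim simp
    with \<zeta> show "\<exists>\<zeta>. \<zeta> a = x \<and> M-lipschitz_on {a..b} \<zeta> \<and>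
       (AE t in lebesgue_on {a..b}. (\<zeta> has_vector_derivative f (?cp (\<zeta> t)) (w t)) (at t))" by blast
  qed
qed

lemma solution_dependence:
  fixes f :: "'a::euclidean_space \<Rightarrow> 'b::euclidean_space \<Rightarrow> 'a"
  assumes K: "lipschitz_field K f"
  obtains Z where "Z > 0"
    "\<And>a b u w \<xi> \<zeta> D t. \<lbrakk>solves f u a b \<xi>; solves f w a b \<zeta>; AE t in lebesgue_on {a..b}. u t \<in> K \<and> w t \<in> K \<and> norm (u t - w t) \<le> D;
       \<forall>t\<in>{a..b}. norm (\<xi> t) \<le> R; \<forall>t\<in>{a..b}. norm (\<zeta> t) \<le> R; t \<in> {a..b}; D \<ge> 0\<rbrakk> \<Longrightarrow>
      (norm (\<xi> t - \<zeta> t))\<^sup>2 \<le> exp (Z * (b - a)) * ((norm (\<xi> a - \<zeta> a))\<^sup>2 + D\<^sup>2)"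
proof -
  obtain Z where Z: "Z > 0"
    "\<And>x y u w. \<lbrakk>norm x \<le> R; norm y \<le> R; u \<in> K; w \<in> K\<rbrakk> \<Longrightarrow> norm (f x u - f y w) \<le> Z * (norm (x - y) + norm (u - w))"
    by (rule lipschitz_fieldE[OF K, of R]) (rule that, assumption+)
  show thesis
  proof (rule that[of "3 * Z"])
    show "3 * Z > 0" using Z by simp
    fix a b u w \<xi> \<zeta> and D t :: real
    assume s: "solves f u a b \<xi>" "solves f w a b \<zeta>" and ae: "AE t in lebesgue_on {a..b}. u t \<in> K \<and> w t \<in> K \<and> norm (u t - w t) \<le> D"
      and bd: "\<forall>t\<in>{a..b}. norm (\<xi> t) \<le> R" "\<forall>t\<in>{a..b}. norm (\<zeta> t) \<le> R" and t: "t \<in> {a..b}" and D: "D \<ge> 0"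
    obtain L M where LM: "L-lipschitz_on {a..b} \<xi>" "M-lipschitz_on {a..b} \<zeta>" using s by (auto simp: solves_def)
    have d: "AE t in lebesgue_on {a..b}. (\<xi> has_vector_derivative f (\<xi> t) (u t)) (at t)"
      "AE t in lebesgue_on {a..b}. (\<zeta> has_vector_derivative f (\<zeta> t) (w t)) (at t)" using s by (auto simp: solves_def)
    have in_ab: "AE t in lebesgue_on {a..b}. t \<in> {a..b}" by (rule AE_I2) simp
    have "AE t in lebesgue_on {a..b}. \<exists>v z. (\<xi> has_vector_derivative v) (at t) \<and> (\<zeta> has_vector_derivative z) (at t)
        \<and> norm (v - z) \<le> Z * (norm (\<xi> t - \<zeta> t) + D)"
      using d ae in_ab
    proof eventually_elim
      case (elim t)
      have "norm (f (\<xi> t) (u t) - f (\<zeta> t) (w t)) \<le> Z * (norm (\<xi> t - \<zeta> t) + norm (u t - w t))"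
        using elim bd by (intro Z(2)) auto
      also have "\<dots> \<le> Z * (norm (\<xi> t - \<zeta> t) + D)" using elim Z(1) by simp
      finally show ?case using elim by blast
    qed
    from curve_gronwall[OF t LM Z(1) D this]
    have "(norm (\<xi> t - \<zeta> t))\<^sup>2 \<le> exp (3 * Z * (t - a)) * ((norm (\<xi> a - \<zeta> a))\<^sup>2 + D\<^sup>2)" .
    also have "\<dots> \<le> exp (3 * Z * (b - a)) * ((norm (\<xi> a - \<zeta> a))\<^sup>2 + D\<^sup>2)"
      using t Z(1) by (intro mult_right_mono) auto
    finally show "(norm (\<xi> t - \<zeta> t))\<^sup>2 \<le> exp (3 * Z * (b - a)) * ((norm (\<xi> a - \<zeta> a))\<^sup>2 + D\<^sup>2)" .
  qed
qed

lemma solves_unique: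
  fixes f :: "'a::euclidean_space \<Rightarrow> 'b::euclidean_space \<Rightarrow> 'a"
  assumes K: "lipschitz_field K f" and u: "admissible K a b u"
    and s: "solves f u a b \<xi>" "solves f u a b \<zeta>" "\<xi> a = \<zeta> a" and t: "t \<in> {a..b}"
  shows "\<xi> t = \<zeta> t"
proof -
  obtain R1 where R1: "\<And>t. t \<in> {a..b} \<Longrightarrow> norm (\<xi> t) \<le> R1" by (rule solves_bounded[OF s(1)]) (rule that, assumption)
  obtain R2 where R2: "\<And>t. t \<in> {a..b} \<Longrightarrow> norm (\<zeta> t) \<le> R2" by (rule solves_bounded[OF s(2)]) (rule that, assumption)
  obtain Z where "Z > 0" and Z:
    "\<And>a b u w \<xi> \<zeta> D t. \<lbrakk>solves f u a b \<xi>; solves f w a b \<zeta>; AE t in lebesgue_on {a..b}. u t \<in> K \<and> w t \<in> K \<and> norm (u t - w t) \<le> D;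
       \<forall>t\<in>{a..b}. norm (\<xi> t) \<le> max R1 R2; \<forall>t\<in>{a..b}. norm (\<zeta> t) \<le> max R1 R2; t \<in> {a..b}; D \<ge> 0\<rbrakk> \<Longrightarrow>
      (norm (\<xi> t - \<zeta> t))\<^sup>2 \<le> exp (Z * (b - a)) * ((norm (\<xi> a - \<zeta> a))\<^sup>2 + D\<^sup>2)"
    by (rule solution_dependence[OF K, of "max R1 R2"]) (rule that, assumption+)
  have "(norm (\<xi> t - \<zeta> t))\<^sup>2 \<le> exp (Z * (b - a)) * ((norm (\<xi> a - \<zeta> a))\<^sup>2 + 0\<^sup>2)"
    by (rule Z[OF s(1,2)]) (use u R1 R2 t in \<open>auto simp: admissible_def le_max_iff_disj\<close>)
  then show ?thesis using s(3) by simp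
qed

text \<open>
  By Gronwall's inequality the solution of the system truncated to the ball of radius \<open>R + 1\<close> stays
  within distance 1 of \<open>\<xi>\<close>; so it never leaves that ball and solves the original equation. What matters
  later is that \<open>\<eta>\<close> depends on \<open>\<xi>\<close> only through the bound \<open>R\<close>.
\<close>

lemma solution_continuation:
  fixes f :: "'a::euclidean_space \<Rightarrow> 'b::euclidean_space \<Rightarrow> 'a"
  assumes K: "lipschitz_field K f" and R: "R \<ge> 0" and ab: "a \<le> b"
  obtains \<eta> where "\<eta> > 0"
    "\<And>u w \<xi> y. \<lbrakk>solves f u a b \<xi>; admissible K a b u; admissible K a b w; \<forall>t\<in>{a..b}. norm (\<xi> t) \<le> R;
       AE t in lebesgue_on {a..b}. norm (u t - w t) \<le> \<eta>; norm (\<xi> a - y) \<le> \<eta>\<rbrakk> \<Longrightarrow>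
      \<exists>\<zeta>. solves f w a b \<zeta> \<and> \<zeta> a = y \<and> (\<forall>t\<in>{a..b}. norm (\<zeta> t) \<le> R + 1)"
proof -
  let ?B = "cball 0 (R + 1) :: 'a set"
  let ?cp = "closest_point ?B"
  have R1: "R + 1 \<ge> 0" using R by simp
  have Bne: "?B \<noteq> {}" using R by auto
  have cpB: "norm (?cp x) \<le> R + 1" for x using closest_point_in_set[OF closed_cball Bne, of x] by simp
  have cpl: "norm (?cp x - ?cp y) \<le> norm (x - y)" for x y
    using closest_point_lipschitz[OF convex_cball closed_cball Bne, of x y] by (simp add: dist_norm)
  have cp_id: "?cp x = x" if "norm x \<le> R + 1" for x using that by (simp add: closest_point_self)
  obtain M where M:
    "\<And>a b w x. a \<le> b \<Longrightarrow> admissible K a b w \<Longrightarrow> \<exists>\<zeta>. \<zeta> a = x \<and> M-lipschitz_on {a..b} \<zeta> \<and>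
       (AE t in lebesgue_on {a..b}. (\<zeta> has_vector_derivative f (?cp (\<zeta> t)) (w t)) (at t))"
    by (rule truncated_solution[OF K R1]) (rule that, assumption+)
  obtain Z where Z: "Z > 0"
    "\<And>x y u w. \<lbrakk>norm x \<le> R + 1; norm y \<le> R + 1; u \<in> K; w \<in> K\<rbrakk> \<Longrightarrow> norm (f x u - f y w) \<le> Z * (norm (x - y) + norm (u - w))"
    by (rule lipschitz_fieldE[OF K, of "R + 1"]) (rule that, assumption+)
  \<comment> \<open>Chosen so that the bound \<open>exp (3 Z (b - a)) (\<eta>\<^sup>2 + \<eta>\<^sup>2)\<close> from Gronwall's inequality equals 1.\<close>
  define \<eta> where "\<eta> = sqrt (exp (- 3 * Z * (b - a)) / 2)"
  have \<eta>: "\<eta> > 0" "\<eta>\<^sup>2 = exp (- 3 * Z * (b - a)) / 2" by (auto simp: \<eta>_def)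
  show thesis
  proof (rule that[OF \<eta>(1)])
    fix u w \<xi> y
    assume s: "solves f u a b \<xi>" and u: "admissible K a b u" and w: "admissible K a b w"
      and bd: "\<forall>t\<in>{a..b}. norm (\<xi> t) \<le> R"
      and uw: "AE t in lebesgue_on {a..b}. norm (u t - w t) \<le> \<eta>" and y: "norm (\<xi> a - y) \<le> \<eta>"
    have bd': "norm (\<xi> t) \<le> R + 1" if "t \<in> {a..b}" for t using bspec[OF bd that] by simp
    obtain \<zeta> where \<zeta>: "\<zeta> a = y" "M-lipschitz_on {a..b} \<zeta>"
       "AE t in lebesgue_on {a..b}. (\<zeta> has_vector_derivative f (?cp (\<zeta> t)) (w t)) (at t)"
      using M[OF ab w, of y] by blast
    obtain L where L: "L-lipschitz_on {a..b} \<xi>" using s by (auto simp: solves_def)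
    have d: "AE t in lebesgue_on {a..b}. (\<xi> has_vector_derivative f (\<xi> t) (u t)) (at t)" using s by (auto simp: solves_def)
    have in_ab: "AE t in lebesgue_on {a..b}. t \<in> {a..b}" by (rule AE_I2) simp
    have uK: "AE t in lebesgue_on {a..b}. u t \<in> K" "AE t in lebesgue_on {a..b}. w t \<in> K"
      using u w by (auto simp: admissible_def)
    have *: "AE t in lebesgue_on {a..b}. \<exists>v z. (\<xi> has_vector_derivative v) (at t) \<and> (\<zeta> has_vector_derivative z) (at t)
        \<and> norm (v - z) \<le> Z * (norm (\<xi> t - \<zeta> t) + \<eta>)"
      using d \<zeta>(3) uw uK in_ab
    proof eventually_elim
      case (elim t)
      have "norm (f (\<xi> t) (u t) - f (?cp (\<zeta> t)) (w t)) \<le> Z * (norm (\<xi> t - ?cp (\<zeta> t)) + norm (u t - w t))"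
        using elim bd' by (intro Z(2) cpB) auto
      also have "\<xi> t = ?cp (\<xi> t)" using cp_id[of "\<xi> t"] bd'[of t] elim by simp
      also have "Z * (norm (?cp (\<xi> t) - ?cp (\<zeta> t)) + norm (u t - w t)) \<le> Z * (norm (\<xi> t - \<zeta> t) + \<eta>)"
        using cpl elim Z(1) by (intro mult_left_mono add_mono) auto
      finally show ?case using elim \<open>\<xi> t = ?cp (\<xi> t)\<close> by metis
    qed
    have near: "norm (\<zeta> t) \<le> R + 1" if t: "t \<in> {a..b}" for t
    proof -
      have "(norm (\<xi> t - \<zeta> t))\<^sup>2 \<le> exp (3 * Z * (t - a)) * ((norm (\<xi> a - \<zeta> a))\<^sup>2 + \<eta>\<^sup>2)"
        by (rule curve_gronwall[OF t L \<zeta>(2) Z(1) _ *]) (use \<eta> in auto)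
      also have "\<dots> \<le> exp (3 * Z * (b - a)) * (\<eta>\<^sup>2 + \<eta>\<^sup>2)"
        using t Z(1) y \<zeta>(1) \<eta>(1) by (intro mult_mono add_mono power_mono) auto
      also have "\<dots> = exp (3 * Z * (b - a)) * exp (- 3 * Z * (b - a))" by (simp add: \<eta>(2))
      also have "\<dots> = 1" by (simp flip: exp_add)
      finally have "norm (\<xi> t - \<zeta> t) \<le> 1" by (simp add: power2_le_iff_abs_le abs_square_le_1)
      then show ?thesis using bspec[OF bd t] norm_triangle_sub[of "\<zeta> t" "\<xi> t"] by (simp add: norm_minus_commute)
    qed
    have "AE t in lebesgue_on {a..b}. (\<zeta> has_vector_derivative f (\<zeta> t) (w t)) (at t)"
      using \<zeta>(3) in_ab by eventually_elim (use near cp_id in auto)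
    then have "solves f w a b \<zeta>" using \<zeta>(2) by (auto simp: solves_def)
    then show "\<exists>\<zeta>. solves f w a b \<zeta> \<and> \<zeta> a = y \<and> (\<forall>t\<in>{a..b}. norm (\<zeta> t) \<le> R + 1)" using near \<zeta>(1) by blast
  qed
qed

text \<open>
  Solutions of the truncated system have speed at most \<open>M\<close>, so they stay in the ball of radius 1
  around \<open>x\<close> for the time \<open>1 / (M + 1)\<close>. This time depends neither on the initial time nor on the input.
\<close>

lemma local_solution:
  fixes f :: "'a::euclidean_space \<Rightarrow> 'b::euclidean_space \<Rightarrow> 'a"
  assumes K: "lipschitz_field K f"
  obtains \<tau> where "\<tau> > 0"
    "\<And>a b w. \<lbrakk>a \<le> b; b - a \<le> \<tau>; admissible K a b w\<rbrakk> \<Longrightarrow> \<exists>\<zeta>. solves f w a b \<zeta> \<and> \<zeta> a = x"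
proof -
  let ?R = "norm x + 1"
  let ?cp = "closest_point (cball 0 ?R)"
  have R: "?R \<ge> 0" by simp
  obtain M where M: "M \<ge> 0"
    "\<And>a b w x. a \<le> b \<Longrightarrow> admissible K a b w \<Longrightarrow> \<exists>\<zeta>. \<zeta> a = x \<and> M-lipschitz_on {a..b} \<zeta> \<and>
       (AE t in lebesgue_on {a..b}. (\<zeta> has_vector_derivative f (?cp (\<zeta> t)) (w t)) (at t))"
    by (rule truncated_solution[OF K R]) (rule that, assumption+)
  show thesis
  proof (rule that[of "1 / (M + 1)"])
    show "1 / (M + 1) > 0" using M(1) by simp
    fix a b :: real and w assume ab: "a \<le> b" "b - a \<le> 1 / (M + 1)" and w: "admissible K a b w"
    obtain \<zeta> where \<zeta>: "\<zeta> a = x" "M-lipschitz_on {a..b} \<zeta>"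
       "AE t in lebesgue_on {a..b}. (\<zeta> has_vector_derivative f (?cp (\<zeta> t)) (w t)) (at t)"
      using M(2)[OF ab(1) w, of x] by blast
    have near: "?cp (\<zeta> t) = \<zeta> t" if t: "t \<in> {a..b}" for t
    proof -
      have "norm (\<zeta> t - x) \<le> M * (t - a)"
        using lipschitz_onD[OF \<zeta>(2) t, of a] t \<zeta>(1) by (simp add: dist_norm)
      also have "\<dots> \<le> (M + 1) * (1 / (M + 1))" using t ab M(1) by (intro mult_mono) auto
      finally have "norm (\<zeta> t - x) \<le> 1" using M(1) by simp
      then have "norm (\<zeta> t) \<le> ?R" using norm_triangle_sub[of "\<zeta> t" x] by simp
      then show ?thesis by (simp add: closest_point_self)
    qed
    have in_ab: "AE t in lebesgue_on {a..b}. t \<in> {a..b}" by (rule AE_I2) simp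
    have "AE t in lebesgue_on {a..b}. (\<zeta> has_vector_derivative f (\<zeta> t) (w t)) (at t)"
      using \<zeta>(3) in_ab by eventually_elim (use near in auto)
    then have "solves f w a b \<zeta>" using \<zeta>(2) by (auto simp: solves_def)
    then show "\<exists>\<zeta>. solves f w a b \<zeta> \<and> \<zeta> a = x" using \<zeta>(1) by blast
  qed
qed

lemma solves_concat:
  fixes \<xi> \<zeta> :: "real \<Rightarrow> 'a::euclidean_space"
  assumes s: "solves f u a m \<xi>" "solves f u m b \<zeta>" and eq: "\<xi> m = \<zeta> m" and m: "a \<le> m" "m \<le> b"
  shows "solves f u a b (\<lambda>t. if t \<le> m then \<xi> t else \<zeta> t)" (is "solves f u a b ?\<phi>")
  unfolding solves_def
proof
  show "\<exists>L. L-lipschitz_on {a..b} ?\<phi>" using s eq lipschitz_on_concat_max unfolding solves_def by blast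
  let ?N1 = "{t \<in> {a..m}. \<not> (\<xi> has_vector_derivative f (\<xi> t) (u t)) (at t)}"
  let ?N2 = "{t \<in> {m..b}. \<not> (\<zeta> has_vector_derivative f (\<zeta> t) (u t)) (at t)}"
  have N: "negligible ?N1" "negligible ?N2"
    using s unfolding solves_def by (intro AE_lebesgue_on_exceptional_negligible; simp)+
  show "AE t in lebesgue_on {a..b}. (?\<phi> has_vector_derivative f (?\<phi> t) (u t)) (at t)"
  proof (rule negligible_imp_AE_lebesgue_on)
    show "negligible (insert m (?N1 \<union> ?N2))" using N by simp
    fix t assume t: "t \<in> {a..b}" "t \<notin> insert m (?N1 \<union> ?N2)"
    then consider "t < m" "(\<xi> has_vector_derivative f (\<xi> t) (u t)) (at t)"
      | "t > m" "(\<zeta> has_vector_derivative f (\<zeta> t) (u t)) (at t)" by fastforce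
    then show "(?\<phi> has_vector_derivative f (?\<phi> t) (u t)) (at t)"
    proof cases
      case 1
      have "(?\<phi> has_vector_derivative f (\<xi> t) (u t)) (at t)"
        by (rule has_vector_derivative_transform_within_open[OF 1(2), of "{..<m}"]) (use 1 in auto)
      then show ?thesis using 1 by simp
    next
      case 2
      have "(?\<phi> has_vector_derivative f (\<zeta> t) (u t)) (at t)"
        by (rule has_vector_derivative_transform_within_open[OF 2(2), of "{m<..}"]) (use 2 in auto)
      then show ?thesis using 2 by simp
    qed
  qed simp
qed

section \<open>Contraction of nearby solutions\<close>

lemma lipschitz_fun_sum:
  assumes "finite I" "\<And>i. i \<in> I \<Longrightarrow> lipschitz_fun a b (g i)"
  shows "lipschitz_fun a b (\<lambda>t. \<Sum>i\<in>I. g i t)"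
  using assms
proof (induction I)
  case empty
  show ?case by (auto intro: lipschitz_on_constant)
next
  case (insert i I)
  then obtain A B where "A-lipschitz_on {a..b} (g i)" "B-lipschitz_on {a..b} (\<lambda>t. \<Sum>i\<in>I. g i t)" by blast
  from lipschitz_on_add[OF this] show ?case using insert.hyps by auto
qed

lemma lipschitz_fun_nth:
  fixes g :: "real \<Rightarrow> 'a::real_normed_vector ^ 'n"
  assumes "lipschitz_fun a b g" shows "lipschitz_fun a b (\<lambda>t. g t $ i)"
proof -
  obtain A where A: "A-lipschitz_on {a..b} g" using assms by blast
  have "A-lipschitz_on {a..b} (\<lambda>t. g t $ i)"
  proof (rule lipschitz_onI[OF _ lipschitz_on_nonneg[OF A]])
    fix x y assume xy: "x \<in> {a..b}" "y \<in> {a..b}"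
    have "dist (g x $ i) (g y $ i) \<le> dist (g x) (g y)" by (rule dist_vec_nth_le)
    also have "\<dots> \<le> A * dist x y" using lipschitz_onD[OF A xy] .
    finally show "dist (g x $ i) (g y $ i) \<le> A * dist x y" .
  qed
  then show ?thesis by blast
qed

lemma lipschitz_fun_form:
  fixes I J :: "real \<Rightarrow> real^'n"
  assumes "lipschitz_fun a b H" "lipschitz_fun a b I" "lipschitz_fun a b J"
  shows "lipschitz_fun a b (\<lambda>t. form (H t) (I t) (J t))"
  unfolding form_sum by (intro lipschitz_fun_sum lipschitz_fun_mult lipschitz_fun_nth assms) auto

lemma has_vector_derivative_nth:
  "(g has_vector_derivative g') F \<Longrightarrow> ((\<lambda>t. g t $ i) has_vector_derivative g' $ i) F"
  by (rule bounded_linear.has_vector_derivative[OF bounded_linear_vec_nth])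

lemma form_has_real_derivative:
  fixes I J :: "real \<Rightarrow> real^'n"
  assumes "(H has_vector_derivative H') (at t)" "(I has_vector_derivative I') (at t)" "(J has_vector_derivative J') (at t)"
  shows "((\<lambda>t. form (H t) (I t) (J t)) has_real_derivative
    form H' (I t) (J t) + form (H t) I' (J t) + form (H t) (I t) J') (at t)"
proof -
  have H: "((\<lambda>t. H t $ i $ j) has_real_derivative H' $ i $ j) (at t)"
    and I: "((\<lambda>t. I t $ i) has_real_derivative I' $ i) (at t)"
    and J: "((\<lambda>t. J t $ i) has_real_derivative J' $ i) (at t)" for i j
    using assms by (auto simp: has_real_derivative_iff_has_vector_derivative intro!: has_vector_derivative_nth)
  show ?thesis
    unfolding form_sum
    by (rule derivative_eq_intros H I J refl | simp add: sum.distrib[symmetric])+ (simp add: algebra_simps)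
qed

text \<open>
  \<open>V\<close> is the set of admitted input variations: the whole space for contraction with respect to states
  and inputs, \<open>{0}\<close> for contraction with respect to states. It is a subspace so that the difference of
  two inputs can be distributed over many small steps.
\<close>

definition contracting ::
  "(real^'m) set \<Rightarrow> (real^'n \<Rightarrow> real^'m \<Rightarrow> real^'n) \<Rightarrow> (real^'n \<Rightarrow> real^'n^'n) \<Rightarrow> real \<Rightarrow> real \<Rightarrow> (real^'m) set \<Rightarrow> bool" where
  "contracting U f G lam \<alpha> V \<longleftrightarrow> lam > 0 \<and> \<alpha> \<ge> 0 \<and> subspace V \<and>
     (\<forall>u\<in>U. \<forall>x X. \<forall>Y\<in>V. form (contraction_matrix f G x u) X X + 2 * form (G x) (jac_u f x u *v Y) X
        \<le> - lam * form (G x) X X + \<alpha> * gnorm (G x) X * norm Y)"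

lemma metric_derivative_entries:
  fixes G :: "real^'n \<Rightarrow> real^'n^'n"
  assumes G: "riemannian_metric G"
  shows "(\<chi> i j. \<Sum>k\<in>UNIV. frechet_derivative (\<lambda>y. G y $ i $ j) (at x) (axis k 1) * v $ k)
    = frechet_derivative G (at x) v"
proof -
  have d: "(G has_derivative frechet_derivative G (at x)) (at x)"
    using G smooth_on_has_derivative unfolding riemannian_metric_def by blast
  have lin: "linear (frechet_derivative G (at x))" using d has_derivative_linear by blast
  have ent: "frechet_derivative (\<lambda>y. G y $ i $ j) (at x) = (\<lambda>h. frechet_derivative G (at x) h $ i $ j)" for i j
    by (rule frechet_derivative_at[symmetric])
      (intro bounded_linear.has_derivative[OF bounded_linear_vec_nth] d)
  have "frechet_derivative G (at x) v = frechet_derivative G (at x) (\<Sum>k\<in>UNIV. (v $ k) *\<^sub>R axis k 1)"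
    using basis_expansion[of v] by (simp add: scalar_mult_eq_scaleR)
  also have "\<dots> = (\<Sum>k\<in>UNIV. (v $ k) *\<^sub>R frechet_derivative G (at x) (axis k 1))"
    by (simp add: linear_sum[OF lin] linear_scale[OF lin])
  finally show ?thesis unfolding ent by (simp add: vec_eq_iff mult.commute)
qed

text \<open>
  The third summand of the contraction matrix is the derivative of \<open>G\<close> in the direction of the field,
  that is, the rate of change of \<open>G\<close> along a solution.
\<close>

lemma contraction_matrix_form:
  fixes G :: "real^'n \<Rightarrow> real^'n^'n"
  assumes G: "riemannian_metric G"
  shows "form (contraction_matrix f G x u) X X
    = 2 * form (G x) (jac_x f x u *v X) X + form (frechet_derivative G (at x) (f x u)) X X"
proof -
  have sym: "transpose (G x) = G x" using G by (simp add: riemannian_metric_def)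
  have "form (transpose (jac_x f x u) ** G x) X X = form (G x) (jac_x f x u *v X) X"
    unfolding form_def by (metis dot_lmul_matrix matrix_vector_mul_assoc transpose_matrix_vector inner_commute)
  moreover have "form (G x ** jac_x f x u) X X = form (G x) X (jac_x f x u *v X)"
    unfolding form_def by (simp add: matrix_vector_mul_assoc)
  moreover have "form (G x) X (jac_x f x u *v X) = form (G x) (jac_x f x u *v X) X" by (rule form_commute[OF sym])
  ultimately show ?thesis
    unfolding contraction_matrix_def metric_derivative_entries[OF G] by (simp add: form_simps)
qed

lemma partial_jacobians:
  fixes f :: "real^'n \<Rightarrow> real^'m \<Rightarrow> real^'n"
  assumes d: "((\<lambda>(x, u). f x u) has_derivative D) (at (x, u))"
  shows "D (X, Y) = jac_x f x u *v X + jac_u f x u *v Y"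
proof -
  have lin: "linear D" using d has_derivative_linear by blast
  have "((\<lambda>y. (y, u)) has_derivative (\<lambda>h. (h, 0))) (at x)" by (auto intro!: derivative_eq_intros)
  from has_derivative_compose[OF this, of "\<lambda>(x, u). f x u" D] d
  have dx: "((\<lambda>y. f y u) has_derivative (\<lambda>h. D (h, 0))) (at x)" by simp
  have "((\<lambda>w. (x, w)) has_derivative (\<lambda>h. (0, h))) (at u)" by (auto intro!: derivative_eq_intros)
  from has_derivative_compose[OF this, of "\<lambda>(x, u). f x u" D] d
  have du: "((\<lambda>w. f x w) has_derivative (\<lambda>h. D (0, h))) (at u)" by simp
  have "jac_x f x u *v X = D (X, 0)"
    unfolding jac_x_def jacobian_def frechet_derivative_at[OF dx, symmetric]
    using has_derivative_linear[OF dx] by (simp add: matrix_works linear_matrix_vector_mul_eq)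
  moreover have "jac_u f x u *v Y = D (0, Y)"
    unfolding jac_u_def jacobian_def frechet_derivative_at[OF du, symmetric]
    using has_derivative_linear[OF du] by (simp add: matrix_works linear_matrix_vector_mul_eq)
  moreover have "D (X, Y) = D (X, 0) + D (0, Y)" using linear_add[OF lin, of "(X, 0)" "(0, Y)"] by simp
  ultimately show ?thesis by simp
qed

definition smooth_field :: "(real^'m) set \<Rightarrow> (real^'n \<Rightarrow> real^'m \<Rightarrow> real^'n) \<Rightarrow> bool" where
  "smooth_field U f \<longleftrightarrow> (\<exists>W. open W \<and> UNIV \<times> U \<subseteq> W \<and> smooth_on W (\<lambda>(x, u). f x u))"

lemma smooth_field_imp_lipschitz_field:
  assumes f: "smooth_field U f" and K: "compact K" "convex K" "K \<subseteq> U" "K \<noteq> {}"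
  shows "lipschitz_field K f"
proof -
  obtain W where W: "UNIV \<times> U \<subseteq> W" "smooth_on W (\<lambda>(x, u). f x u)" using f by (auto simp: smooth_field_def)
  have "\<exists>L. L-lipschitz_on (cball 0 R \<times> K) (\<lambda>(x, u). f x u)" for R
  proof -
    have "cball 0 R \<times> K \<subseteq> W" using W(1) K(3) by auto
    then show ?thesis
      using smooth_on_imp_lipschitz[OF W(2) compact_Times[OF compact_cball K(1)] convex_Times[OF convex_cball K(2)]] by metis
  qed
  then show ?thesis using K by (simp add: lipschitz_field_def)
qed

text \<open>
  The left-hand side is the derivative of \<open>|y - x|\<^sub>x\<^sup>2\<close> along the field. Up to a remainder \<open>r\<close> of the
  linearisation of \<open>f\<close> at \<open>(x, u)\<close>, it is the left-hand side of the contraction condition for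
  \<open>X = y - x\<close> and \<open>Y = w - u\<close>. For close points the remainder increases \<open>- \<lambda>\<close> by at most \<open>\<lambda> / 4\<close> and
  \<open>\<alpha>\<close> by at most 1. Young's inequality then trades the mixed term \<open>|X|\<^sub>x |Y|\<close> for \<open>|Y|\<^sup>2\<close>, so that the
  resulting differential inequality is linear in the squared length.
\<close>

lemma contraction_of_differences:
  fixes f :: "real^'n \<Rightarrow> real^'m \<Rightarrow> real^'n"
  assumes f: "smooth_field U f" and G: "riemannian_metric G" and con: "contracting U f G lam \<alpha> V"
    and K: "compact K" "convex K" "K \<subseteq> U"
  obtains \<eta> where "\<eta> > 0"
    "\<And>x y u w. \<lbrakk>x \<in> cball 0 R; y \<in> cball 0 R; u \<in> K; w \<in> K; w - u \<in> V; norm (y - x) < \<eta>; norm (w - u) < \<eta>\<rbrakk> \<Longrightarrow>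
      form (frechet_derivative G (at x) (f x u)) (y - x) (y - x) + 2 * form (G x) (f y w - f x u) (y - x)
      \<le> - (lam / 4) * form (G x) (y - x) (y - x) + ((\<alpha> + 1)\<^sup>2 / (2 * lam)) * (norm (w - u))\<^sup>2"
proof -
  have lam: "lam > 0" and \<alpha>: "\<alpha> \<ge> 0" using con by (auto simp: contracting_def)
  obtain c C where c: "c > 0" "C > 0" "\<And>x v. x \<in> cball 0 R \<Longrightarrow> c * norm v \<le> gnorm (G x) v"
    "\<And>x v. x \<in> cball 0 R \<Longrightarrow> gnorm (G x) v \<le> C * norm v"
    by (rule gnorm_bounds[OF G, of R]) (rule that, assumption+)
  obtain W where W: "UNIV \<times> U \<subseteq> W" "smooth_on W (\<lambda>(x, u). f x u)" using f by (auto simp: smooth_field_def)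
  let ?S = "cball 0 R \<times> K :: ((real^'n) \<times> (real^'m)) set"
  have S: "compact ?S" "convex ?S" "?S \<subseteq> W"
    using W(1) K by (auto intro: compact_Times convex_Times)
  define e where "e = min (lam * c / (8 * C)) (1 / (2 * C))"
  have e: "e > 0" using lam c by (simp add: e_def)
  have e1: "2 * C * e / c \<le> lam / 4" and e2: "2 * C * e \<le> 1"
  proof -
    have "2 * C * e \<le> 2 * C * (lam * c / (8 * C))" using c by (intro mult_left_mono) (auto simp: e_def)
    also have "\<dots> = lam / 4 * c" using c by simp
    finally show "2 * C * e / c \<le> lam / 4" using c by (simp add: divide_le_eq)
    have "2 * C * e \<le> 2 * C * (1 / (2 * C))" using c by (intro mult_left_mono) (auto simp: e_def)
    then show "2 * C * e \<le> 1" using c by simp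
  qed
  obtain d where d: "d > 0" "\<And>p q. \<lbrakk>p \<in> ?S; q \<in> ?S; norm (q - p) < d\<rbrakk> \<Longrightarrow>
       norm ((\<lambda>(x, u). f x u) q - (\<lambda>(x, u). f x u) p - frechet_derivative (\<lambda>(x, u). f x u) (at p) (q - p)) \<le> e * norm (q - p)"
    by (rule smooth_on_uniform_linearisation[OF W(2) S e]) (rule that, assumption+)
  show thesis
  proof (rule that[of "d / 2"])
    show "d / 2 > 0" using d by simp
    fix x y :: "real^'n" and u w :: "real^'m"
    assume x: "x \<in> cball 0 R" and y: "y \<in> cball 0 R" and u: "u \<in> K" and w: "w \<in> K" and V: "w - u \<in> V"
      and close: "norm (y - x) < d / 2" "norm (w - u) < d / 2"
    define X where "X = y - x"
    define Y where "Y = w - u"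
    define r where "r = f y w - f x u - (jac_x f x u *v X + jac_u f x u *v Y)"
    define s where "s = gnorm (G x) X"
    have H: "posdef (G x)" by (rule riemannian_metric_posdef[OF G])
    have s0: "s \<ge> 0" and ss: "s * s = form (G x) X X"
      using gnorm_nonneg[OF H] gnorm_power2[OF H] by (auto simp: s_def power2_eq_square)
    have tri: "norm (X, Y) \<le> norm X + norm Y" by (simp add: norm_Pair sqrt_sum_squares_le_sum)
    have pW: "(x, u) \<in> W" using W(1) u K(3) by auto
    have "norm r \<le> e * norm (X, Y)"
    proof -
      have "norm ((y, w) - (x, u)) < d" using tri close by (simp add: X_def Y_def)
      from d(2)[OF _ _ this] have "norm (f y w - f x u - frechet_derivative (\<lambda>(x, u). f x u) (at (x, u)) (X, Y)) \<le> e * norm (X, Y)"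
        using x y u w by (simp add: X_def Y_def)
      then show ?thesis
        unfolding r_def partial_jacobians[OF smooth_on_has_derivative[OF W(2) pW], symmetric] .
    qed
    also have "\<dots> \<le> e * (s / c + norm Y)"
    proof (intro mult_left_mono order_trans[OF tri] add_right_mono)
      have "c * norm X \<le> s" using c(3)[OF x] by (simp add: s_def)
      then show "norm X \<le> s / c" using c(1) by (simp add: field_simps)
    qed (use e in auto)
    finally have r: "norm r \<le> e * (s / c + norm Y)" .
    have "form (G x) r X \<le> gnorm (G x) r * s" unfolding s_def by (rule form_cauchy_schwarz[OF H])
    also have "\<dots> \<le> (C * norm r) * s" using c(4)[OF x] s0 by (intro mult_right_mono) auto
    also have "\<dots> \<le> (C * (e * (s / c + norm Y))) * s" using c(2) s0 r by (intro mult_right_mono mult_left_mono) auto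
    finally have "2 * form (G x) r X \<le> 2 * ((C * (e * (s / c + norm Y))) * s)" by linarith
    also have "\<dots> = (2 * C * e / c) * (s * s) + (2 * C * e) * (s * norm Y)" by (simp add: algebra_simps)
    also have "\<dots> \<le> (lam / 4) * (s * s) + 1 * (s * norm Y)"
      using e1 e2 s0 by (intro add_mono mult_right_mono) auto
    finally have rest: "2 * form (G x) r X \<le> (lam / 4) * (s * s) + s * norm Y" by simp
    have "form (contraction_matrix f G x u) X X + 2 * form (G x) (jac_u f x u *v Y) X
        \<le> - lam * form (G x) X X + \<alpha> * gnorm (G x) X * norm Y"
      using con u K(3) V unfolding contracting_def Y_def by blast
    then have main: "form (contraction_matrix f G x u) X X + 2 * form (G x) (jac_u f x u *v Y) X \<le> - lam * (s * s) + \<alpha> * s * norm Y"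
      unfolding ss s_def[symmetric] .
    have young: "(\<alpha> + 1) * s * norm Y \<le> (lam / 2) * (s * s) + ((\<alpha> + 1)\<^sup>2 / (2 * lam)) * (norm Y)\<^sup>2"
    proof -
      have "0 \<le> (lam * s - (\<alpha> + 1) * norm Y)\<^sup>2 / (2 * lam)" using lam by simp
      also have "\<dots> = (lam / 2) * (s * s) - (\<alpha> + 1) * s * norm Y + ((\<alpha> + 1)\<^sup>2 / (2 * lam)) * (norm Y)\<^sup>2"
        using lam by (simp add: field_simps power2_eq_square)
      finally show ?thesis by simp
    qed
    have "f y w - f x u = jac_x f x u *v X + jac_u f x u *v Y + r" by (simp add: r_def)
    then have "form (frechet_derivative G (at x) (f x u)) X X + 2 * form (G x) (f y w - f x u) X
      = form (contraction_matrix f G x u) X X + 2 * form (G x) (jac_u f x u *v Y) X + 2 * form (G x) r X"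
      by (simp add: contraction_matrix_form[OF G] form_simps)
    also have "\<dots> \<le> - lam * (s * s) + (lam / 4) * (s * s) + (\<alpha> + 1) * s * norm Y"
      using main rest by (simp add: algebra_simps)
    also have "\<dots> \<le> - lam * (s * s) + (lam / 4) * (s * s) + (lam / 2) * (s * s) + ((\<alpha> + 1)\<^sup>2 / (2 * lam)) * (norm Y)\<^sup>2"
      using young by simp
    also have "\<dots> = - (lam / 4) * (s * s) + ((\<alpha> + 1)\<^sup>2 / (2 * lam)) * (norm Y)\<^sup>2" by (simp add: algebra_simps)
    finally show "form (frechet_derivative G (at x) (f x u)) (y - x) (y - x) + 2 * form (G x) (f y w - f x u) (y - x)
      \<le> - (lam / 4) * form (G x) (y - x) (y - x) + ((\<alpha> + 1)\<^sup>2 / (2 * lam)) * (norm (w - u))\<^sup>2"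
      unfolding ss X_def Y_def .
  qed
qed

text \<open>
  Gronwall's inequality for \<open>E = |\<zeta> - \<xi>|\<^sub>\<xi>\<^sup>2\<close>, followed by a square root, which halves the rate
  \<open>\<lambda> / 4\<close>. Neither the rate nor the factor of \<open>D\<close> depends on the compact sets \<open>cball 0 R\<close> and \<open>K\<close>; only
  the required closeness \<open>\<eta>\<close> does.
\<close>

lemma pair_contraction:
  fixes f :: "real^'n \<Rightarrow> real^'m \<Rightarrow> real^'n"
  assumes f: "smooth_field U f" and G: "riemannian_metric G" and con: "contracting U f G lam \<alpha> V"
    and K: "compact K" "convex K" "K \<subseteq> U"
  obtains \<eta> where "\<eta> > 0"
    "\<And>a b u w \<xi> \<zeta> D t. \<lbrakk>solves f u a b \<xi>; solves f w a b \<zeta>; \<forall>t\<in>{a..b}. norm (\<xi> t) \<le> R \<and> norm (\<zeta> t) \<le> R \<and> norm (\<zeta> t - \<xi> t) < \<eta>;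
       AE t in lebesgue_on {a..b}. u t \<in> K \<and> w t \<in> K \<and> w t - u t \<in> V \<and> norm (w t - u t) \<le> D; 0 \<le> D; D < \<eta>; t \<in> {a..b}\<rbrakk> \<Longrightarrow>
      gnorm (G (\<xi> t)) (\<zeta> t - \<xi> t) \<le> exp (- (lam / 8) * (t - a)) * gnorm (G (\<xi> a)) (\<zeta> a - \<xi> a) + (2 * (\<alpha> + 1) / lam) * D"
proof -
  have lam: "lam > 0" and \<alpha>: "\<alpha> \<ge> 0" using con by (auto simp: contracting_def)
  obtain \<eta> where \<eta>: "\<eta> > 0"
    "\<And>x y u w. \<lbrakk>x \<in> cball 0 R; y \<in> cball 0 R; u \<in> K; w \<in> K; w - u \<in> V; norm (y - x) < \<eta>; norm (w - u) < \<eta>\<rbrakk> \<Longrightarrow>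
      form (frechet_derivative G (at x) (f x u)) (y - x) (y - x) + 2 * form (G x) (f y w - f x u) (y - x)
      \<le> - (lam / 4) * form (G x) (y - x) (y - x) + ((\<alpha> + 1)\<^sup>2 / (2 * lam)) * (norm (w - u))\<^sup>2"
    by (rule contraction_of_differences[OF f G con K, of R]) (rule that, assumption+)
  have Gs: "smooth_on UNIV G" using G by (simp add: riemannian_metric_def)
  show thesis
  proof (rule that[OF \<eta>(1)])
    fix a b u w \<xi> \<zeta> D t
    assume s: "solves f u a b \<xi>" "solves f w a b \<zeta>"
      and bd: "\<forall>t\<in>{a..b}. norm (\<xi> t) \<le> R \<and> norm (\<zeta> t) \<le> R \<and> norm (\<zeta> t - \<xi> t) < \<eta>"
      and ae: "AE t in lebesgue_on {a..b}. u t \<in> K \<and> w t \<in> K \<and> w t - u t \<in> V \<and> norm (w t - u t) \<le> D"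
      and D: "0 \<le> D" "D < \<eta>" and t: "t \<in> {a..b}"
    define \<delta> where "\<delta> = (\<lambda>t. \<zeta> t - \<xi> t)"
    define E where "E = (\<lambda>t. form (G (\<xi> t)) (\<delta> t) (\<delta> t))"
    define B where "B = (\<alpha> + 1)\<^sup>2 / (2 * lam)"
    have B: "B \<ge> 0" using lam by (simp add: B_def)
    obtain A A' where A: "A-lipschitz_on {a..b} \<xi>" "A'-lipschitz_on {a..b} \<zeta>" using s by (auto simp: solves_def)
    obtain LG where LG: "LG-lipschitz_on (cball 0 R) G"
      by (rule smooth_on_imp_lipschitz[OF Gs compact_cball convex_cball subset_UNIV]) (rule that, assumption)
    have "lipschitz_fun a b (\<lambda>t. G (\<xi> t))"
    proof -
      have "\<xi> ` {a..b} \<subseteq> cball 0 R" using bd by auto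
      then show ?thesis using lipschitz_on_compose2[OF A(1) lipschitz_on_subset[OF LG]] by blast
    qed
    moreover have "lipschitz_fun a b \<delta>" unfolding \<delta>_def using lipschitz_on_diff[OF A(2,1)] by blast
    ultimately have "lipschitz_fun a b E" unfolding E_def by (intro lipschitz_fun_form)
    then obtain LE where LE: "LE-lipschitz_on {a..b} E" by blast
    have "AE t in lebesgue_on {a..b}. (\<xi> has_vector_derivative f (\<xi> t) (u t)) (at t)"
      "AE t in lebesgue_on {a..b}. (\<zeta> has_vector_derivative f (\<zeta> t) (w t)) (at t)"
      "AE t in lebesgue_on {a..b}. t \<in> {a..b}" using s by (auto simp: solves_def)
    then have "AE t in lebesgue_on {a..b}. \<exists>l. l \<le> (- (lam / 4)) * E t + B * D\<^sup>2 \<and> (E has_real_derivative l) (at t)"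
      using ae
    proof eventually_elim
      case (elim t)
      let ?DG = "frechet_derivative G (at (\<xi> t))"
      have "(G has_derivative ?DG) (at (\<xi> t))" by (rule smooth_on_has_derivative[OF Gs]) simp
      from vector_derivative_diff_chain_within[OF elim(1), of G ?DG] this
      have dG: "((\<lambda>t. G (\<xi> t)) has_vector_derivative ?DG (f (\<xi> t) (u t))) (at t)"
        by (simp add: o_def has_derivative_at_withinI)
      have d\<delta>: "(\<delta> has_vector_derivative (f (\<zeta> t) (w t) - f (\<xi> t) (u t))) (at t)"
        unfolding \<delta>_def by (rule has_vector_derivative_diff[OF elim(2,1)])
      let ?v = "f (\<zeta> t) (w t) - f (\<xi> t) (u t)"
      have "(E has_real_derivative form (?DG (f (\<xi> t) (u t))) (\<delta> t) (\<delta> t) + form (G (\<xi> t)) ?v (\<delta> t) + form (G (\<xi> t)) (\<delta> t) ?v) (at t)"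
        unfolding E_def by (rule form_has_real_derivative[OF dG d\<delta> d\<delta>])
      moreover have "form (G (\<xi> t)) (\<delta> t) ?v = form (G (\<xi> t)) ?v (\<delta> t)"
        using riemannian_metric_posdef[OF G] by (intro form_commute) (simp add: posdef_def)
      moreover have "form (?DG (f (\<xi> t) (u t))) (\<delta> t) (\<delta> t) + 2 * form (G (\<xi> t)) ?v (\<delta> t)
          \<le> - (lam / 4) * E t + B * (norm (w t - u t))\<^sup>2"
        unfolding \<delta>_def E_def B_def using elim bd D by (intro \<eta>(2)) auto
      moreover have "B * (norm (w t - u t))\<^sup>2 \<le> B * D\<^sup>2" using elim B by (intro mult_left_mono power_mono) auto
      ultimately show ?case
        by (intro exI[of _ "form (?DG (f (\<xi> t) (u t))) (\<delta> t) (\<delta> t) + form (G (\<xi> t)) ?v (\<delta> t) + form (G (\<xi> t)) (\<delta> t) ?v"])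
          (rule conjI, linarith, assumption)
    qed
    from lipschitz_gronwall[OF t LE _ this] lam
    have "E t \<le> exp (- (lam / 4) * (t - a)) * (E a + B * D\<^sup>2 / (- (lam / 4))) - B * D\<^sup>2 / (- (lam / 4))" by simp
    also have "\<dots> = exp (- (lam / 4) * (t - a)) * E a - exp (- (lam / 4) * (t - a)) * (4 * B * D\<^sup>2 / lam) + 4 * B * D\<^sup>2 / lam"
      using lam by (simp add: algebra_simps)
    also have "\<dots> \<le> exp (- (lam / 4) * (t - a)) * E a + 4 * B * D\<^sup>2 / lam" using B lam by simp
    also have "\<dots> \<le> exp (- (lam / 4) * (t - a)) * E a + (2 * (\<alpha> + 1) / lam * D)\<^sup>2"
    proof -
      have "4 * B * D\<^sup>2 / lam = 2 * ((\<alpha> + 1) / lam * D)\<^sup>2"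
        using lam by (simp add: B_def power2_eq_square)
      moreover have "(2 * (\<alpha> + 1) / lam * D)\<^sup>2 = 4 * ((\<alpha> + 1) / lam * D)\<^sup>2"
        using power_mult_distrib[of 2 "(\<alpha> + 1) / lam * D" 2] by (simp only: times_divide_eq_right mult.assoc times_divide_eq_left) simp
      moreover have "((\<alpha> + 1) / lam * D)\<^sup>2 \<ge> 0" by simp
      ultimately show ?thesis by linarith
    qed
    finally have "sqrt (E t) \<le> sqrt (exp (- (lam / 4) * (t - a)) * E a + (2 * (\<alpha> + 1) / lam * D)\<^sup>2)" by (rule real_sqrt_le_mono)
    also have "\<dots> \<le> sqrt (exp (- (lam / 4) * (t - a)) * E a) + sqrt ((2 * (\<alpha> + 1) / lam * D)\<^sup>2)"
      using posdef_nonneg[OF riemannian_metric_posdef[OF G]] by (intro sqrt_add_le_add_sqrt) (auto simp: E_def)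
    also have "sqrt ((2 * (\<alpha> + 1) / lam * D)\<^sup>2) = 2 * (\<alpha> + 1) / lam * D" using lam \<alpha> D by simp
    also have "exp (- (lam / 4) * (t - a)) = (exp (- (lam / 8) * (t - a)))\<^sup>2"
    proof -
      have "- (lam / 4) * (t - a) = 2 * (- (lam / 8) * (t - a))" by simp
      then show ?thesis by (metis exp_double)
    qed
    also have "sqrt ((exp (- (lam / 8) * (t - a)))\<^sup>2 * E a) = exp (- (lam / 8) * (t - a)) * sqrt (E a)"
      by (simp add: real_sqrt_mult)
    finally show "gnorm (G (\<xi> t)) (\<zeta> t - \<xi> t) \<le> exp (- (lam / 8) * (t - a)) * gnorm (G (\<xi> a)) (\<zeta> a - \<xi> a) + (2 * (\<alpha> + 1) / lam) * D"
      by (simp add: gnorm_def E_def \<delta>_def)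
  qed
qed

section \<open>Contraction along a segment of initial states\<close>

lemma riemannian_dist_le_norm:
  fixes G :: "real^'n \<Rightarrow> real^'n^'n"
  assumes G: "riemannian_metric G"
  obtains C where "C > 0" "\<And>x y. \<lbrakk>x \<in> cball 0 R; y \<in> cball 0 R\<rbrakk> \<Longrightarrow> riemannian_dist G x y \<le> C * norm (y - x)"
proof -
  obtain C where C: "C > 0" "\<And>x v. x \<in> cball 0 R \<Longrightarrow> gnorm (G x) v \<le> C * norm v"
    by (rule gnorm_bounds[OF G, of R]) (rule that, assumption+)
  show thesis
  proof (rule that[OF C(1)])
    fix x y :: "real^'n" assume xy: "x \<in> cball 0 R" "y \<in> cball 0 R"
    show "riemannian_dist G x y \<le> C * norm (y - x)"
    proof (rule riemannian_dist_segment[OF G])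
      fix \<sigma> :: real assume \<sigma>: "\<sigma> \<in> {0..1}"
      have "(1 - \<sigma>) *\<^sub>R x + \<sigma> *\<^sub>R y \<in> cball 0 R" using xy \<sigma> by (intro convexD[OF convex_cball]) auto
      moreover have "(1 - \<sigma>) *\<^sub>R x + \<sigma> *\<^sub>R y = x + \<sigma> *\<^sub>R (y - x)" by (simp add: algebra_simps)
      ultimately show "gnorm (G (x + \<sigma> *\<^sub>R (y - x))) (y - x) \<le> C * norm (y - x)" using C(2) by metis
    qed
  qed
qed

text \<open>
  Induction along the unit interval: the supremum of all \<open>s\<close> with \<open>[0,s] \<subseteq> A\<close> belongs to \<open>A\<close> and cannot
  be less than 1.
\<close>

lemma unit_interval_induct:
  fixes A :: "real set"
  assumes zero: "0 \<in> A"
    and lim: "\<And>s. \<lbrakk>0 < s; s \<le> 1; {0..<s} \<subseteq> A\<rbrakk> \<Longrightarrow> s \<in> A"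
    and step: "\<And>s. \<lbrakk>s \<in> A; 0 \<le> s; s < 1\<rbrakk> \<Longrightarrow> \<exists>e>0. {s..s + e} \<inter> {0..1} \<subseteq> A"
  shows "{0..1} \<subseteq> A"
proof -
  define B where "B = {s \<in> {0..1}. {0..s} \<subseteq> A}"
  define s where "s = Sup B"
  have B0: "0 \<in> B" using zero by (simp add: B_def)
  have bdd: "bdd_above B" by (rule bdd_aboveI[of _ 1]) (auto simp: B_def)
  have s01: "0 \<le> s" "s \<le> 1"
  proof -
    show "0 \<le> s" unfolding s_def by (rule cSup_upper[OF B0 bdd])
    show "s \<le> 1" unfolding s_def
    proof (rule cSup_least)
      show "B \<noteq> {}" using B0 by blast
    qed (simp add: B_def)
  qed
  have below: "{0..<s} \<subseteq> A"
  proof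
    fix r assume "r \<in> {0..<s}"
    then obtain q where "q \<in> B" "r < q" unfolding s_def using less_cSup_iff[of B r] B0 bdd by auto
    then show "r \<in> A" using \<open>r \<in> {0..<s}\<close> by (auto simp: B_def)
  qed
  have sA: "s \<in> A" using lim[OF _ s01(2) below] zero s01(1) by (cases "s = 0") auto
  have up: "{0..s} \<subseteq> A"
  proof
    fix r assume "r \<in> {0..s}"
    then show "r \<in> A" using below sA by (cases "r = s") auto
  qed
  have "s = 1"
  proof (rule ccontr)
    assume "s \<noteq> 1"
    then obtain e where e: "e > 0" "{s..s + e} \<inter> {0..1} \<subseteq> A" using step[OF sA s01(1)] s01 by auto
    have "min (s + e) 1 \<in> B"
    proof -
      have "{0..min (s + e) 1} \<subseteq> {0..s} \<union> ({s..s + e} \<inter> {0..1})" using s01 e by auto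
      then have "{0..min (s + e) 1} \<subseteq> A" using up e by blast
      then show ?thesis using s01 e by (auto simp: B_def)
    qed
    then have "min (s + e) 1 \<le> s" unfolding s_def by (rule cSup_upper[OF _ bdd])
    then show False using e s01 \<open>s \<noteq> 1\<close> by (auto simp: min_def split: if_splits)
  qed
  then show ?thesis using up by simp
qed

lemma admissible_segment:
  fixes u w :: "real \<Rightarrow> 'b::euclidean_space"
  assumes K: "convex K" and u: "admissible K a b u" and w: "admissible K a b w" and \<sigma>: "\<sigma> \<in> {0..1}"
  shows "admissible K a b (\<lambda>t. u t + \<sigma> *\<^sub>R (w t - u t))"
proof -
  have [measurable]: "u \<in> borel_measurable (lebesgue_on {a..b})" "w \<in> borel_measurable (lebesgue_on {a..b})"
    using u w by (auto simp: admissible_def)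
  have "(\<lambda>t. u t + \<sigma> *\<^sub>R (w t - u t)) \<in> borel_measurable (lebesgue_on {a..b})" by measurable
  moreover have "AE t in lebesgue_on {a..b}. u t \<in> K" "AE t in lebesgue_on {a..b}. w t \<in> K"
    using u w by (auto simp: admissible_def)
  then have "AE t in lebesgue_on {a..b}. u t + \<sigma> *\<^sub>R (w t - u t) \<in> K"
  proof eventually_elim
    case (elim t)
    then have "(1 - \<sigma>) *\<^sub>R u t + \<sigma> *\<^sub>R w t \<in> K" using \<sigma> by (intro convexD[OF K]) auto
    then show ?case by (simp add: algebra_simps)
  qed
  ultimately show ?thesis by (simp add: admissible_def)
qed

locale contracting_system =
  fixes U :: "(real^'m) set" and f :: "real^'n \<Rightarrow> real^'m \<Rightarrow> real^'n" and G :: "real^'n \<Rightarrow> real^'n^'n"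
    and lam \<alpha> :: real and V :: "(real^'m) set"
  assumes f: "smooth_field U f" and G: "riemannian_metric G" and con: "contracting U f G lam \<alpha> V"
    and metric: "Metric_space UNIV (riemannian_dist G)"
begin

abbreviation d where "d \<equiv> riemannian_dist G"

lemma d_triangle: "d x z \<le> d x y + d y z" and d_commute: "d x y = d y x"
  using Metric_space.triangle[OF metric] Metric_space.commute[OF metric] by auto

lemma d_chain: "d (p 0) (p N) \<le> (\<Sum>i<N. d (p i) (p (Suc i)))"
proof (induction N)
  case 0
  show ?case using Metric_space.mdist_zero[OF metric] by simp
next
  case (Suc N)
  then show ?case using d_triangle[of "p 0" "p (Suc N)" "p N"] by simp
qed

lemma lam_pos: "lam > 0" and \<alpha>_nonneg: "\<alpha> \<ge> 0" and V: "subspace V"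
  using con by (auto simp: contracting_def)

text \<open>
  Divide the segment of initial states, and simultaneously the segment between the two inputs, into
  \<open>N\<close> equal steps. For large \<open>N\<close> neighbouring solutions are so close that \<open>pair_contraction\<close> applies to
  each of the \<open>N\<close> pairs and that the metric is comparable along the short segment joining them, and
  the triangle inequality adds up the \<open>N\<close> estimates. The closeness is uniform because all the
  solutions lie in one ball: by \<open>solution_continuation\<close> they are bounded for parameters near a given
  one, and \<open>[0,1]\<close> is compact.
\<close>

lemma segment_contraction:
  assumes K: "compact K" "convex K" "K \<subseteq> U" "K \<noteq> {}" and ab: "a \<le> b" and D: "D \<ge> 0"
    and u: "admissible K a b u" and w: "admissible K a b w"
    and uw: "AE t in lebesgue_on {a..b}. w t - u t \<in> V \<and> norm (w t - u t) \<le> D"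
    and \<phi>: "\<And>\<sigma>. \<sigma> \<in> {0..1} \<Longrightarrow> solves f (\<lambda>t. u t + \<sigma> *\<^sub>R (w t - u t)) a b (\<phi> \<sigma>)"
      "\<And>\<sigma>. \<sigma> \<in> {0..1} \<Longrightarrow> \<phi> \<sigma> a = x + \<sigma> *\<^sub>R (y - x)"
    and L: "\<And>\<sigma>. \<sigma> \<in> {0..1} \<Longrightarrow> gnorm (G (x + \<sigma> *\<^sub>R (y - x))) (y - x) \<le> L"
    and t: "t \<in> {a..b}"
  shows "d (\<phi> 0 t) (\<phi> 1 t) \<le> 2 * exp (- (lam / 8) * (t - a)) * L + (4 * (\<alpha> + 1) / lam) * D"
proof -
  have fK: "lipschitz_field K f" by (rule smooth_field_imp_lipschitz_field[OF f K])
  define v where "v = (\<lambda>\<sigma> t. u t + \<sigma> *\<^sub>R (w t - u t))"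
  have vd: "v \<sigma>' t - v \<sigma> t = (\<sigma>' - \<sigma>) *\<^sub>R (w t - u t)" for \<sigma> \<sigma>' t by (simp add: v_def algebra_simps)
  have vadm: "admissible K a b (v \<sigma>)" if "\<sigma> \<in> {0..1}" for \<sigma>
    unfolding v_def by (rule admissible_segment[OF K(2) u w that])
  have vK: "AE t in lebesgue_on {a..b}. v \<sigma> t \<in> K" if "\<sigma> \<in> {0..1}" for \<sigma>
    using vadm[OF that] by (simp add: admissible_def)
  have vclose: "AE t in lebesgue_on {a..b}. norm (v \<sigma>' t - v \<sigma> t) \<le> \<bar>\<sigma>' - \<sigma>\<bar> * D" for \<sigma> \<sigma>'
    using uw by eventually_elim (simp add: vd mult_left_mono)
  have \<phi>v: "solves f (v \<sigma>) a b (\<phi> \<sigma>)" if "\<sigma> \<in> {0..1}" for \<sigma> using \<phi>(1)[OF that] by (simp add: v_def)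
  have \<phi>a: "\<phi> \<sigma>' a - \<phi> \<sigma> a = (\<sigma>' - \<sigma>) *\<^sub>R (y - x)" if "\<sigma> \<in> {0..1}" "\<sigma>' \<in> {0..1}" for \<sigma> \<sigma>'
    using \<phi>(2) that by (simp add: algebra_simps)
  have "\<exists>\<rho>>0. \<exists>R. \<forall>\<sigma>\<in>{0..1}. \<bar>\<sigma> - \<mu>\<bar> < \<rho> \<longrightarrow> (\<forall>t\<in>{a..b}. norm (\<phi> \<sigma> t) \<le> R)" if \<mu>: "\<mu> \<in> {0..1}" for \<mu>
  proof -
    obtain R where R: "R \<ge> 0" "\<And>t. t \<in> {a..b} \<Longrightarrow> norm (\<phi> \<mu> t) \<le> R"
      by (rule solves_bounded[OF \<phi>v[OF \<mu>]]) (rule that, assumption+)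
    obtain \<eta> where \<eta>: "\<eta> > 0"
      "\<And>u w \<xi> y. \<lbrakk>solves f u a b \<xi>; admissible K a b u; admissible K a b w; \<forall>t\<in>{a..b}. norm (\<xi> t) \<le> R;
         AE t in lebesgue_on {a..b}. norm (u t - w t) \<le> \<eta>; norm (\<xi> a - y) \<le> \<eta>\<rbrakk> \<Longrightarrow>
        \<exists>\<zeta>. solves f w a b \<zeta> \<and> \<zeta> a = y \<and> (\<forall>t\<in>{a..b}. norm (\<zeta> t) \<le> R + 1)"
      by (rule solution_continuation[OF fK R(1) ab]) (rule that, assumption+)
    define \<rho> where "\<rho> = \<eta> / (D + norm (y - x) + 1)"
    have pos: "D + norm (y - x) + 1 > 0" using D by (simp add: add_nonneg_pos)
    have \<rho>: "\<rho> > 0" using \<eta>(1) pos by (simp add: \<rho>_def)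
    have "norm (\<phi> \<sigma> t) \<le> R + 1" if \<sigma>: "\<sigma> \<in> {0..1}" "\<bar>\<sigma> - \<mu>\<bar> < \<rho>" and t: "t \<in> {a..b}" for \<sigma> t
    proof -
      have small: "\<bar>\<mu> - \<sigma>\<bar> * (D + norm (y - x) + 1) \<le> \<eta>"
        using \<sigma>(2) pos by (simp add: \<rho>_def pos_less_divide_eq abs_minus_commute)
      have "\<bar>\<mu> - \<sigma>\<bar> * D \<le> \<bar>\<mu> - \<sigma>\<bar> * (D + norm (y - x) + 1)" by (intro mult_left_mono) auto
      then have sD: "\<bar>\<mu> - \<sigma>\<bar> * D \<le> \<eta>" using small by linarith
      have "\<bar>\<mu> - \<sigma>\<bar> * norm (y - x) \<le> \<bar>\<mu> - \<sigma>\<bar> * (D + norm (y - x) + 1)" using D by (intro mult_left_mono) auto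
      then have sx: "\<bar>\<mu> - \<sigma>\<bar> * norm (y - x) \<le> \<eta>" using small by linarith
      have "\<exists>\<zeta>. solves f (v \<sigma>) a b \<zeta> \<and> \<zeta> a = \<phi> \<sigma> a \<and> (\<forall>t\<in>{a..b}. norm (\<zeta> t) \<le> R + 1)"
      proof (rule \<eta>(2)[OF \<phi>v[OF \<mu>] vadm[OF \<mu>] vadm[OF \<sigma>(1)]])
        show "AE t in lebesgue_on {a..b}. norm (v \<mu> t - v \<sigma> t) \<le> \<eta>"
          using vclose[of \<mu> \<sigma>] by eventually_elim (use sD in linarith)
        show "norm (\<phi> \<mu> a - \<phi> \<sigma> a) \<le> \<eta>" using \<phi>a[OF \<sigma>(1) \<mu>] sx by simp
      qed (use R in auto)
      then obtain \<zeta> where \<zeta>: "solves f (v \<sigma>) a b \<zeta>" "\<zeta> a = \<phi> \<sigma> a" "\<forall>t\<in>{a..b}. norm (\<zeta> t) \<le> R + 1" by blast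
      have "\<phi> \<sigma> t = \<zeta> t"
        by (rule solves_unique[OF fK vadm[OF \<sigma>(1)] \<phi>v[OF \<sigma>(1)] \<zeta>(1) \<zeta>(2)[symmetric] t])
      then show ?thesis using \<zeta>(3) t by simp
    qed
    then show ?thesis using \<rho> by blast
  qed
  then obtain \<rho> R' where \<rho>: "\<And>\<mu>. \<mu> \<in> {0..1} \<Longrightarrow> \<rho> \<mu> > 0"
    and R': "\<And>\<mu> \<sigma> t. \<mu> \<in> {0..1} \<Longrightarrow> \<sigma> \<in> {0..1} \<Longrightarrow> \<bar>\<sigma> - \<mu>\<bar> < \<rho> \<mu> \<Longrightarrow> t \<in> {a..b} \<Longrightarrow> norm (\<phi> \<sigma> t) \<le> R' \<mu>" by metis
  obtain C where C: "C \<subseteq> {0..1}" "finite C" "{0..1} \<subseteq> (\<Union>\<mu>\<in>C. ball \<mu> (\<rho> \<mu>))"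
    by (rule compactE_image[of "{0..1}" "{0..1}" "\<lambda>\<mu>. ball \<mu> (\<rho> \<mu>)"]) (use \<rho> in auto)
  define R where "R = (\<Sum>\<mu>\<in>C. \<bar>R' \<mu>\<bar>)"
  have bound: "norm (\<phi> \<sigma> t) \<le> R" if \<sigma>: "\<sigma> \<in> {0..1}" and t: "t \<in> {a..b}" for \<sigma> t
  proof -
    obtain \<mu> where \<mu>: "\<mu> \<in> C" "\<bar>\<sigma> - \<mu>\<bar> < \<rho> \<mu>"
      using C(3) \<sigma> by (force simp: dist_real_def abs_minus_commute)
    have "norm (\<phi> \<sigma> t) \<le> \<bar>R' \<mu>\<bar>" using R'[of \<mu> \<sigma> t] \<mu> C(1) \<sigma> t by fastforce
    also have "\<dots> \<le> R" unfolding R_def using C(2) \<mu>(1) by (intro member_le_sum) auto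
    finally show ?thesis .
  qed
  obtain Z where Z: "Z > 0"
    "\<And>a b u w \<xi> \<zeta> D t. \<lbrakk>solves f u a b \<xi>; solves f w a b \<zeta>; AE t in lebesgue_on {a..b}. u t \<in> K \<and> w t \<in> K \<and> norm (u t - w t) \<le> D;
       \<forall>t\<in>{a..b}. norm (\<xi> t) \<le> R; \<forall>t\<in>{a..b}. norm (\<zeta> t) \<le> R; t \<in> {a..b}; D \<ge> 0\<rbrakk> \<Longrightarrow>
      (norm (\<xi> t - \<zeta> t))\<^sup>2 \<le> exp (Z * (b - a)) * ((norm (\<xi> a - \<zeta> a))\<^sup>2 + D\<^sup>2)"
    by (rule solution_dependence[OF fK, of R]) (rule that, assumption+)
  obtain \<eta> where \<eta>: "\<eta> > 0"
    "\<And>a b u w \<xi> \<zeta> D t. \<lbrakk>solves f u a b \<xi>; solves f w a b \<zeta>; \<forall>t\<in>{a..b}. norm (\<xi> t) \<le> R \<and> norm (\<zeta> t) \<le> R \<and> norm (\<zeta> t - \<xi> t) < \<eta>;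
       AE t in lebesgue_on {a..b}. u t \<in> K \<and> w t \<in> K \<and> w t - u t \<in> V \<and> norm (w t - u t) \<le> D; 0 \<le> D; D < \<eta>; t \<in> {a..b}\<rbrakk> \<Longrightarrow>
      gnorm (G (\<xi> t)) (\<zeta> t - \<xi> t) \<le> exp (- (lam / 8) * (t - a)) * gnorm (G (\<xi> a)) (\<zeta> a - \<xi> a) + (2 * (\<alpha> + 1) / lam) * D"
    by (rule pair_contraction[OF f G con K(1-3), of R]) (rule that, assumption+)
  obtain r where r: "r > 0"
    "\<And>x y v. \<lbrakk>x \<in> cball 0 R; norm (y - x) \<le> r\<rbrakk> \<Longrightarrow> gnorm (G y) v \<le> 2 * gnorm (G x) v"
    by (rule gnorm_comparable[OF G, of R]) (rule that, assumption+)
  \<comment> \<open>A Lipschitz constant of \<open>\<phi>\<close> with respect to the parameter, from Gronwall's inequality.\<close>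
  define q where "q = sqrt (exp (Z * (b - a)) * ((norm (y - x))\<^sup>2 + D\<^sup>2))"
  have q0: "q \<ge> 0" by (simp add: q_def)
  have q2: "q\<^sup>2 = exp (Z * (b - a)) * ((norm (y - x))\<^sup>2 + D\<^sup>2)"
    unfolding q_def by (rule real_sqrt_pow2) simp
  have close: "norm (\<phi> \<sigma>' t - \<phi> \<sigma> t) \<le> \<bar>\<sigma>' - \<sigma>\<bar> * q"
    if \<sigma>: "\<sigma> \<in> {0..1}" "\<sigma>' \<in> {0..1}" and t: "t \<in> {a..b}" for \<sigma> \<sigma>' t
  proof -
    have "(norm (\<phi> \<sigma>' t - \<phi> \<sigma> t))\<^sup>2 \<le> exp (Z * (b - a)) * ((norm (\<phi> \<sigma>' a - \<phi> \<sigma> a))\<^sup>2 + (\<bar>\<sigma>' - \<sigma>\<bar> * D)\<^sup>2)"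
    proof (rule Z(2)[OF \<phi>v[OF \<sigma>(2)] \<phi>v[OF \<sigma>(1)]])
      show "AE t in lebesgue_on {a..b}. v \<sigma>' t \<in> K \<and> v \<sigma> t \<in> K \<and> norm (v \<sigma>' t - v \<sigma> t) \<le> \<bar>\<sigma>' - \<sigma>\<bar> * D"
        using vK[OF \<sigma>(1)] vK[OF \<sigma>(2)] vclose[of \<sigma>' \<sigma>] by eventually_elim simp
    qed (use bound \<sigma> t D in auto)
    also have "\<dots> = (\<bar>\<sigma>' - \<sigma>\<bar> * q)\<^sup>2"
      unfolding \<phi>a[OF \<sigma>] norm_scaleR power_mult_distrib q2 by (simp add: distrib_left mult_ac)
    finally show ?thesis by (rule power2_le_imp_le) (use q0 in simp)
  qed
  define m where "m = min \<eta> r"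
  have m: "m > 0" "m \<le> \<eta>" "m \<le> r" using \<eta>(1) r(1) by (auto simp: m_def)
  obtain N :: nat where N0: "(q + D + 1) / m < N" using reals_Archimedean2 by blast
  have "(q + D + 1) / m > 0" using q0 D m by simp
  then have N: "N > 0" using N0 by (cases N) auto
  have Nm: "(q + D + 1) / N < m" using N0 N m(1) by (simp add: field_simps)
  have qN: "q / N < m" and DN: "D / N < m"
    using Nm q0 D N by (smt (verit) divide_right_mono of_nat_0_le_iff)+
  define s where "s = (\<lambda>j :: nat. j / N)"
  have s01: "s j \<in> {0..1}" if "j \<le> N" for j using that N by (simp add: s_def)
  have sS: "s (Suc j) - s j = 1 / N" for j by (simp add: s_def add_divide_distrib)
  have step: "d (\<phi> (s j) t) (\<phi> (s (Suc j)) t) \<le> 2 * (exp (- (lam / 8) * (t - a)) * (L / N) + (2 * (\<alpha> + 1) / lam) * (D / N))"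
    if j: "j < N" for j
  proof -
    let ?\<xi> = "\<phi> (s j)" and ?\<zeta> = "\<phi> (s (Suc j))"
    have sj: "s j \<in> {0..1}" "s (Suc j) \<in> {0..1}" using s01 j by auto
    have near: "norm (?\<zeta> t - ?\<xi> t) < m" if "t \<in> {a..b}" for t
      using close[OF sj that] sS[of j] qN by simp
    have "gnorm (G (?\<xi> t)) (?\<zeta> t - ?\<xi> t) \<le> exp (- (lam / 8) * (t - a)) * gnorm (G (?\<xi> a)) (?\<zeta> a - ?\<xi> a) + (2 * (\<alpha> + 1) / lam) * (D / N)"
    proof (rule \<eta>(2)[OF \<phi>v[OF sj(1)] \<phi>v[OF sj(2)]])
      show "\<forall>t\<in>{a..b}. norm (?\<xi> t) \<le> R \<and> norm (?\<zeta> t) \<le> R \<and> norm (?\<zeta> t - ?\<xi> t) < \<eta>"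
        using bound sj near m by force
      show "AE t in lebesgue_on {a..b}. v (s j) t \<in> K \<and> v (s (Suc j)) t \<in> K \<and>
          v (s (Suc j)) t - v (s j) t \<in> V \<and> norm (v (s (Suc j)) t - v (s j) t) \<le> D / N"
        using vK[OF sj(1)] vK[OF sj(2)] vclose[of "s (Suc j)" "s j"] uw
      proof eventually_elim
        case (elim t)
        then show ?case using V by (simp add: sS vd subspace_scale)
      qed
    qed (use D N DN m t in auto)
    also have "gnorm (G (?\<xi> a)) (?\<zeta> a - ?\<xi> a) \<le> L / N"
    proof -
      have "?\<zeta> a - ?\<xi> a = (1 / N) *\<^sub>R (y - x)" using \<phi>a[OF sj] sS[of j] by simp
      then have "gnorm (G (?\<xi> a)) (?\<zeta> a - ?\<xi> a) = (1 / N) * gnorm (G (x + s j *\<^sub>R (y - x))) (y - x)"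
        using \<phi>(2)[OF sj(1)] by (simp add: gnorm_scaleR)
      also have "\<dots> \<le> (1 / N) * L" by (intro mult_left_mono L sj) auto
      finally show ?thesis by simp
    qed
    finally have e: "gnorm (G (?\<xi> t)) (?\<zeta> t - ?\<xi> t) \<le> exp (- (lam / 8) * (t - a)) * (L / N) + (2 * (\<alpha> + 1) / lam) * (D / N)" by simp
    have "d (?\<xi> t) (?\<zeta> t) \<le> 2 * gnorm (G (?\<xi> t)) (?\<zeta> t - ?\<xi> t)"
    proof (rule riemannian_dist_segment[OF G], rule r(2))
      show "?\<xi> t \<in> cball 0 R" using bound[OF sj(1) t] by simp
      fix \<sigma> :: real assume \<sigma>: "\<sigma> \<in> {0..1}"
      have "\<bar>\<sigma>\<bar> * norm (?\<zeta> t - ?\<xi> t) \<le> 1 * norm (?\<zeta> t - ?\<xi> t)" using \<sigma> by (intro mult_right_mono) auto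
      then show "norm (?\<xi> t + \<sigma> *\<^sub>R (?\<zeta> t - ?\<xi> t) - ?\<xi> t) \<le> r" using near[OF t] m by simp
    qed
    also have "\<dots> \<le> 2 * (exp (- (lam / 8) * (t - a)) * (L / N) + (2 * (\<alpha> + 1) / lam) * (D / N))"
      by (intro mult_left_mono e) simp
    finally show ?thesis .
  qed
  have "d (\<phi> (s 0) t) (\<phi> (s N) t) \<le> (\<Sum>j<N. d (\<phi> (s j) t) (\<phi> (s (Suc j)) t))" by (rule d_chain)
  also have "\<dots> \<le> (\<Sum>j<N. 2 * (exp (- (lam / 8) * (t - a)) * (L / N) + (2 * (\<alpha> + 1) / lam) * (D / N)))"
    by (intro sum_mono step) auto
  also have "\<dots> = 2 * exp (- (lam / 8) * (t - a)) * L + 2 * (2 * (\<alpha> + 1) / lam) * D"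
  proof -
    have "(\<Sum>j<N. 2 * (e * (L / N) + k * (D / N))) = 2 * e * L + 2 * k * D" for e k :: real
      using N by (simp add: field_simps)
    then show ?thesis .
  qed
  also have "2 * (2 * (\<alpha> + 1) / lam) = 4 * (\<alpha> + 1) / lam" by simp
  finally show ?thesis using N by (simp add: s_def)
qed

end

context contracting_system begin

section \<open>Existence of solutions\<close>

text \<open>
  Let \<open>A\<close> be the set of parameters \<open>\<sigma>\<close> for which the solution from \<open>x\<^sub>0 + \<sigma> v\<close> exists, where \<open>x\<^sub>0\<close>
  is the initial state of \<open>\<phi>0\<close>. Induction along the unit interval shows that \<open>A\<close> contains \<open>[0,1]\<close>. The
  crucial step is to pass to the limit \<open>s\<close> of parameters in \<open>A\<close>. By contraction the solutions \<open>\<phi> \<sigma>\<close>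
  depend on \<open>\<sigma>\<close> in a Lipschitz way, for the Riemannian distance and uniformly in time; by completeness
  they converge to a curve \<open>\<psi>\<close>. As a uniform limit \<open>\<psi>\<close> is continuous, hence bounded, and so are the
  solutions for \<open>\<sigma>\<close> close to \<open>s\<close>. Then \<open>solution_continuation\<close>, whose step size depends only on
  that bound, reaches \<open>s\<close>.
\<close>

lemma solution_from_everywhere:
  assumes complete: "Metric_space.mcomplete UNIV (riemannian_dist G)"
    and K: "compact K" "convex K" "K \<subseteq> U" "K \<noteq> {}" and ab: "a \<le> b" and u: "admissible K a b u"
    and \<phi>0: "solves f u a b \<phi>0"
  shows "\<exists>\<xi>. solves f u a b \<xi> \<and> \<xi> a = x"
proof -
  have fK: "lipschitz_field K f" by (rule smooth_field_imp_lipschitz_field[OF f K])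
  define x0 where "x0 = \<phi>0 a"
  define v where "v = x - x0"
  define A where "A = {\<sigma>. \<exists>\<xi>. solves f u a b \<xi> \<and> \<xi> a = x0 + \<sigma> *\<^sub>R v}"
  have continue: "\<exists>\<eta>>0. \<forall>\<sigma> \<xi>. solves f u a b \<xi> \<and> \<xi> a = x0 + \<sigma> *\<^sub>R v \<and> (\<forall>t\<in>{a..b}. norm (\<xi> t) \<le> R)
      \<longrightarrow> {\<sigma>..\<sigma> + \<eta>} \<subseteq> A" if R: "R \<ge> 0" for R
  proof -
    obtain \<eta> where \<eta>: "\<eta> > 0"
      "\<And>u w \<xi> y. \<lbrakk>solves f u a b \<xi>; admissible K a b u; admissible K a b w; \<forall>t\<in>{a..b}. norm (\<xi> t) \<le> R;
         AE t in lebesgue_on {a..b}. norm (u t - w t) \<le> \<eta>; norm (\<xi> a - y) \<le> \<eta>\<rbrakk> \<Longrightarrow>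
        \<exists>\<zeta>. solves f w a b \<zeta> \<and> \<zeta> a = y \<and> (\<forall>t\<in>{a..b}. norm (\<zeta> t) \<le> R + 1)"
      by (rule solution_continuation[OF fK R ab]) (rule that, assumption+)
    have "{\<sigma>..\<sigma> + \<eta> / (norm v + 1)} \<subseteq> A"
      if \<xi>: "solves f u a b \<xi>" "\<xi> a = x0 + \<sigma> *\<^sub>R v" "\<forall>t\<in>{a..b}. norm (\<xi> t) \<le> R" for \<sigma> \<xi>
    proof
      fix \<tau> assume \<tau>: "\<tau> \<in> {\<sigma>..\<sigma> + \<eta> / (norm v + 1)}"
      have "\<xi> a - (x0 + \<tau> *\<^sub>R v) = - ((\<tau> - \<sigma>) *\<^sub>R v)" using \<xi>(2) by (simp add: algebra_simps)
      then have "norm (\<xi> a - (x0 + \<tau> *\<^sub>R v)) = (\<tau> - \<sigma>) * norm v" using \<tau> by simp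
      also have "\<dots> \<le> (\<eta> / (norm v + 1)) * (norm v + 1)" using \<tau> by (intro mult_mono) auto
      also have "\<dots> = \<eta>" by (simp add: add_nonneg_eq_0_iff)
      finally have "\<exists>\<zeta>. solves f u a b \<zeta> \<and> \<zeta> a = x0 + \<tau> *\<^sub>R v \<and> (\<forall>t\<in>{a..b}. norm (\<zeta> t) \<le> R + 1)"
        using \<eta>(1) by (intro \<eta>(2)[OF \<xi>(1) u u \<xi>(3)]) auto
      then show "\<tau> \<in> A" by (auto simp: A_def)
    qed
    moreover have "\<eta> / (norm v + 1) > 0" using \<eta>(1) by (simp add: add_nonneg_pos)
    ultimately show ?thesis by blast
  qed
  obtain L where L: "L \<ge> 0" "\<And>\<sigma>. \<sigma> \<in> {0..1} \<Longrightarrow> gnorm (G (x0 + \<sigma> *\<^sub>R (x - x0))) (x - x0) \<le> L"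
    by (rule segment_speed_bounded[OF G]) (rule that, assumption+)
  have Lv: "gnorm (G (x0 + \<sigma> *\<^sub>R v)) v \<le> L" if "\<sigma> \<in> {0..1}" for \<sigma>
    using L(2)[OF that] by (simp add: v_def)
  have "{0..1} \<subseteq> A"
  proof (rule unit_interval_induct)
    show "0 \<in> A" using \<phi>0 by (auto simp: A_def x0_def)
  next
    fix s assume s: "s \<in> A" "0 \<le> s" "s < 1"
    obtain \<xi> where \<xi>: "solves f u a b \<xi>" "\<xi> a = x0 + s *\<^sub>R v" using s(1) by (auto simp: A_def)
    obtain R where R: "R \<ge> 0" "\<And>t. t \<in> {a..b} \<Longrightarrow> norm (\<xi> t) \<le> R"
      by (rule solves_bounded[OF \<xi>(1)]) (rule that, assumption+)
    obtain \<eta> where "\<eta> > 0" "{s..s + \<eta>} \<subseteq> A" using continue[OF R(1)] \<xi> R(2) by blast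
    then show "\<exists>e>0. {s..s + e} \<inter> {0..1} \<subseteq> A" by blast
  next
    fix s :: real assume s: "0 < s" "s \<le> 1" "{0..<s} \<subseteq> A"
    then have "\<forall>\<sigma>\<in>{0..<s}. \<exists>\<xi>. solves f u a b \<xi> \<and> \<xi> a = x0 + \<sigma> *\<^sub>R v" by (auto simp: A_def)
    then obtain \<phi> where \<phi>: "\<And>\<sigma>. \<sigma> \<in> {0..<s} \<Longrightarrow> solves f u a b (\<phi> \<sigma>)" "\<And>\<sigma>. \<sigma> \<in> {0..<s} \<Longrightarrow> \<phi> \<sigma> a = x0 + \<sigma> *\<^sub>R v"
      by metis
    define C where "C = 2 * L"
    have C0: "C \<ge> 0" using L(1) by (simp add: C_def)
    have lip: "d (\<phi> \<sigma> t) (\<phi> \<sigma>' t) \<le> C * (\<sigma>' - \<sigma>)"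
      if \<sigma>: "0 \<le> \<sigma>" "\<sigma> \<le> \<sigma>'" "\<sigma>' < s" and t: "t \<in> {a..b}" for \<sigma> \<sigma>' t
    proof -
      define \<psi> where "\<psi> = (\<lambda>\<tau>. \<phi> (\<sigma> + \<tau> * (\<sigma>' - \<sigma>)))"
      have in_s: "\<sigma> + \<tau> * (\<sigma>' - \<sigma>) \<in> {0..<s}" if "\<tau> \<in> {0..1}" for \<tau>
      proof -
        have "\<tau> * (\<sigma>' - \<sigma>) \<le> 1 * (\<sigma>' - \<sigma>)" using that \<sigma> by (intro mult_right_mono) auto
        then show ?thesis using that \<sigma> by auto
      qed
      let ?y = "x0 + \<sigma> *\<^sub>R v" and ?y' = "x0 + \<sigma>' *\<^sub>R v"
      have diff: "?y' - ?y = (\<sigma>' - \<sigma>) *\<^sub>R v" by (simp add: algebra_simps)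
      have pt: "?y + \<tau> *\<^sub>R (?y' - ?y) = x0 + (\<sigma> + \<tau> * (\<sigma>' - \<sigma>)) *\<^sub>R v" for \<tau> by (simp add: diff algebra_simps)
      have "d (\<psi> 0 t) (\<psi> 1 t) \<le> 2 * exp (- (lam / 8) * (t - a)) * ((\<sigma>' - \<sigma>) * L) + (4 * (\<alpha> + 1) / lam) * 0"
      proof (rule segment_contraction[OF K ab _ u u])
        show "AE t in lebesgue_on {a..b}. u t - u t \<in> V \<and> norm (u t - u t) \<le> 0"
          using subspace_0[OF V] by simp
        show "solves f (\<lambda>t. u t + \<tau> *\<^sub>R (u t - u t)) a b (\<psi> \<tau>)" if "\<tau> \<in> {0..1}" for \<tau>
          using \<phi>(1)[OF in_s[OF that]] by (simp add: \<psi>_def)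
        show "\<psi> \<tau> a = ?y + \<tau> *\<^sub>R (?y' - ?y)" if "\<tau> \<in> {0..1}" for \<tau>
          using \<phi>(2)[OF in_s[OF that]] unfolding pt by (simp add: \<psi>_def)
        show "gnorm (G (?y + \<tau> *\<^sub>R (?y' - ?y))) (?y' - ?y) \<le> (\<sigma>' - \<sigma>) * L" if "\<tau> \<in> {0..1}" for \<tau>
        proof -
          have "\<sigma> + \<tau> * (\<sigma>' - \<sigma>) \<in> {0..1}" using in_s[OF that] s(2) by auto
          from mult_left_mono[OF Lv[OF this], of "\<sigma>' - \<sigma>"] show ?thesis
            unfolding pt unfolding diff gnorm_scaleR using \<sigma> by simp
        qed
      qed (use t in auto)
      also have "\<dots> \<le> 2 * 1 * ((\<sigma>' - \<sigma>) * L) + (4 * (\<alpha> + 1) / lam) * 0"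
        using t \<sigma> L(1) lam_pos by (intro add_right_mono mult_right_mono mult_left_mono) auto
      finally show ?thesis by (simp add: \<psi>_def C_def mult_ac)
    qed
    \<comment> \<open>A sequence increasing to \<open>s\<close>, along which the limit curve is constructed.\<close>
    define \<sigma> where "\<sigma> = (\<lambda>n :: nat. s * (1 - 1 / (real n + 1)))"
    have \<sigma>s: "0 \<le> \<sigma> n" "\<sigma> n < s" for n using s(1) by (auto simp: \<sigma>_def field_simps)
    have \<sigma>mono: "\<sigma> n \<le> \<sigma> k" if "n \<le> k" for n k
      using s(1) that unfolding \<sigma>_def by (intro mult_left_mono diff_left_mono divide_left_mono) auto
    have \<sigma>lim: "\<exists>N. \<forall>n\<ge>N. s - \<sigma> n < e" if e: "e > 0" for e
    proof -
      obtain N :: nat where N: "s / e < N" using reals_Archimedean2 by blast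
      have "s - \<sigma> n < e" if "n \<ge> N" for n
      proof -
        have "s / e < real n + 1" using N that by (simp add: less_le_trans)
        then have "s < e * (real n + 1)" using e by (simp add: divide_less_eq mult.commute)
        then have "s / (real n + 1) < e" by (simp add: divide_less_eq)
        moreover have "s - \<sigma> n = s / (real n + 1)" by (simp add: \<sigma>_def algebra_simps)
        ultimately show ?thesis by simp
      qed
      then show ?thesis by blast
    qed
    have "\<exists>p. \<forall>e>0. \<exists>N. \<forall>n\<ge>N. d (\<phi> (\<sigma> n) t) p < e" if t: "t \<in> {a..b}" for t
    proof -
      have "\<exists>N. \<forall>n n'. N \<le> n \<longrightarrow> N \<le> n' \<longrightarrow> d (\<phi> (\<sigma> n) t) (\<phi> (\<sigma> n') t) < e" if e: "e > 0" for e
      proof -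
        obtain N where N: "\<forall>n\<ge>N. s - \<sigma> n < e / (C + 1)" using \<sigma>lim[of "e / (C + 1)"] e C0 by auto
        have le: "d (\<phi> (\<sigma> n) t) (\<phi> (\<sigma> n') t) < e" if "N \<le> n" "n \<le> n'" for n n'
        proof -
          have "d (\<phi> (\<sigma> n) t) (\<phi> (\<sigma> n') t) \<le> C * (\<sigma> n' - \<sigma> n)" by (intro lip \<sigma>s \<sigma>mono that t)
          also have "\<dots> \<le> (C + 1) * (s - \<sigma> n)" using \<sigma>s[of n'] \<sigma>mono[OF that(2)] C0 by (intro mult_mono) auto
          also have "\<dots> < (C + 1) * (e / (C + 1))" using N that(1) C0 by (intro mult_strict_left_mono) auto
          also have "\<dots> = e" using C0 by simp
          finally show ?thesis .
        qed
        have "d (\<phi> (\<sigma> n) t) (\<phi> (\<sigma> n') t) < e" if "N \<le> n" "N \<le> n'" for n n'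
          using le[of n n'] le[of n' n] that d_commute by (cases "n \<le> n'") auto
        then show ?thesis by blast
      qed
      then have "Metric_space.MCauchy UNIV d (\<lambda>n. \<phi> (\<sigma> n) t)"
        by (simp add: Metric_space.MCauchy_def[OF metric])
      then obtain p where "limitin (Metric_space.mtopology UNIV d) (\<lambda>n. \<phi> (\<sigma> n) t) p sequentially"
        using complete unfolding Metric_space.mcomplete_def[OF metric] by blast
      then show ?thesis unfolding Metric_space.limit_metric_sequentially[OF metric] by auto
    qed
    then obtain \<psi> where \<psi>: "\<And>t e. t \<in> {a..b} \<Longrightarrow> e > 0 \<Longrightarrow> \<exists>N. \<forall>n\<ge>N. d (\<phi> (\<sigma> n) t) (\<psi> t) < e" by metis
    have dist_\<psi>: "d (\<phi> r t) (\<psi> t) \<le> C * (s - r)" if r: "0 \<le> r" "r < s" and t: "t \<in> {a..b}" for r t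
    proof (rule field_le_epsilon)
      fix e :: real assume e: "e > 0"
      obtain N1 where N1: "\<forall>n\<ge>N1. d (\<phi> (\<sigma> n) t) (\<psi> t) < e" using \<psi>[OF t e] by blast
      obtain N2 where N2: "\<forall>n\<ge>N2. s - \<sigma> n < s - r" using \<sigma>lim[of "s - r"] r by auto
      define n where "n = max N1 N2"
      have n: "d (\<phi> (\<sigma> n) t) (\<psi> t) < e" "r \<le> \<sigma> n" using N1 N2 by (auto simp: n_def less_imp_le)
      have "d (\<phi> r t) (\<psi> t) \<le> d (\<phi> r t) (\<phi> (\<sigma> n) t) + d (\<phi> (\<sigma> n) t) (\<psi> t)" by (rule d_triangle)
      also have "d (\<phi> r t) (\<phi> (\<sigma> n) t) \<le> C * (\<sigma> n - r)" by (rule lip[OF r(1) n(2) \<sigma>s(2) t])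
      also have "C * (\<sigma> n - r) \<le> C * (s - r)" using \<sigma>s[of n] C0 by (intro mult_left_mono) auto
      finally show "d (\<phi> r t) (\<psi> t) \<le> C * (s - r) + e" using n(1) by linarith
    qed
    have near_s: "\<exists>r. 0 \<le> r \<and> r < s \<and> s - r < h \<and> C * (s - r) < e" if "e > 0" "h > 0" for e h
    proof -
      have m: "min h (e / (C + 1)) > 0" using that C0 by simp
      obtain N where N: "\<forall>n\<ge>N. s - \<sigma> n < min h (e / (C + 1))" using \<sigma>lim[OF m] by blast
      have "s - \<sigma> N < h" "s - \<sigma> N < e / (C + 1)" using N by auto
      moreover have "C * (s - \<sigma> N) < e"
      proof -
        have "C * (s - \<sigma> N) \<le> (C + 1) * (s - \<sigma> N)" using \<sigma>s[of N] by simp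
        also have "\<dots> < (C + 1) * (e / (C + 1))" using \<open>s - \<sigma> N < e / (C + 1)\<close> C0 by (intro mult_strict_left_mono) auto
        finally show ?thesis using C0 by simp
      qed
      ultimately show ?thesis using \<sigma>s[of N] by (intro exI[of _ "\<sigma> N"]) auto
    qed
    have "continuous_on {a..b} \<psi>"
      unfolding continuous_on_iff
    proof (intro ballI allI impI)
      fix t e :: real assume t: "t \<in> {a..b}" and e: "e > 0"
      obtain \<eta> where \<eta>: "\<eta> > 0" "\<And>p y. \<lbrakk>p \<in> cball 0 (norm (\<psi> t)); d p y < \<eta>\<rbrakk> \<Longrightarrow> norm (y - p) < e"
        by (rule riemannian_dist_small_imp_close[OF G e]) (rule that, assumption+)
      obtain r where r: "0 \<le> r" "r < s" "C * (s - r) < \<eta> / 3" using near_s[of "\<eta> / 3" 1] \<eta>(1) by auto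
      have rin: "r \<in> {0..<s}" using r by simp
      obtain R where R: "\<And>t. t \<in> {a..b} \<Longrightarrow> norm (\<phi> r t) \<le> R"
        by (rule solves_bounded[OF \<phi>(1)[OF rin]]) (rule that, assumption)
      obtain M where M: "M > 0" "\<And>x y. \<lbrakk>x \<in> cball 0 R; y \<in> cball 0 R\<rbrakk> \<Longrightarrow> d x y \<le> M * norm (y - x)"
        by (rule riemannian_dist_le_norm[OF G]) (rule that, assumption+)
      have "\<eta> / 3 / M > 0" using \<eta>(1) M(1) by simp
      then obtain \<delta> where \<delta>: "\<delta> > 0" "\<And>t'. t' \<in> {a..b} \<Longrightarrow> dist t' t < \<delta> \<Longrightarrow> dist (\<phi> r t') (\<phi> r t) < \<eta> / 3 / M"
        using solves_imp_continuous_on[OF \<phi>(1)[OF rin]] t unfolding continuous_on_iff by metis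
      have "dist (\<psi> t') (\<psi> t) < e" if t': "t' \<in> {a..b}" "dist t' t < \<delta>" for t'
      proof -
        have "d (\<phi> r t) (\<phi> r t') \<le> M * norm (\<phi> r t' - \<phi> r t)" using R t t' by (intro M(2)) auto
        also have "\<dots> < M * (\<eta> / 3 / M)" using \<delta>(2)[OF t'] M(1) by (intro mult_strict_left_mono) (auto simp: dist_norm)
        finally have "d (\<phi> r t) (\<phi> r t') < \<eta> / 3" using M(1) by simp
        moreover have "d (\<psi> t) (\<psi> t') \<le> d (\<psi> t) (\<phi> r t) + (d (\<phi> r t) (\<phi> r t') + d (\<phi> r t') (\<psi> t'))"
          using d_triangle[of "\<psi> t" "\<psi> t'" "\<phi> r t"] d_triangle[of "\<phi> r t" "\<psi> t'" "\<phi> r t'"] by linarith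
        moreover have "d (\<psi> t) (\<phi> r t) < \<eta> / 3" "d (\<phi> r t') (\<psi> t') < \<eta> / 3"
          using dist_\<psi>[OF r(1,2) t] dist_\<psi>[OF r(1,2) t'(1)] r(3) by (simp_all add: d_commute[of "\<psi> t"])
        ultimately have "d (\<psi> t) (\<psi> t') < \<eta>" by linarith
        then show ?thesis using \<eta>(2)[of "\<psi> t" "\<psi> t'"] by (simp add: dist_norm)
      qed
      then show "\<exists>\<delta>>0. \<forall>t'\<in>{a..b}. dist t' t < \<delta> \<longrightarrow> dist (\<psi> t') (\<psi> t) < e" using \<delta>(1) by blast
    qed
    then obtain R where R: "R \<ge> 0" "\<And>t. t \<in> {a..b} \<Longrightarrow> norm (\<psi> t) \<le> R"
      by (rule continuous_on_compact_bound[OF compact_Icc]) (rule that, assumption+)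
    obtain \<eta>1 where \<eta>1: "\<eta>1 > 0" "\<And>p y. \<lbrakk>p \<in> cball 0 R; d p y < \<eta>1\<rbrakk> \<Longrightarrow> norm (y - p) < 1"
      by (rule riemannian_dist_small_imp_close[OF G zero_less_one]) (rule that, assumption+)
    obtain \<eta> where \<eta>: "\<eta> > 0" "\<forall>\<sigma> \<xi>. solves f u a b \<xi> \<and> \<xi> a = x0 + \<sigma> *\<^sub>R v \<and> (\<forall>t\<in>{a..b}. norm (\<xi> t) \<le> R + 1)
      \<longrightarrow> {\<sigma>..\<sigma> + \<eta>} \<subseteq> A" using continue[of "R + 1"] R(1) by auto
    obtain r where r: "0 \<le> r" "r < s" "s - r < \<eta>" "C * (s - r) < \<eta>1" using near_s[OF \<eta>1(1) \<eta>(1)] by blast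
    have rin: "r \<in> {0..<s}" using r by simp
    have "norm (\<phi> r t) \<le> R + 1" if t: "t \<in> {a..b}" for t
    proof -
      have "d (\<psi> t) (\<phi> r t) < \<eta>1" using dist_\<psi>[OF r(1,2) t] r(4) by (simp add: d_commute[of "\<psi> t"])
      then have "norm (\<phi> r t - \<psi> t) < 1" using R(2)[OF t] by (intro \<eta>1(2)) auto
      then show ?thesis using R(2)[OF t] norm_triangle_sub[of "\<phi> r t" "\<psi> t"] by simp
    qed
    then have "{r..r + \<eta>} \<subseteq> A" using \<eta>(2) \<phi>(1)[OF rin] \<phi>(2)[OF rin] by blast
    then show "s \<in> A" using r by auto
  qed
  then have "1 \<in> A" by auto
  then show ?thesis by (simp add: A_def v_def)
qed

text \<open>
  On intervals of length at most \<open>\<tau>\<close> the solution from the origin exists, hence those from all states.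
  As \<open>\<tau>\<close> is independent of the initial time, concatenation covers any compact interval.
\<close>

lemma solution_exists:
  assumes complete: "Metric_space.mcomplete UNIV (riemannian_dist G)"
    and K: "compact K" "convex K" "K \<subseteq> U" "K \<noteq> {}" and ab: "a \<le> b" and u: "admissible K a b u"
  shows "\<exists>\<xi>. solves f u a b \<xi> \<and> \<xi> a = x"
proof -
  have fK: "lipschitz_field K f" by (rule smooth_field_imp_lipschitz_field[OF f K])
  obtain \<tau> where \<tau>: "\<tau> > 0"
    "\<And>a b w. \<lbrakk>a \<le> b; b - a \<le> \<tau>; admissible K a b w\<rbrakk> \<Longrightarrow> \<exists>\<zeta>. solves f w a b \<zeta> \<and> \<zeta> a = 0"
    by (rule local_solution[OF fK, of 0]) (rule that, assumption+)
  have short: "\<exists>\<xi>. solves f u a b \<xi> \<and> \<xi> a = x" if "a \<le> b" "b - a \<le> \<tau>" "admissible K a b u" for a b x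
    using \<tau>(2)[OF that] solution_from_everywhere[OF complete K that(1,3)] by blast
  have "\<exists>\<xi>. solves f u a b \<xi> \<and> \<xi> a = x" if "a \<le> b" "b - a \<le> real n * \<tau>" "admissible K a b u" for n b
    using that
  proof (induction n arbitrary: b)
    case 0
    then show ?case using short[of a b] \<tau>(1) by simp
  next
    case (Suc n)
    define m where "m = max a (b - \<tau>)"
    have m: "a \<le> m" "m \<le> b" "b - m \<le> \<tau>" "m - a \<le> real n * \<tau>"
      using Suc.prems \<tau>(1) by (auto simp: m_def algebra_simps max_def)
    obtain \<xi> where \<xi>: "solves f u a m \<xi>" "\<xi> a = x"
      using Suc.IH[OF m(1,4) admissible_subinterval[OF Suc.prems(3) order_refl m(2)]] by blast
    obtain \<zeta> where \<zeta>: "solves f u m b \<zeta>" "\<zeta> m = \<xi> m"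
      using short[OF m(2,3) admissible_subinterval[OF Suc.prems(3) m(1) order_refl], of "\<xi> m"] by blast
    from solves_concat[OF \<xi>(1) \<zeta>(1) \<zeta>(2)[symmetric] m(1,2)] show ?case
      using \<xi>(2) m(1) by (intro exI[of _ "\<lambda>t. if t \<le> m then \<xi> t else \<zeta> t"]) auto
  qed
  moreover obtain n :: nat where "(b - a) / \<tau> < n" using reals_Archimedean2 by blast
  then have "b - a \<le> real n * \<tau>" using \<tau>(1) by (simp add: pos_divide_less_eq less_imp_le)
  ultimately show ?thesis using ab u by blast
qed

end

section \<open>Trajectories\<close>

lemma abs_continuous_imp_continuous_on:
  assumes ac: "abs_continuous_on a b g" shows "continuous_on {a..b} g"
  unfolding continuous_on_iff
proof (intro ballI allI impI)
  fix x e :: real assume x: "x \<in> {a..b}" and e: "e > 0"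
  obtain \<delta> where \<delta>: "\<delta> > 0"
    "\<And>D T. \<lbrakk>D division_of T; T \<subseteq> {a..b}; (\<Sum>I\<in>D. Sup I - Inf I) < \<delta>\<rbrakk> \<Longrightarrow>
       (\<Sum>I\<in>D. norm (g (Sup I) - g (Inf I))) < e"
    by (rule abs_continuous_onE[OF ac e]) (rule that, assumption+)
  have le: "norm (g q - g p) < e" if "p \<in> {a..b}" "q \<in> {a..b}" "p \<le> q" "q - p < \<delta>" for p q
  proof -
    have "{{p..q}} division_of {p..q}" using division_of_self[of p q] that by simp
    from \<delta>(2)[OF this] show ?thesis using that by auto
  qed
  have "dist (g x') (g x) < e" if "x' \<in> {a..b}" "dist x' x < \<delta>" for x'
    using le[of x x'] le[of x' x] that x by (cases "x \<le> x'") (auto simp: dist_norm norm_minus_commute)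
  then show "\<exists>d>0. \<forall>x'\<in>{a..b}. dist x' x < d \<longrightarrow> dist (g x') (g x) < e" using \<delta>(1) by blast
qed

lemma einterval_sets [simp]: "einterval a b \<in> sets lebesgue"
  by (simp add: borel_open)

lemma einterval_Icc:
  assumes "a < ereal c" "ereal e < b" shows "{c..e} \<subseteq> einterval a b"
proof
  fix t assume "t \<in> {c..e}"
  then have "ereal c \<le> ereal t" "ereal t \<le> ereal e" by auto
  then have "a < ereal t" "ereal t < b" using assms by (blast intro: less_le_trans le_less_trans)+
  then show "t \<in> einterval a b" by (simp add: einterval_iff)
qed

text \<open>
  The convex hull makes room for interpolation between inputs. One value of the input is inserted
  because \<open>K0\<close> may be empty when the interval consists of a single point.
\<close>

lemma is_input_admissible:
  assumes inp: "is_input U a b \<upsilon>" and U: "convex U" and ce: "a < ereal c" "c \<le> e" "ereal e < b"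
  obtains K where "compact K" "convex K" "K \<subseteq> U" "K \<noteq> {}" "admissible K c e \<upsilon>"
proof -
  have sub: "{c..e} \<subseteq> einterval a b" using einterval_Icc ce by blast
  obtain K0 where K0: "compact K0" "K0 \<subseteq> U" "AE t in lebesgue_on {c..e}. \<upsilon> t \<in> K0"
    using inp sub unfolding is_input_def by blast
  have "\<upsilon> c \<in> U" using inp sub ce(2) unfolding is_input_def by auto
  define K where "K = convex hull (insert (\<upsilon> c) K0)"
  have "\<upsilon> \<in> borel_measurable (restrict_space (lebesgue_on (einterval a b)) {c..e})"
    using inp by (auto simp: is_input_def intro: measurable_restrict_space1)
  moreover have "restrict_space (lebesgue_on (einterval a b)) {c..e} = lebesgue_on {c..e}"
    using sub by (subst restrict_restrict_space) (simp_all add: Int_absorb1)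
  moreover have "AE t in lebesgue_on {c..e}. \<upsilon> t \<in> K"
    using K0(3) by eventually_elim (simp add: K_def hull_inc)
  ultimately have "admissible K c e \<upsilon>" by (simp add: admissible_def)
  moreover have "K \<subseteq> U" unfolding K_def using K0(2) \<open>\<upsilon> c \<in> U\<close> U by (intro hull_minimal) auto
  moreover have "compact K" unfolding K_def using K0(1) by (intro compact_convex_hull compact_insert)
  ultimately show thesis using that[of K] by (auto simp: K_def)
qed

lemma admissible_mono: "admissible K a b u \<Longrightarrow> K \<subseteq> K' \<Longrightarrow> admissible K' a b u"
  unfolding admissible_def by (auto elim: eventually_mono)

lemma is_input_restrict:
  assumes "is_input U a b \<upsilon>" "a \<le> c" "c < 0" shows "is_input U c b \<upsilon>"
proof -
  have sub: "einterval c b \<subseteq> einterval a b" using assms by (auto simp: einterval_def)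
  have "\<upsilon> \<in> borel_measurable (restrict_space (lebesgue_on (einterval a b)) (einterval c b))"
    using assms by (auto simp: is_input_def intro: measurable_restrict_space1)
  moreover have "restrict_space (lebesgue_on (einterval a b)) (einterval c b) = lebesgue_on (einterval c b)"
    using sub by (subst restrict_restrict_space) (simp_all add: Int_absorb1)
  ultimately show ?thesis using assms sub unfolding is_input_def by (auto intro: order_trans)
qed

lemma trajectory_solves:
  fixes f :: "real^'n \<Rightarrow> real^'m \<Rightarrow> real^'n"
  assumes tr: "trajectory U f a b \<upsilon> \<xi>" and f: "lipschitz_field K f" and u: "admissible K c e \<upsilon>"
    and ce: "a < ereal c" "ereal e < b"
  shows "solves f \<upsilon> c e \<xi>"
proof -
  have sub: "{c..e} \<subseteq> einterval a b" using einterval_Icc ce by blast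
  have ac: "abs_continuous_on c e \<xi>" using tr sub by (simp add: trajectory_def)
  have der: "AE t in lebesgue_on {c..e}. (\<xi> has_vector_derivative f (\<xi> t) (\<upsilon> t)) (at t)"
    by (rule AE_lebesgue_on_subset[OF _ sub]) (use tr in \<open>auto simp: trajectory_def\<close>)
  obtain R where R: "R \<ge> 0" "\<And>t. t \<in> {c..e} \<Longrightarrow> norm (\<xi> t) \<le> R"
    by (rule continuous_on_compact_bound[OF compact_Icc abs_continuous_imp_continuous_on[OF ac]]) (rule that, assumption+)
  obtain L where L: "L-lipschitz_on (cball 0 R \<times> K) (\<lambda>(x, u). f x u)" using f by (auto simp: lipschitz_field_def)
  have "compact (cball (0 :: real^'n) R \<times> K)" using f compact_Times[OF compact_cball, of K] by (simp add: lipschitz_field_def)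
  then obtain M where M: "M \<ge> 0" "\<And>s. s \<in> cball 0 R \<times> K \<Longrightarrow> norm (case s of (x, u) \<Rightarrow> f x u) \<le> M"
    by (rule continuous_on_compact_bound[OF _ lipschitz_on_continuous_on[OF L]]) (rule that, assumption+)
  have "AE t in lebesgue_on {c..e}. \<upsilon> t \<in> K" "AE t in lebesgue_on {c..e}. t \<in> {c..e}"
    using u by (auto simp: admissible_def)
  with der have "AE t in lebesgue_on {c..e}. \<exists>v. norm v \<le> M \<and> (\<xi> has_vector_derivative v) (at t)"
  proof eventually_elim
    case (elim t)
    have "(\<xi> t, \<upsilon> t) \<in> cball 0 R \<times> K" using R(2)[of t] elim by simp
    from M(2)[OF this] show ?case using elim(1) by auto
  qed
  from abs_continuous_imp_lipschitz[OF ac M(1) this] show ?thesis using der by (auto simp: solves_def)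
qed

lemma solves_cong:
  assumes s: "solves f u a b \<xi>" and eq: "\<And>t. t \<in> {a..b} \<Longrightarrow> \<zeta> t = \<xi> t"
  shows "solves f u a b \<zeta>"
  unfolding solves_def
proof
  obtain L where "L-lipschitz_on {a..b} \<xi>" using s by (auto simp: solves_def)
  then have "L-lipschitz_on {a..b} \<zeta>" using eq unfolding lipschitz_on_def by (metis)
  then show "\<exists>L. L-lipschitz_on {a..b} \<zeta>" by blast
  let ?N = "{t \<in> {a..b}. \<not> (\<xi> has_vector_derivative f (\<xi> t) (u t)) (at t)}"
  have N: "negligible ?N"
    using s unfolding solves_def by (intro AE_lebesgue_on_exceptional_negligible; simp)
  show "AE t in lebesgue_on {a..b}. (\<zeta> has_vector_derivative f (\<zeta> t) (u t)) (at t)"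
  proof (rule negligible_imp_AE_lebesgue_on)
    show "negligible (?N \<union> {a, b})" using N by simp
    fix t assume t: "t \<in> {a..b}" "t \<notin> ?N \<union> {a, b}"
    then have "(\<xi> has_vector_derivative f (\<xi> t) (u t)) (at t)" by simp
    then have "(\<zeta> has_vector_derivative f (\<xi> t) (u t)) (at t)"
      by (rule has_vector_derivative_transform_within_open[of _ _ _ "{a<..<b}"]) (use t eq in auto)
    then show "(\<zeta> has_vector_derivative f (\<zeta> t) (u t)) (at t)" using eq[OF t(1)] by simp
  qed simp
qed

text \<open>
  A trajectory through a state at time 0 has to be defined on a neighbourhood of 0. Reversing time
  turns \<open>f\<close> into \<open>- f\<close> and reduces the past to the future.
\<close>

lemma local_backward_solution:
  fixes f :: "'a::euclidean_space \<Rightarrow> 'b::euclidean_space \<Rightarrow> 'a"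
  assumes K: "lipschitz_field K f" and u: "admissible K p 0 u" and p: "p < 0"
  obtains e \<xi> where "p \<le> e" "e < 0" "solves f u e 0 \<xi>" "\<xi> 0 = x"
proof -
  define g where "g = (\<lambda>x u. - f x u)"
  have gK: "lipschitz_field K g"
    unfolding lipschitz_field_def
  proof (intro conjI allI)
    show "compact K" "K \<noteq> {}" using K by (auto simp: lipschitz_field_def)
    fix R
    obtain L where L: "L-lipschitz_on (cball 0 R \<times> K) (\<lambda>(x, u). f x u)" using K by (auto simp: lipschitz_field_def)
    have "L-lipschitz_on (cball 0 R \<times> K) (\<lambda>z. - (case z of (x, u) \<Rightarrow> f x u))"
      by (rule lipschitz_on_minus[OF L])
    then show "\<exists>L. L-lipschitz_on (cball 0 R \<times> K) (\<lambda>(x, u). g x u)" by (auto simp: g_def case_prod_unfold)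
  qed
  obtain \<tau> where \<tau>: "\<tau> > 0"
    "\<And>a b w. \<lbrakk>a \<le> b; b - a \<le> \<tau>; admissible K a b w\<rbrakk> \<Longrightarrow> \<exists>\<zeta>. solves g w a b \<zeta> \<and> \<zeta> a = x"
    by (rule local_solution[OF gK, of x]) (rule that, assumption+)
  define e where "e = max p (- \<tau>)"
  have e: "p \<le> e" "e < 0" "- e \<le> \<tau>" using p \<tau>(1) by (auto simp: e_def)
  define w where "w = (\<lambda>t. u (- t))"
  have ue: "admissible K e 0 u" by (rule admissible_subinterval[OF u e(1) order_refl])
  have neg_image: "negligible (uminus ` N)" if "negligible N" for N :: "real set"
    by (rule negligible_differentiable_image_negligible[OF _ that])
      (auto intro: derivative_intros simp: differentiable_on_def)
  have "admissible K 0 (- e) w"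
    unfolding admissible_def
  proof
    obtain k0 where "k0 \<in> K" using K by (auto simp: lipschitz_field_def)
    have "(\<lambda>t. if t \<in> {e..0} then u t else k0) \<in> borel_measurable lebesgue"
      using ue measurable_restrict_space_iff[of "{e..0}" lebesgue k0 borel u] by (simp add: admissible_def)
    moreover have "(uminus :: real \<Rightarrow> real) \<in> lebesgue \<rightarrow>\<^sub>M lebesgue"
    proof -
      have "(*\<^sub>R) (- 1) = (uminus :: real \<Rightarrow> real)" by (auto simp: fun_eq_iff)
      then show ?thesis using lebesgue_measurable_scaling[where ?'a = real, of "- 1"] by simp
    qed
    ultimately have "(\<lambda>t. if - t \<in> {e..0} then u (- t) else k0) \<in> borel_measurable lebesgue"
      by (rule measurable_compose[rotated])
    then have "(\<lambda>t. if t \<in> {0..- e} then w t else k0) \<in> borel_measurable lebesgue"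
      by (rule measurable_cong[THEN iffD1, rotated]) (auto simp: w_def)
    then show "w \<in> borel_measurable (lebesgue_on {0..- e})"
      using measurable_restrict_space_iff[of "{0..- e}" lebesgue k0 borel w] by simp
    have N: "negligible {t \<in> {e..0}. \<not> u t \<in> K}"
      using ue unfolding admissible_def by (intro AE_lebesgue_on_exceptional_negligible; simp)
    show "AE t in lebesgue_on {0..- e}. w t \<in> K"
    proof (rule negligible_imp_AE_lebesgue_on[OF _ neg_image[OF N]])
      fix t assume t: "t \<in> {0..- e}" "t \<notin> uminus ` {t \<in> {e..0}. \<not> u t \<in> K}"
      have "t = - (- t)" by simp
      then have "- t \<notin> {t \<in> {e..0}. \<not> u t \<in> K}" using t(2) by blast
      then show "w t \<in> K" using t(1) by (auto simp: w_def)
    qed simp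
  qed
  from \<tau>(2)[OF _ _ this] obtain \<zeta> where \<zeta>: "solves g w 0 (- e) \<zeta>" "\<zeta> 0 = x" using e by auto
  define \<xi> where "\<xi> = (\<lambda>t. \<zeta> (- t))"
  have "solves f u e 0 \<xi>"
    unfolding solves_def
  proof
    obtain L where L: "L-lipschitz_on {0..- e} \<zeta>" using \<zeta> by (auto simp: solves_def)
    have "L-lipschitz_on {e..0} \<xi>"
    proof (rule lipschitz_onI[OF _ lipschitz_on_nonneg[OF L]])
      fix s t assume "s \<in> {e..0}" "t \<in> {e..0}"
      then show "dist (\<xi> s) (\<xi> t) \<le> L * dist s t"
        using lipschitz_onD[OF L, of "- s" "- t"] by (simp add: \<xi>_def dist_minus)
    qed
    then show "\<exists>L. L-lipschitz_on {e..0} \<xi>" by blast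
    have N: "negligible {t \<in> {0..- e}. \<not> (\<zeta> has_vector_derivative g (\<zeta> t) (w t)) (at t)}"
      using \<zeta> unfolding solves_def by (intro AE_lebesgue_on_exceptional_negligible; simp)
    show "AE t in lebesgue_on {e..0}. (\<xi> has_vector_derivative f (\<xi> t) (u t)) (at t)"
    proof (rule negligible_imp_AE_lebesgue_on[OF _ neg_image[OF N]])
      fix t assume t: "t \<in> {e..0}" "t \<notin> uminus ` {t \<in> {0..- e}. \<not> (\<zeta> has_vector_derivative g (\<zeta> t) (w t)) (at t)}"
      have "t = - (- t)" by simp
      then have "- t \<notin> {t \<in> {0..- e}. \<not> (\<zeta> has_vector_derivative g (\<zeta> t) (w t)) (at t)}" using t(2) by blast
      then have d: "(\<zeta> has_vector_derivative g (\<zeta> (- t)) (w (- t))) (at (- t))" using t(1) by auto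
      have m: "(uminus has_vector_derivative - 1) (at t)" by (auto intro!: derivative_eq_intros)
      from vector_diff_chain_at[OF m d] show "(\<xi> has_vector_derivative f (\<xi> t) (u t)) (at t)"
        by (simp add: o_def \<xi>_def g_def w_def)
    qed simp
  qed
  then show thesis using that[OF e(1,2)] \<zeta>(2) by (simp add: \<xi>_def)
qed

text \<open>
  Compact subintervals are handled by concatenation. Countably many of them, with rational left and
  natural right endpoints, cover the domain, so that the exceptional times remain a null set.
\<close>

lemma glue_trajectory:
  assumes inp: "is_input U c \<infinity> \<upsilon>"
    and left: "\<And>e. c < ereal e \<Longrightarrow> e \<le> 0 \<Longrightarrow> solves f \<upsilon> e 0 \<xi>"
    and right: "\<And>T. T \<ge> 0 \<Longrightarrow> solves f \<upsilon> 0 T \<zeta>" and eq: "\<xi> 0 = \<zeta> 0"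
  shows "trajectory U f c \<infinity> \<upsilon> (\<lambda>t. if t \<le> 0 then \<xi> t else \<zeta> t)" (is "trajectory U f c \<infinity> \<upsilon> ?\<phi>")
proof -
  have sol: "solves f \<upsilon> p q ?\<phi>" if "c < ereal p" for p q
  proof -
    have c0: "c < 0" using inp by (simp add: is_input_def)
    have "c < ereal (min p 0)" using that c0 by (auto simp: min_def zero_ereal_def)
    then have "solves f \<upsilon> (min p 0) (max q 0) ?\<phi>"
      by (intro solves_concat left right eq) auto
    then show ?thesis by (rule solves_subinterval) auto
  qed
  have ac: "abs_continuous_on p q ?\<phi>" if "{p..q} \<subseteq> einterval c \<infinity>" for p q
  proof (cases "p \<le> q")
    case True
    then have "c < ereal p" using that by (auto simp: einterval_def)
    from sol[OF this, of q] show ?thesis unfolding solves_def using lipschitz_imp_abs_continuous_on by blast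
  next
    case False
    then have "0-lipschitz_on {p..q} ?\<phi>" by (auto simp: lipschitz_on_def)
    then show ?thesis by (rule lipschitz_imp_abs_continuous_on)
  qed
  define N where "N = (\<lambda>(p :: real) (q :: real). {t \<in> {p..q}. \<not> (?\<phi> has_vector_derivative f (?\<phi> t) (\<upsilon> t)) (at t)})"
  have N: "negligible (N p q)" if "c < ereal p" for p q
    unfolding N_def using sol[OF that, of q] unfolding solves_def
    by (intro AE_lebesgue_on_exceptional_negligible; simp)
  define \<F> where "\<F> = (\<lambda>(r :: rat, n :: nat). N (of_rat r) (real n)) ` {(r, n). c < ereal (of_rat r)}"
  have neg: "negligible (\<Union>\<F>)"
  proof (rule negligible_countable_Union)
    show "countable \<F>" unfolding \<F>_def by (rule countable_image) (rule countableI_type)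
    show "negligible S" if "S \<in> \<F>" for S using that N by (auto simp: \<F>_def)
  qed
  have "AE t in lebesgue_on (einterval c \<infinity>). (?\<phi> has_vector_derivative f (?\<phi> t) (\<upsilon> t)) (at t)"
  proof (rule negligible_imp_AE_lebesgue_on[OF _ neg])
    fix t assume t: "t \<in> einterval c \<infinity>" "t \<notin> \<Union>\<F>"
    obtain r :: rat where r: "c < ereal (of_rat r)" "ereal (of_rat r) < ereal t"
      using ereal_dense3[of c "ereal t"] t by (auto simp: einterval_def)
    obtain n :: nat where n: "t \<le> real n" using real_arch_simple by blast
    have "N (of_rat r) (real n) \<in> \<F>" using r(1) by (auto simp: \<F>_def)
    then have "t \<notin> N (of_rat r) (real n)" using t(2) by blast
    then show "(?\<phi> has_vector_derivative f (?\<phi> t) (\<upsilon> t)) (at t)" using r(2) n by (auto simp: N_def)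
  qed simp
  then show ?thesis using inp ac by (simp add: trajectory_def)
qed

context contracting_system begin

section \<open>Incremental stability\<close>

text \<open>
  A polygon between the initial states with \<open>N\<close> edges is matched with \<open>N\<close> steps between the inputs:
  the \<open>i\<close>-th vertex is moved by the input \<open>u (i / N)\<close>. Each edge is covered by \<open>segment_contraction\<close>,
  and the \<open>l i\<close> add up to at most 4 times any number above the distance of the initial states.
\<close>

lemma trajectory_estimate:
  assumes complete: "Metric_space.mcomplete UNIV (riemannian_dist G)" and U: "convex U"
    and tr: "trajectory U f a b \<upsilon> \<xi>" "trajectory U f a b \<upsilon>' \<xi>'" and t: "0 \<le> t" "ereal t < b" and D: "D \<ge> 0"
    and close: "AE s in lebesgue_on {0..t}. \<upsilon>' s - \<upsilon> s \<in> V \<and> norm (\<upsilon>' s - \<upsilon> s) \<le> D"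
  shows "d (\<xi> t) (\<xi>' t) \<le> 8 * exp (- (lam / 8) * t) * d (\<xi> 0) (\<xi>' 0) + (4 * (\<alpha> + 1) / lam) * D"
proof -
  have a0: "a < ereal 0" and inp: "is_input U a b \<upsilon>" "is_input U a b \<upsilon>'"
    using tr by (auto simp: trajectory_def is_input_def zero_ereal_def)
  obtain K1 where K1: "compact K1" "convex K1" "K1 \<subseteq> U" "K1 \<noteq> {}" "admissible K1 0 t \<upsilon>"
    by (rule is_input_admissible[OF inp(1) U a0 t]) (rule that, assumption+)
  obtain K2 where K2: "compact K2" "convex K2" "K2 \<subseteq> U" "K2 \<noteq> {}" "admissible K2 0 t \<upsilon>'"
    by (rule is_input_admissible[OF inp(2) U a0 t]) (rule that, assumption+)
  define K where "K = convex hull (K1 \<union> K2)"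
  have sub: "K1 \<union> K2 \<subseteq> K" by (simp add: K_def hull_subset)
  have K: "compact K" "convex K" "K \<subseteq> U" "K \<noteq> {}"
  proof -
    show "compact K" unfolding K_def using K1 K2 by (intro compact_convex_hull compact_Un)
    show "K \<subseteq> U" unfolding K_def using K1 K2 U by (intro hull_minimal) auto
    show "K \<noteq> {}" using sub K1(4) by auto
  qed (simp add: K_def)
  have fK: "lipschitz_field K f" by (rule smooth_field_imp_lipschitz_field[OF f K])
  define u where "u = (\<lambda>(\<sigma> :: real) s. \<upsilon> s + \<sigma> *\<^sub>R (\<upsilon>' s - \<upsilon> s))"
  have adm: "admissible K 0 t \<upsilon>" "admissible K 0 t \<upsilon>'" using K1(5) K2(5) sub by (auto intro: admissible_mono)
  have uadm: "admissible K 0 t (u \<sigma>)" if "\<sigma> \<in> {0..1}" for \<sigma>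
    unfolding u_def by (rule admissible_segment[OF K(2) adm that])
  have u_diff: "u \<tau> s - u \<sigma> s = (\<tau> - \<sigma>) *\<^sub>R (\<upsilon>' s - \<upsilon> s)" for \<sigma> \<tau> s by (simp add: u_def algebra_simps)
  have u01: "u 0 = \<upsilon>" "u 1 = \<upsilon>'" by (auto simp: u_def)
  define \<Phi> where "\<Phi> = (\<lambda>q \<sigma>. SOME \<phi>. solves f (u \<sigma>) 0 t \<phi> \<and> \<phi> 0 = q)"
  have \<Phi>: "solves f (u \<sigma>) 0 t (\<Phi> q \<sigma>)" "\<Phi> q \<sigma> 0 = q" if "\<sigma> \<in> {0..1}" for q \<sigma>
    using someI_ex[OF solution_exists[OF complete K t(1) uadm[OF that], of q]] by (auto simp: \<Phi>_def)
  have tt: "t \<in> {0..t}" using t by simp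
  have "solves f (u 0) 0 t \<xi>" "solves f (u 1) 0 t \<xi>'"
    unfolding u01 by (rule trajectory_solves[OF tr(1) fK adm(1) a0 t(2)], rule trajectory_solves[OF tr(2) fK adm(2) a0 t(2)])
  then have ends: "\<Phi> (\<xi> 0) 0 t = \<xi> t" "\<Phi> (\<xi>' 0) 1 t = \<xi>' t"
    using solves_unique[OF fK uadm[of 0] \<Phi>(1)[of 0 "\<xi> 0"] _ _ tt] solves_unique[OF fK uadm[of 1] \<Phi>(1)[of 1 "\<xi>' 0"] _ _ tt] \<Phi>(2)
    by auto
  have bound: "d (\<xi> t) (\<xi>' t) \<le> 8 * exp (- (lam / 8) * t) * L + (4 * (\<alpha> + 1) / lam) * D" if L: "d (\<xi> 0) (\<xi>' 0) < L" for L
  proof -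
    obtain N :: nat and p l where N: "N > 0" and p: "p 0 = \<xi> 0" "p N = \<xi>' 0" and l: "(\<Sum>i<N. l i) \<le> 4 * L"
      and seg: "\<And>i \<sigma>. i < N \<Longrightarrow> \<sigma> \<in> {0..1} \<Longrightarrow> gnorm (G (p i + \<sigma> *\<^sub>R (p (Suc i) - p i))) (p (Suc i) - p i) \<le> l i"
      by (rule riemannian_dist_polygon[OF G L]) (rule that, assumption+)
    define q where "q = (\<lambda>i. \<Phi> (p i) (i / N) t)"
    have step: "d (q i) (q (Suc i)) \<le> 2 * exp (- (lam / 8) * (t - 0)) * l i + (4 * (\<alpha> + 1) / lam) * (D / N)" if i: "i < N" for i
    proof -
      let ?x = "p i" and ?y = "p (Suc i)" and ?s = "\<lambda>\<sigma>. (real i + \<sigma>) / N"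
      have s01: "?s \<sigma> \<in> {0..1}" if "\<sigma> \<in> {0..1}" for \<sigma> using that i N by (auto simp: field_simps)
      have "d (\<Phi> (?x + 0 *\<^sub>R (?y - ?x)) (?s 0) t) (\<Phi> (?x + 1 *\<^sub>R (?y - ?x)) (?s 1) t)
        \<le> 2 * exp (- (lam / 8) * (t - 0)) * l i + (4 * (\<alpha> + 1) / lam) * (D / N)"
      proof (rule segment_contraction[OF K t(1) _ uadm[OF s01[of 0]] uadm[OF s01[of 1]]])
        show "0 \<le> D / N" using D by simp
        show "AE s in lebesgue_on {0..t}. u (?s 1) s - u (?s 0) s \<in> V \<and> norm (u (?s 1) s - u (?s 0) s) \<le> D / N"
          using close
        proof eventually_elim
          case (elim s)
          have "?s 1 - ?s 0 = 1 / N" by (simp add: add_divide_distrib)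
          then show ?case using elim N V by (simp only: u_diff) (simp add: subspace_scale divide_right_mono)
        qed
        fix \<sigma> :: real assume \<sigma>: "\<sigma> \<in> {0..1}"
        have "u (?s 0) s + \<sigma> *\<^sub>R (u (?s 1) s - u (?s 0) s) = u (?s \<sigma>) s" for s
          unfolding u_diff unfolding u_def by (simp add: algebra_simps add_divide_distrib)
        then show "solves f (\<lambda>s. u (?s 0) s + \<sigma> *\<^sub>R (u (?s 1) s - u (?s 0) s)) 0 t (\<Phi> (?x + \<sigma> *\<^sub>R (?y - ?x)) (?s \<sigma>))"
          using \<Phi>(1)[OF s01[OF \<sigma>]] by simp
        show "\<Phi> (?x + \<sigma> *\<^sub>R (?y - ?x)) (?s \<sigma>) 0 = ?x + \<sigma> *\<^sub>R (?y - ?x)" by (rule \<Phi>(2)[OF s01[OF \<sigma>]])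
        show "gnorm (G (?x + \<sigma> *\<^sub>R (?y - ?x))) (?y - ?x) \<le> l i" by (rule seg[OF i \<sigma>])
      qed (use tt in auto)
      then show ?thesis by (simp add: q_def add.commute)
    qed
    have "d (q 0) (q N) \<le> (\<Sum>i<N. d (q i) (q (Suc i)))" by (rule d_chain)
    also have "\<dots> \<le> (\<Sum>i<N. 2 * exp (- (lam / 8) * (t - 0)) * l i + (4 * (\<alpha> + 1) / lam) * (D / N))"
      by (intro sum_mono step) auto
    also have "\<dots> = 2 * exp (- (lam / 8) * (t - 0)) * (\<Sum>i<N. l i) + N * ((4 * (\<alpha> + 1) / lam) * (D / N))"
      by (simp only: sum.distrib sum_distrib_left[symmetric]) simp
    also have "\<dots> \<le> 2 * exp (- (lam / 8) * (t - 0)) * (4 * L) + N * ((4 * (\<alpha> + 1) / lam) * (D / N))"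
      by (intro add_right_mono mult_left_mono l) auto
    also have "real N * ((4 * (\<alpha> + 1) / lam) * (D / N)) = (4 * (\<alpha> + 1) / lam) * D" using N by simp
    finally show ?thesis using N p ends by (simp add: q_def)
  qed
  show ?thesis
  proof (rule field_le_epsilon)
    fix e :: real assume e: "e > 0"
    define c where "c = 8 * exp (- (lam / 8) * t)"
    have c: "c > 0" by (simp add: c_def)
    have "d (\<xi> t) (\<xi>' t) \<le> c * (d (\<xi> 0) (\<xi>' 0) + e / c) + (4 * (\<alpha> + 1) / lam) * D"
      unfolding c_def by (rule bound) (use e in simp)
    also have "c * (d (\<xi> 0) (\<xi>' 0) + e / c) = c * d (\<xi> 0) (\<xi>' 0) + e" using c by (simp add: distrib_left)
    finally show "d (\<xi> t) (\<xi>' t) \<le> 8 * exp (- (lam / 8) * t) * d (\<xi> 0) (\<xi>' 0) + (4 * (\<alpha> + 1) / lam) * D + e"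
      by (simp add: c_def)
  qed
qed

text \<open>
  By uniqueness the solutions on the intervals \<open>[0,T]\<close> extend each other; the value at \<open>t\<close> can
  therefore be read off from the solution \<open>\<phi> t\<close> on \<open>[0,t]\<close>.
\<close>

lemma global_forward_solution:
  assumes complete: "Metric_space.mcomplete UNIV (riemannian_dist G)" and U: "convex U" and inp: "is_input U a \<infinity> \<upsilon>"
  obtains \<zeta> where "\<zeta> 0 = x" "\<And>T. T \<ge> 0 \<Longrightarrow> solves f \<upsilon> 0 T \<zeta>"
proof -
  have a0: "a < ereal 0" using inp by (auto simp: is_input_def zero_ereal_def)
  have window: "\<exists>K. compact K \<and> convex K \<and> K \<subseteq> U \<and> K \<noteq> {} \<and> admissible K 0 T \<upsilon>" if "T \<ge> 0" for T
    using is_input_admissible[OF inp U a0 that] by auto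
  have "\<exists>\<phi>. solves f \<upsilon> 0 T \<phi> \<and> \<phi> 0 = x" if "T \<ge> 0" for T
    using window[OF that] solution_exists[OF complete _ _ _ _ that] by metis
  then obtain \<phi> where \<phi>: "\<And>T. T \<ge> 0 \<Longrightarrow> solves f \<upsilon> 0 T (\<phi> T)" "\<And>T. T \<ge> 0 \<Longrightarrow> \<phi> T 0 = x" by metis
  have agree: "\<phi> t t = \<phi> T t" if "t \<in> {0..T}" for t T
  proof -
    have t: "t \<ge> 0" "t \<le> T" using that by auto
    obtain K where K: "compact K" "convex K" "K \<subseteq> U" "K \<noteq> {}" "admissible K 0 t \<upsilon>" using window[OF t(1)] by blast
    have "solves f \<upsilon> 0 t (\<phi> T)" using solves_subinterval[OF \<phi>(1)[of T]] t by auto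
    then show ?thesis
      using solves_unique[OF smooth_field_imp_lipschitz_field[OF f K(1-4)] K(5) \<phi>(1)[OF t(1)]] \<phi>(2) t by auto
  qed
  show thesis
  proof (rule that[of "\<lambda>t. \<phi> t t"])
    show "\<phi> 0 0 = x" using \<phi>(2) by simp
    show "solves f \<upsilon> 0 T (\<lambda>t. \<phi> t t)" if "T \<ge> 0" for T
      by (rule solves_cong[OF \<phi>(1)[OF that]]) (rule agree)
  qed
qed

text \<open>
  In both parts of the definition a solution for positive times is attached at time 0 to a curve in
  the past: a short backward solution in the first part, the given trajectory in the second.
\<close>

lemma contracting_imp_forward_complete:
  assumes complete: "Metric_space.mcomplete UNIV (riemannian_dist G)" and U: "convex U"
  shows "forward_complete U f"
  unfolding forward_complete_def
proof (intro allI impI conjI)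
  fix a \<upsilon> x assume inp: "is_input U a \<infinity> \<upsilon>"
  have a0: "a < 0" using inp by (simp add: is_input_def)
  obtain p where p: "a < ereal p" "ereal p < 0" using ereal_dense2[OF a0] by blast
  have p0: "p < 0" using p(2) by (simp add: zero_ereal_def)
  obtain K where K: "compact K" "convex K" "K \<subseteq> U" "K \<noteq> {}" "admissible K p 0 \<upsilon>"
    by (rule is_input_admissible[OF inp U p(1) less_imp_le[OF p0]]) (simp, rule that, assumption+)
  obtain e \<xi> where e: "p \<le> e" "e < 0" and \<xi>: "solves f \<upsilon> e 0 \<xi>" "\<xi> 0 = x"
    by (rule local_backward_solution[OF smooth_field_imp_lipschitz_field[OF f K(1-4)] K(5) p0]) (rule that, assumption+)
  obtain \<zeta> where \<zeta>: "\<zeta> 0 = x" "\<And>T. T \<ge> 0 \<Longrightarrow> solves f \<upsilon> 0 T \<zeta>"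
    by (rule global_forward_solution[OF complete U inp]) (rule that, assumption+)
  have ae: "a \<le> ereal e" using p(1) e(1) by (meson ereal_less_eq(3) less_imp_le order_trans)
  have "is_input U (ereal e) \<infinity> \<upsilon>" by (rule is_input_restrict[OF inp ae]) (use e in \<open>simp add: zero_ereal_def\<close>)
  then have "trajectory U f (ereal e) \<infinity> \<upsilon> (\<lambda>t. if t \<le> 0 then \<xi> t else \<zeta> t)"
    by (rule glue_trajectory) (use \<zeta> \<xi> solves_subinterval[OF \<xi>(1)] in auto)
  then show "\<exists>c\<ge>a. \<exists>\<xi>. trajectory U f c \<infinity> \<upsilon> \<xi> \<and> \<xi> 0 = x"
    using ae \<xi>(2) by (intro exI[of _ "ereal e"] conjI exI[of _ "\<lambda>t. if t \<le> 0 then \<xi> t else \<zeta> t"]) auto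
next
  fix a \<upsilon> c b \<xi> assume inp: "is_input U a \<infinity> \<upsilon>" and c: "a \<le> c" and tr: "trajectory U f c b \<upsilon> \<xi>"
  have c0: "c < 0" and b0: "0 < b" and inpc: "is_input U c b \<upsilon>" using tr by (auto simp: trajectory_def is_input_def)
  have inf: "is_input U c \<infinity> \<upsilon>" by (rule is_input_restrict[OF inp c c0])
  obtain \<zeta> where \<zeta>: "\<zeta> 0 = \<xi> 0" "\<And>T. T \<ge> 0 \<Longrightarrow> solves f \<upsilon> 0 T \<zeta>"
    by (rule global_forward_solution[OF complete U inp]) (rule that, assumption+)
  have part: "solves f \<upsilon> p q \<xi>" if pq: "c < ereal p" "p \<le> q" "ereal q < b" for p q
  proof -
    obtain K where K: "compact K" "convex K" "K \<subseteq> U" "K \<noteq> {}" "admissible K p q \<upsilon>"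
      by (rule is_input_admissible[OF inpc U pq]) (rule that, assumption+)
    show ?thesis by (rule trajectory_solves[OF tr smooth_field_imp_lipschitz_field[OF f K(1-4)] K(5) pq(1,3)])
  qed
  have same: "\<zeta> t = \<xi> t" if t: "0 \<le> t" "ereal t < b" for t
  proof -
    have c0': "c < ereal 0" using c0 by (simp add: zero_ereal_def)
    obtain K where K: "compact K" "convex K" "K \<subseteq> U" "K \<noteq> {}" "admissible K 0 t \<upsilon>"
      by (rule is_input_admissible[OF inpc U c0' t]) (rule that, assumption+)
    show ?thesis
      by (rule solves_unique[OF smooth_field_imp_lipschitz_field[OF f K(1-4)] K(5) \<zeta>(2)[OF t(1)] part[OF c0' t] \<zeta>(1)]) (use t in simp)
  qed
  have "trajectory U f c \<infinity> \<upsilon> (\<lambda>t. if t \<le> 0 then \<xi> t else \<zeta> t)"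
  proof (rule glue_trajectory[OF inf _ \<zeta>(2)])
    show "solves f \<upsilon> e 0 \<xi>" if "c < ereal e" "e \<le> 0" for e
      by (rule part[OF that]) (use b0 in \<open>simp add: zero_ereal_def\<close>)
  qed (use \<zeta> in auto)
  moreover have "(if t \<le> 0 then \<xi> t else \<zeta> t) = \<xi> t" if "t \<in> einterval c b" for t
    using same[of t] that by (auto simp: einterval_iff)
  ultimately show "\<exists>\<zeta>. trajectory U f c \<infinity> \<upsilon> \<zeta> \<and> (\<forall>t\<in>einterval c b. \<zeta> t = \<xi> t)" by blast
qed

end

lemma class_Kinf_linear:
  assumes "c > 0" shows "class_Kinf (\<lambda>r. c * r)"
  unfolding class_Kinf_def class_K_def
proof (intro conjI)
  show "strict_mono_on {0..} (\<lambda>r. c * r)" using assms by (intro strict_mono_onI) simp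
  show "filterlim (\<lambda>r. c * r) at_top at_top"
    by (rule filterlim_tendsto_pos_mult_at_top[OF tendsto_const assms filterlim_ident])
qed (auto intro: continuous_intros)

lemma class_KL_exponential:
  assumes "k > 0" "c > 0" shows "class_KL (\<lambda>r s. c * exp (- k * s) * r)"
  unfolding class_KL_def
proof (intro conjI allI impI)
  show "continuous_on ({0..} \<times> {0..}) (\<lambda>(r, s). c * exp (- k * s) * r)"
    unfolding case_prod_unfold by (intro continuous_intros)
  show "class_Kinf (\<lambda>r. c * exp (- k * s) * r)" for s
    using class_Kinf_linear[of "c * exp (- k * s)"] assms by simp
  fix r :: real assume r: "r > 0"
  show "antimono_on {0..} (\<lambda>s. c * exp (- k * s) * r)"
    using assms r by (intro monotone_onI) (auto intro!: mult_right_mono)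
  have "filterlim (\<lambda>s. - k * s) at_bot at_top"
    using assms by (intro filterlim_tendsto_neg_mult_at_bot[OF tendsto_const _ filterlim_ident]) auto
  then have "((\<lambda>s. exp (- k * s)) \<longlongrightarrow> 0) at_top" by (rule filterlim_compose[OF exp_at_bot])
  then have "((\<lambda>s. c * exp (- k * s) * r) \<longlongrightarrow> c * 0 * r) at_top" by (intro tendsto_intros)
  then show "((\<lambda>s. c * exp (- k * s) * r) \<longlongrightarrow> 0) at_top" by simp
qed

lemma contraction_metric_states_contracting:
  assumes "contraction_metric_states U f G" obtains lam where "contracting U f G lam 0 {0}"
proof -
  obtain lam where "lam > 0" "\<And>u X x. u \<in> U \<Longrightarrow> form (contraction_matrix f G x u) X X \<le> - lam * form (G x) X X"
    using assms by (auto simp: contraction_metric_states_def)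
  then have "contracting U f G lam 0 {0}"
    unfolding contracting_def by (auto simp: form_simps subspace_single_0)
  then show thesis by (rule that)
qed

lemma sqrt_form_mat_1: "sqrt (form (mat 1) Y Y) = norm Y"
  by (simp add: form_def norm_eq_sqrt_inner)

lemma contraction_metric_states_inputs_contracting:
  assumes "contraction_metric_states_inputs U f G" obtains lam \<alpha> where "contracting U f G lam \<alpha> UNIV"
proof -
  obtain lam \<alpha> where pos: "lam > 0" "\<alpha> \<ge> 0" and H: "\<forall>X x. \<forall>u\<in>U. \<forall>Y.
      form (contraction_matrix f G x u) X X + 2 * form (G x) (jac_u f x u *v Y) X
        \<le> - lam * form (G x) X X + \<alpha> * sqrt (form (G x) X X) * sqrt (form (mat 1) Y Y)"
    using assms unfolding contraction_metric_states_inputs_def by blast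
  have "contracting U f G lam \<alpha> UNIV"
    unfolding contracting_def gnorm_def using pos H by (simp add: sqrt_form_mat_1)
  then show thesis by (rule that)
qed

theorem theorem3p11:
  fixes U :: "(real^'m) set"
    and f :: "real^'n \<Rightarrow> real^'m \<Rightarrow> real^'n"
    and G :: "real^'n \<Rightarrow> real^'n^'n"
  assumes "smooth_control_system U f"
    and "riemannian_metric G"
    and "convex U"
    and "Metric_space UNIV (riemannian_dist G)"
    and "Metric_space.mcomplete UNIV (riemannian_dist G)"
  shows "(contraction_metric_states_inputs U f G \<longrightarrow> delta_ISS U f) \<and>
         (contraction_metric_states U f G \<longrightarrow> delta_GAS U f)"
proof (intro conjI impI)
  have f: "smooth_field U f" using assms(1) by (simp add: smooth_control_system_def smooth_field_def)
  {
    assume "contraction_metric_states_inputs U f G"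
    then obtain lam \<alpha> where con: "contracting U f G lam \<alpha> UNIV" by (rule contraction_metric_states_inputs_contracting)
    interpret contracting_system U f G lam \<alpha> UNIV
      by (rule contracting_system.intro) (use f assms con in auto)
    define c where "c = 4 * (\<alpha> + 1) / lam"
    have c: "c > 0" using lam_pos \<alpha>_nonneg by (simp add: c_def)
    show "delta_ISS U f"
      unfolding delta_ISS_def
    proof (intro conjI exI allI impI)
      show "forward_complete U f" by (rule contracting_imp_forward_complete[OF assms(5,3)])
      show "Metric_space UNIV (riemannian_dist G)" by fact
      show "class_KL (\<lambda>r s. 8 * exp (- (lam / 8) * s) * r)" using lam_pos by (intro class_KL_exponential) auto
      show "class_Kinf (\<lambda>r. c * r)" by (rule class_Kinf_linear[OF c])
      fix a b and \<upsilon> \<upsilon>' :: "real \<Rightarrow> real^'m" and \<xi> \<xi>' t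
      let ?s = "sup_norm a b (\<lambda>s. \<upsilon> s - \<upsilon>' s)"
      assume *: "trajectory U f a b \<upsilon> \<xi> \<and> trajectory U f a b \<upsilon>' \<xi>' \<and> 0 \<le> t \<and> ereal t < b \<and> ?s < \<infinity>"
      have a0: "a < ereal 0" using * by (auto simp: trajectory_def is_input_def zero_ereal_def)
      have "AE s in lebesgue_on (einterval a b \<inter> {0..}). ennreal (norm (\<upsilon> s - \<upsilon>' s)) \<le> ?s"
        unfolding sup_norm_def by (rule esssup_AE)
      then have "AE s in lebesgue_on {0..t}. ennreal (norm (\<upsilon> s - \<upsilon>' s)) \<le> ?s"
        by (rule AE_lebesgue_on_subset) (use einterval_Icc[OF a0, of t b] * in auto)
      then have "AE s in lebesgue_on {0..t}. \<upsilon>' s - \<upsilon> s \<in> UNIV \<and> norm (\<upsilon>' s - \<upsilon> s) \<le> enn2real ?s"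
      proof eventually_elim
        case (elim s)
        then have "enn2real (ennreal (norm (\<upsilon> s - \<upsilon>' s))) \<le> enn2real ?s" using * by (intro enn2real_mono) auto
        then show ?case by (simp add: norm_minus_commute)
      qed
      from trajectory_estimate[OF assms(5,3) _ _ _ _ enn2real_nonneg this]
      show "d (\<xi> t) (\<xi>' t) \<le> 8 * exp (- (lam / 8) * t) * d (\<xi> 0) (\<xi>' 0) + c * enn2real ?s"
        using * unfolding c_def by blast
    qed
  }
  {
    assume "contraction_metric_states U f G"
    then obtain lam where con: "contracting U f G lam 0 {0}" by (rule contraction_metric_states_contracting)
    interpret contracting_system U f G lam 0 "{0}"
      by (rule contracting_system.intro) (use f assms con in auto)
    show "delta_GAS U f"
      unfolding delta_GAS_def
    proof (intro conjI exI allI impI)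
      show "forward_complete U f" by (rule contracting_imp_forward_complete[OF assms(5,3)])
      show "Metric_space UNIV (riemannian_dist G)" by fact
      show "class_KL (\<lambda>r s. 8 * exp (- (lam / 8) * s) * r)" using lam_pos by (intro class_KL_exponential) auto
      fix a b \<upsilon> \<xi> \<xi>' t
      assume *: "trajectory U f a b \<upsilon> \<xi> \<and> trajectory U f a b \<upsilon> \<xi>' \<and> 0 \<le> t \<and> ereal t < b"
      have "AE s in lebesgue_on {0..t}. \<upsilon> s - \<upsilon> s \<in> {0} \<and> norm (\<upsilon> s - \<upsilon> s) \<le> 0" by simp
      from trajectory_estimate[OF assms(5,3) _ _ _ _ order_refl this] *
      show "d (\<xi> t) (\<xi>' t) \<le> 8 * exp (- (lam / 8) * t) * d (\<xi> 0) (\<xi>' 0)" by auto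
    qed
  }
qed

end
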